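(* Let $0<s<\frac12$, $C_0>0$, and let $\beta(\theta)=C_0\frac{|\cos\theta|}{|\sin\theta|^{1+2s}}$ for $-\frac{\pi}{2}\le\theta\le\frac{\pi}{2}$. Let $f_0\in L^1_{2+2s}(\mathbb{R})\cap L\log L(\mathbb{R})$ with $f_0\ge 0$ and $f_0\not\equiv 0$. Let $T_0>0$ and let $f\in L^\infty([0,T_0];L^1_{2+2s}(\mathbb{R})\cap L\log L(\mathbb{R}))$ be a nonnegative weak solution on $[0,T_0]$ of the Cauchy problem $\partial_t f=K(f,f)$, $f|_{t=0}=f_0$, for the spatially homogeneous Kac equation with kernel $\beta$. Then for every $0<s'<s$ there exists $0<T_*\le T_0$ such that $$f(t,\cdot)\in G^{\frac{1}{2s'}}(\mathbb{R})\qquad\text{for every } 0<t\le T_*.$$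
   Context: Kac operator: $K(f,g)(v)=\int_{\mathbb{R}}\int_{-\pi/2}^{\pi/2}\beta(\theta)\{f(v_*')g(v')-f(v_* )g(v)\}\,d\theta\,dv_*$, where $v'=v\cos\theta-v_*\sin\theta$, $v_*'=v\sin\theta+v_*\cos\theta$. Function spaces: $\langle v\rangle=(1+|v|^2)^{1/2}$; $\|f\|_{L^p_\ell}=\|\langle v\rangle^\ell f\|_{L^p}$; $L\log L=\{f:\int|f|\log(1+|f|)\,dv<\infty\}$. Gevrey class: for $\alpha\ge 1$, $u\in G^\alpha(\mathbb{R}^n)$ means there is $C>0$ with $\|D^k u\|_{L^2(\mathbb{R}^n)}\le C^{k+1}(k!)^\alpha$ for all $k\in\mathbb{N}$; equivalently there is $c_0>0$ such that $e^{c_0\langle D\rangle^{1/\alpha}}u\in L^2(\mathbb{R}^n)$, where $\langle D\rangle=(1+|D_v|^2)^{1/2}$ is a Fourier multiplier. Nonnegative weak solution on $[0,T_0]$: a function $f\ge0$ such that for every $\varphi\in C_c^\infty(\mathbb{R})$ and every $t\in[0,T_0]$, $$\int f(t,v)\varphi(v)\,dv-\int f_0\varphi\,dv=\int_0^t\iint_{\mathbb{R}^2}\int_{-\pi/2}^{\pi/2}\beta(\theta)f(\tau,v_* )f(\tau,v)\big(\varphi(v')-\varphi(v)\big)\,d\theta\,dv_*\,dv\,d\tau,$$ and which satisfies, for all $t$, conservation of mass $\int f(t,v)\,dv=\int f_0\,dv$, conservation of energy $\int f(t,v)|v|^2dv=\int f_0|v|^2dv$, and the entropy inequality $\int f(t,v)\log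 f(t,v)\,dv\le\int f_0\log f_0\,dv$. *)

theory Defs
  imports "HOL-Analysis.Analysis"
begin

text \<open>
  Functions in Lebesgue spaces are represented by actual functions, with pointwise conditions read
  almost everywhere. All integrals are Bochner integrals for the (complete) Lebesgue measure.
\<close>

definition test_function :: "(real \<Rightarrow> real) \<Rightarrow> bool" where
  "test_function \<phi> \<longleftrightarrow>
     (\<forall>k x. ((deriv ^^ k) \<phi>) differentiable (at x)) \<and> compact (closure {x. \<phi> x \<noteq> 0})"

definition japanese :: "real \<Rightarrow> real" where
  "japanese v = sqrt (1 + v\<^sup>2)"

definition weighted_L1 :: "real \<Rightarrow> (real \<Rightarrow> real) set" where
  "weighted_L1 l = {g. integrable lebesgue (\<lambda>v. japanese v powr l * g v)}"

definition weighted_L1_norm :: "real \<Rightarrow> (real \<Rightarrow> real) \<Rightarrow> real" where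
  "weighted_L1_norm l g = (LINT v|lebesgue. \<bar>japanese v powr l * g v\<bar>)"

definition LlogL :: "(real \<Rightarrow> real) set" where
  "LlogL = {g \<in> borel_measurable lebesgue.
              integrable lebesgue (\<lambda>v. \<bar>g v\<bar> * ln (1 + \<bar>g v\<bar>))}"

text \<open>
  The class \<open>L\<^sup>\<infinity>([0,T]; L\<^sup>1\<^sub>l \<inter> LlogL)\<close>. Since \<open>L\<^sup>1\<^sub>l\<close> is separable, strong measurability of
  \<open>t \<mapsto> f t\<close> amounts to joint Lebesgue measurability of \<open>(t, v) \<mapsto> f t v\<close>, for suitable
  representatives of the \<open>f t\<close>.
\<close>
definition Linfty_L1_LlogL :: "real \<Rightarrow> real \<Rightarrow> (real \<Rightarrow> real \<Rightarrow> real) set" where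
  "Linfty_L1_LlogL T l = {f.
     (\<lambda>(t, v). f t v) \<in> borel_measurable (lebesgue_on ({0..T} \<times> UNIV)) \<and>
     (\<exists>M. AE t in lebesgue_on {0..T}.
        f t \<in> weighted_L1 l \<inter> LlogL \<and>
        weighted_L1_norm l (f t) \<le> M \<and>
        (LINT v|lebesgue. \<bar>f t v\<bar> * ln (1 + \<bar>f t v\<bar>)) \<le> M)}"

text \<open>The value at the singularity \<open>\<theta> = 0\<close> is \<open>0\<close>, by the convention on division by zero; it is
  irrelevant for the integrals.\<close>
definition kac_kernel :: "real \<Rightarrow> real \<Rightarrow> real \<Rightarrow> real" where
  "kac_kernel C0 s \<theta> = C0 * \<bar>cos \<theta>\<bar> / \<bar>sin \<theta>\<bar> powr (1 + 2 * s)"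

text \<open>The post-collisional velocity \<open>v'\<close>; the argument \<open>w\<close> stands for \<open>v\<^sub>*\<close>.\<close>
definition post_velocity :: "real \<Rightarrow> real \<Rightarrow> real \<Rightarrow> real" where
  "post_velocity v w \<theta> = v * cos \<theta> - w * sin \<theta>"

text \<open>\<open>\<langle>K(g,g), \<phi>\<rangle>\<close> in weak form, i.e. with the difference transferred to the test function.\<close>
definition kac_weak_form :: "(real \<Rightarrow> real) \<Rightarrow> (real \<Rightarrow> real) \<Rightarrow> (real \<Rightarrow> real) \<Rightarrow> real" where
  "kac_weak_form \<beta> g \<phi> =
     (LINT p|(lebesgue :: (real \<times> real) measure).
        (case p of (v, w) \<Rightarrow>
           (LINT \<theta>:{-pi/2..pi/2}|lebesgue.
              \<beta> \<theta> * g w * g v * (\<phi> (post_velocity v w \<theta>) - \<phi> v))))"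

text \<open>
  The integrability requirements say that mass, energy and entropy are finite, since the Bochner
  integral of a non-integrable function is \<open>0\<close>. For kernels with \<open>|\<theta>| \<beta>(\<theta>)\<close> integrable, finite mass
  and energy already make the integral in \<open>kac_weak_form\<close> absolutely convergent, because test
  functions are Lipschitz.
\<close>
definition kac_weak_solution ::
    "(real \<Rightarrow> real) \<Rightarrow> (real \<Rightarrow> real) \<Rightarrow> real \<Rightarrow> (real \<Rightarrow> real \<Rightarrow> real) \<Rightarrow> bool" where
  "kac_weak_solution \<beta> f0 T f \<longleftrightarrow>
     (\<forall>t\<in>{0..T}.
        (AE v in lebesgue. 0 \<le> f t v) \<and>
        (\<forall>\<phi>. test_function \<phi> \<longrightarrow>
           (LINT v|lebesgue. f t v * \<phi> v) - (LINT v|lebesgue. f0 v * \<phi> v)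
             = (LINT \<tau>:{0..t}|lebesgue. kac_weak_form \<beta> (f \<tau>) \<phi>)) \<and>
        integrable lebesgue (f t) \<and>
        (LINT v|lebesgue. f t v) = (LINT v|lebesgue. f0 v) \<and>
        integrable lebesgue (\<lambda>v. f t v * \<bar>v\<bar>\<^sup>2) \<and>
        (LINT v|lebesgue. f t v * \<bar>v\<bar>\<^sup>2) = (LINT v|lebesgue. f0 v * \<bar>v\<bar>\<^sup>2) \<and>
        integrable lebesgue (\<lambda>v. f t v * ln (f t v)) \<and>
        (LINT v|lebesgue. f t v * ln (f t v)) \<le> (LINT v|lebesgue. f0 v * ln (f0 v)))"

text \<open>\<open>g\<close> is the \<open>k\<close>-th distributional derivative of \<open>u\<close>.\<close>
definition weak_derivative :: "nat \<Rightarrow> (real \<Rightarrow> real) \<Rightarrow> (real \<Rightarrow> real) \<Rightarrow> bool" where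
  "weak_derivative k u g \<longleftrightarrow>
     (\<forall>a b. u absolutely_integrable_on {a..b} \<and> g absolutely_integrable_on {a..b}) \<and>
     (\<forall>\<phi>. test_function \<phi> \<longrightarrow>
        (LINT v|lebesgue. u v * (deriv ^^ k) \<phi> v)
          = (- 1) ^ k * (LINT v|lebesgue. g v * \<phi> v))"

definition gevrey :: "real \<Rightarrow> (real \<Rightarrow> real) set" where
  "gevrey \<alpha> = {u. \<exists>C>0. \<forall>k. \<exists>g.
     weak_derivative k u g \<and>
     g \<in> borel_measurable lebesgue \<and> integrable lebesgue (\<lambda>v. (g v)\<^sup>2) \<and>
     sqrt (LINT v|lebesgue. (g v)\<^sup>2) \<le> C ^ (k + 1) * fact k powr \<alpha>}"

end

theory Submission
  imports Defs "HOL-Probability.Characteristic_Functions" "HOL-Probability.Sinc_Integral"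
begin

text \<open>
  The Fourier transform \<open>F(t, \<xi>)\<close> of a solution satisfies, pointwise in \<open>\<xi>\<close>, Bobylev's equation
  \<open>\<partial>\<^sub>t F(\<xi>) = \<integral> \<beta>(\<theta>) (F(\<xi> cos \<theta>) F(- \<xi> sin \<theta>) - F(0) F(\<xi>)) d\<theta>\<close>. A maximum principle for it compares
  \<open>|F|\<close> with the barrier \<open>m exp (- c t \<psi>(\<xi>))\<close>, where \<open>m\<close> is the mass and
  \<open>\<psi>(\<xi>) = (1 + \<xi>\<^sup>2) powr s - 1\<close>. Since \<open>\<psi>\<close> is a subadditive function of \<open>\<xi>\<^sup>2\<close>, the collision
  term is nonpositive at a first contact point; angles \<open>\<theta>\<close> of order \<open>1 / |\<xi>|\<close> contribute a strictly
  negative amount of order \<open>|\<xi>| powr (2 * s)\<close>, because \<open>m - |F(t, \<zeta>)| \<ge> \<delta> \<zeta>\<^sup>2\<close> for small \<open>\<zeta>\<close>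
  and small times. This dominates \<open>c \<psi>\<close>. The gap holds at time \<open>0\<close> because \<open>f0\<close> charges two disjoint
  intervals, and persists because averages against test functions are Lipschitz in time. The decay
  \<open>|F(t, \<xi>)| \<le> M exp (- c t |\<xi>| powr (2 * s))\<close> gives the Gevrey bounds, even with \<open>s' = s\<close>.
\<close>

section \<open>Fourier decay and Gevrey regularity\<close>

text \<open>The condition \<open>s < 1 / 2\<close> makes
  \<open>\<beta> \<theta> * |sin \<theta>|\<close> integrable, so the Lipschitz constant of a test
  function controls the singular collision integral, with no symmetrisation in
  \<open>\<theta>\<close>. This is what lets \<open>cos (\<xi> * v)\<close> and
  \<open>sin (\<xi> * v)\<close>, which lack compact support, be reached as limits of test
  functions; the constants depend on mass and energy only.

  The barrier is built on \<open>(1 + \<xi>\<^sup>2) powr s - 1\<close> rather than on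
  \<open>|\<xi>| powr (2 * s)\<close> because it must fit the gap at low frequency: being at most
  \<open>\<xi>\<^sup>2\<close>, it keeps the barrier above
  \<open>m - \<delta> * \<xi>\<^sup>2\<close> when \<open>c * t\<close> is small. With the pure
  power the barrier would fall below \<open>|F|\<close> near the origin, where finite energy makes
  \<open>m - |F|\<close> at most quadratic. The time interval is shortened only for the persistence
  of the gap; the low frequency comparison is arranged by a small \<open>c\<close>.

  The statement integrates against the completed Lebesgue measure, whereas Fubini is applied to
  Borel representatives on \<open>lborel\<close>.\<close>

lemma integrable_pair_mult:
  fixes A :: "'a::euclidean_space \<Rightarrow> 'c::{real_normed_field, banach, second_countable_topology}"
    and B :: "'b::euclidean_space \<Rightarrow> 'c"
  assumes A: "integrable lborel A" and B: "integrable lborel B"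
  shows "integrable (lborel \<Otimes>\<^sub>M lborel) (\<lambda>(x, y). A x * B y)"
proof (rule lborel_pair.Fubini_integrable)
  have [measurable]: "A \<in> borel_measurable borel" "B \<in> borel_measurable borel"
    using A B by (simp_all add: borel_measurable_integrable)
  show "(\<lambda>(x, y). A x * B y) \<in> borel_measurable (lborel \<Otimes>\<^sub>M lborel)"
    by measurable
  show "integrable lborel (\<lambda>x. \<integral>y. norm (case (x, y) of (x, y) \<Rightarrow> A x * B y) \<partial>lborel)"
    using A by (simp add: norm_mult integrable_norm)
  show "AE x in lborel. integrable lborel (\<lambda>y. case (x, y) of (x, y) \<Rightarrow> A x * B y)"
    using B by simp
qed

lemma integrable_pair_kernel:
  fixes A :: "'a::euclidean_space \<Rightarrow> complex" and B :: "'b::euclidean_space \<Rightarrow> complex"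
  assumes A: "integrable lborel A" and B: "integrable lborel B"
    and K[measurable]: "(\<lambda>(x, y). K x y) \<in> borel_measurable (borel \<Otimes>\<^sub>M borel)"
    and K1: "\<And>x y. norm (K x y) \<le> (1 :: real)"
  shows "integrable (lborel \<Otimes>\<^sub>M lborel) (\<lambda>(x, y). A x * B y * K x y)"
proof (rule Bochner_Integration.integrable_bound[OF integrable_pair_mult[OF A B]])
  have [measurable]: "A \<in> borel_measurable borel" "B \<in> borel_measurable borel"
    using A B by (simp_all add: borel_measurable_integrable)
  show "(\<lambda>(x, y). A x * B y * K x y) \<in> borel_measurable (lborel \<Otimes>\<^sub>M lborel)"
    by measurable
  show "AE z in lborel \<Otimes>\<^sub>M lborel. norm (case z of (x, y) \<Rightarrow> A x * B y * K x y)
      \<le> norm (case z of (x, y) \<Rightarrow> A x * B y)"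
    by (intro always_eventually allI) (auto simp: norm_mult intro!: mult_left_le K1)
qed

text \<open>A kernel bounded by 1 costs no integrability, so Fubini rests on the two factors alone.
  With the kernel \<open>cis\<close> this moves a Fourier transform from one factor to the
  other.\<close>

lemma integral_kernel_swap:
  fixes A :: "'a::euclidean_space \<Rightarrow> complex" and B :: "'b::euclidean_space \<Rightarrow> complex"
  assumes A: "integrable lborel A" and B: "integrable lborel B"
    and K: "(\<lambda>(x, y). K x y) \<in> borel_measurable (borel \<Otimes>\<^sub>M borel)"
    and K1: "\<And>x y. norm (K x y) \<le> (1 :: real)"
  shows "(\<integral>x. A x * (\<integral>y. B y * K x y \<partial>lborel) \<partial>lborel) = (\<integral>y. B y * (\<integral>x. A x * K x y \<partial>lborel) \<partial>lborel)"
proof -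
  have "(\<integral>y. (\<integral>x. A x * B y * K x y \<partial>lborel) \<partial>lborel) = (\<integral>x. (\<integral>y. A x * B y * K x y \<partial>lborel) \<partial>lborel)"
    by (rule lborel_pair.Fubini_integral) (use integrable_pair_kernel[OF assms] in auto)
  moreover have "(\<integral>x. A x * B y * K x y \<partial>lborel) = B y * (\<integral>x. A x * K x y \<partial>lborel)" for y
    by (subst integral_mult_right_zero[symmetric]) (simp add: ac_simps)
  moreover have "(\<integral>y. A x * B y * K x y \<partial>lborel) = A x * (\<integral>y. B y * K x y \<partial>lborel)" for x
    by (subst integral_mult_right_zero[symmetric]) (simp add: ac_simps)
  ultimately show ?thesis by simp
qed

lemma cis_measurable[measurable]: "cis \<in> borel_measurable borel"
  by (intro borel_measurable_continuous_onI continuous_intros)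

lemma cnj_measurable[measurable]: "cnj \<in> borel_measurable borel"
  by (intro borel_measurable_continuous_onI continuous_intros)

section \<open>Gaussian regularisation: Fourier inversion and the L2 bound\<close>

text \<open>The transform is read off from the characteristic function of the standard normal law by
  scaling. It is written as a multiple of \<open>std_normal_density (t / e)\<close> because, as a
  function of \<open>t\<close>, it is then visibly an approximate identity of mass
  \<open>2 * pi\<close> as \<open>e\<close> tends to 0.\<close>

lemma gaussian_fourier:
  fixes t e :: real assumes "e > 0"
  shows "integrable lborel (\<lambda>x. exp (- (e * x)\<^sup>2 / 2))"
    and "(\<integral>x. complex_of_real (exp (- (e * x)\<^sup>2 / 2)) * cis (t * x) \<partial>lborel)
       = complex_of_real (2 * pi / e * std_normal_density (t / e))"
proof -
  have i0: "integrable lborel (\<lambda>x::real. exp (- x\<^sup>2 / 2) :: real)"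
    using integrable_std_normal_moment[of 0, THEN integrable_mult_right, of "sqrt (2 * pi)"]
    by (simp add: std_normal_density_def)
  then show "integrable lborel (\<lambda>x. exp (- (e * x)\<^sup>2 / 2))"
    using lborel_integrable_real_affine[of "\<lambda>x. exp (- x\<^sup>2 / 2)" e 0] assms by simp
  have c: "(\<integral>x. complex_of_real (exp (- x\<^sup>2 / 2)) * cis (u * x) \<partial>lborel) = complex_of_real (sqrt (2 * pi) * exp (- u\<^sup>2 / 2))" for u
  proof -
    have "complex_of_real (exp (- (u^2) / 2)) = (\<integral>x. std_normal_density x *\<^sub>R iexp (u * x) \<partial>lborel)"
      using fun_cong[OF char_std_normal_distribution, of u]
      unfolding char_def by (subst (asm) integral_density) auto
    also have "\<dots> = (\<integral>x. complex_of_real (1 / sqrt (2 * pi)) * (complex_of_real (exp (- x\<^sup>2 / 2)) * cis (u * x)) \<partial>lborel)"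
      by (intro Bochner_Integration.integral_cong) (auto simp: std_normal_density_def scaleR_conv_of_real cis_conv_exp)
    also have "\<dots> = complex_of_real (1 / sqrt (2 * pi)) * (\<integral>x. complex_of_real (exp (- x\<^sup>2 / 2)) * cis (u * x) \<partial>lborel)"
      by simp
    finally show ?thesis by (simp add: field_simps)
  qed
  have "(\<integral>x. complex_of_real (exp (- x\<^sup>2 / 2)) * cis (t / e * x) \<partial>lborel)
     = e *\<^sub>R (\<integral>x. complex_of_real (exp (- (e * x)\<^sup>2 / 2)) * cis (t * x) \<partial>lborel)"
    using lborel_integral_real_affine[of e "\<lambda>x. complex_of_real (exp (- x\<^sup>2 / 2)) * cis (t / e * x)" 0] assms
    by simp
  then have "(\<integral>x. complex_of_real (exp (- (e * x)\<^sup>2 / 2)) * cis (t * x) \<partial>lborel) = complex_of_real (sqrt (2 * pi) * exp (- (t / e)\<^sup>2 / 2) / e)"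
    using assms c[of "t / e"] by (simp add: field_simps scaleR_conv_of_real)
  also have "sqrt (2 * pi) * exp (- (t / e)\<^sup>2 / 2) / e = (2 * pi / sqrt (2 * pi)) * exp (- (t / e)\<^sup>2 / 2) / e"
    by (subst real_div_sqrt) auto
  also have "\<dots> = 2 * pi / e * std_normal_density (t / e)"
    by (simp add: std_normal_density_def)
  finally show "(\<integral>x. complex_of_real (exp (- (e * x)\<^sup>2 / 2)) * cis (t * x) \<partial>lborel)
       = complex_of_real (2 * pi / e * std_normal_density (t / e))" .
qed

text \<open>The triple integral over \<open>v\<close>, \<open>x\<close> and \<open>\<xi>\<close> is
  not absolutely convergent, so a Gaussian factor in \<open>\<xi>\<close> is inserted before the
  order of integration is changed. The \<open>\<xi>\<close>-integral then becomes a Gaussian average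
  of \<open>\<phi>\<close> at scale \<open>e n\<close>, which tends to
  \<open>2 * pi * \<phi> v\<close>. Pairing with \<open>\<phi>\<close> avoids a pointwise inversion
  of \<open>g\<close>.\<close>

lemma fourier_inversion_weak:
  fixes g :: "real \<Rightarrow> real" and \<phi> :: "real \<Rightarrow> complex"
  assumes g: "integrable lborel g"
    and F: "integrable lborel (\<lambda>\<xi>. \<integral>v. g v *\<^sub>R cis (\<xi> * v) \<partial>lborel)"
    and \<phi>: "integrable lborel \<phi>" and cont: "continuous_on UNIV \<phi>" and bdd: "\<And>x. norm (\<phi> x) \<le> B"
  shows "(\<integral>\<xi>. (\<integral>v. g v *\<^sub>R cis (\<xi> * v) \<partial>lborel) * (\<integral>x. \<phi> x * cis (- (\<xi> * x)) \<partial>lborel) \<partial>lborel)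
       = 2 * pi * (\<integral>v. g v *\<^sub>R \<phi> v \<partial>lborel)"
proof -
  define F where "F \<xi> = (\<integral>v. g v *\<^sub>R cis (\<xi> * v) \<partial>lborel)" for \<xi>
  define P where "P \<xi> = (\<integral>x. \<phi> x * cis (- (\<xi> * x)) \<partial>lborel)" for \<xi>
  define e where "e n = 1 / real (Suc n)" for n
  define \<gamma> where "\<gamma> n \<xi> = exp (- (e n * \<xi>)\<^sup>2 / 2)" for n \<xi>
  define R where "R n v = 2 * pi * (\<integral>z. std_normal_density z *\<^sub>R \<phi> (v - e n * z) \<partial>lborel)" for n v
  have e0: "e n > 0" for n by (simp add: e_def)
  have elim: "e \<longlonglongrightarrow> 0" unfolding e_def by (rule LIMSEQ_Suc[OF lim_1_over_n])
  have [measurable]: "g \<in> borel_measurable borel" "\<phi> \<in> borel_measurable borel"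
    using g \<phi> by (simp_all add: borel_measurable_integrable)
  have [measurable]: "P \<in> borel_measurable borel" "F \<in> borel_measurable borel"
    unfolding P_def F_def by measurable
  have [measurable]: "\<gamma> n \<in> borel_measurable borel" for n
    unfolding \<gamma>_def by measurable
  have Fint: "integrable lborel F" using F unfolding F_def .
  have Pb: "norm (P \<xi>) \<le> (\<integral>x. norm (\<phi> x) \<partial>lborel)" for \<xi>
    unfolding P_def by (rule order_trans[OF integral_norm_bound]) (simp add: norm_mult)
  have \<gamma>1: "0 \<le> \<gamma> n \<xi>" "\<gamma> n \<xi> \<le> 1" for n \<xi> unfolding \<gamma>_def by auto
  have \<gamma>i: "integrable lborel (\<gamma> n)" for n
    using gaussian_fourier(1)[OF e0[of n]] unfolding \<gamma>_def .
  have \<gamma>P: "integrable lborel (\<lambda>\<xi>. complex_of_real (\<gamma> n \<xi>) * P \<xi>)" for n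
    by (rule Bochner_Integration.integrable_bound[OF integrable_mult_left[OF \<gamma>i[of n], of "\<integral>x. norm (\<phi> x) \<partial>lborel"]])
      (use \<gamma>1 Pb in \<open>auto simp: norm_mult intro!: mult_left_mono order_trans[OF _ abs_ge_self]\<close>)
  have inner: "(\<integral>\<xi>. (complex_of_real (\<gamma> n \<xi>) * P \<xi>) * cis (\<xi> * v) \<partial>lborel) = R n v" for n v
  proof -
    have "(\<integral>\<xi>. (complex_of_real (\<gamma> n \<xi>) * P \<xi>) * cis (\<xi> * v) \<partial>lborel)
       = (\<integral>\<xi>. complex_of_real (\<gamma> n \<xi>) * (\<integral>x. \<phi> x * cis ((v - x) * \<xi>) \<partial>lborel) \<partial>lborel)"
    proof (rule Bochner_Integration.integral_cong[OF refl])
      fix \<xi>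
      have "P \<xi> * cis (\<xi> * v) = (\<integral>x. \<phi> x * cis ((v - x) * \<xi>) \<partial>lborel)"
        unfolding P_def
        by (subst integral_mult_left_zero[symmetric]) (simp add: cis_mult algebra_simps)
      then show "(complex_of_real (\<gamma> n \<xi>) * P \<xi>) * cis (\<xi> * v)
         = complex_of_real (\<gamma> n \<xi>) * (\<integral>x. \<phi> x * cis ((v - x) * \<xi>) \<partial>lborel)"
        by (simp add: mult.assoc)
    qed
    also have "\<dots> = (\<integral>x. \<phi> x * (\<integral>\<xi>. complex_of_real (\<gamma> n \<xi>) * cis ((v - x) * \<xi>) \<partial>lborel) \<partial>lborel)"
      by (rule integral_kernel_swap) (use \<gamma>i[of n] \<phi> in auto)
    also have "\<dots> = (\<integral>x. \<phi> x * complex_of_real (2 * pi / e n * std_normal_density ((v - x) / e n)) \<partial>lborel)"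
      unfolding \<gamma>_def gaussian_fourier(2)[OF e0] ..
    \<comment> \<open>The substitution \<open>x = v - e n * z\<close>; its Jacobian cancels the
      factor \<open>1 / e n\<close>.\<close>
    also have "\<dots> = e n *\<^sub>R (\<integral>z. \<phi> (v - e n * z) * complex_of_real (2 * pi / e n * std_normal_density z) \<partial>lborel)"
      using lborel_integral_real_affine[of "- e n" "\<lambda>x. \<phi> x * complex_of_real (2 * pi / e n * std_normal_density ((v - x) / e n))" v] e0[of n]
      by simp
    also have "\<dots> = R n v"
      unfolding R_def integral_scaleR_right[symmetric] integral_mult_right_zero[symmetric]
      using e0[of n] by (intro Bochner_Integration.integral_cong) (auto simp: scaleR_conv_of_real)
    finally show ?thesis .
  qed
  have I: "(\<integral>\<xi>. complex_of_real (\<gamma> n \<xi>) * P \<xi> * F \<xi> \<partial>lborel) = (\<integral>v. g v *\<^sub>R R n v \<partial>lborel)" for n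
  proof -
    have "(\<integral>\<xi>. complex_of_real (\<gamma> n \<xi>) * P \<xi> * F \<xi> \<partial>lborel)
      = (\<integral>\<xi>. complex_of_real (\<gamma> n \<xi>) * P \<xi> * (\<integral>v. complex_of_real (g v) * cis (\<xi> * v) \<partial>lborel) \<partial>lborel)"
      by (simp add: F_def scaleR_conv_of_real)
    also have "\<dots> = (\<integral>v. complex_of_real (g v) * (\<integral>\<xi>. (complex_of_real (\<gamma> n \<xi>) * P \<xi>) * cis (\<xi> * v) \<partial>lborel) \<partial>lborel)"
      by (rule integral_kernel_swap[OF \<gamma>P]) (use g in auto)
    finally show ?thesis by (simp add: inner scaleR_conv_of_real)
  qed
  have std: "integrable lborel std_normal_density" "(\<integral>z. std_normal_density z \<partial>lborel) = 1"
    by (auto simp: integral_normal_density)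
  have [measurable]: "R n \<in> borel_measurable borel" for n unfolding R_def by measurable
  have Rlim: "(\<lambda>n. R n v) \<longlonglongrightarrow> 2 * pi * \<phi> v" for v
  proof -
    have "(\<lambda>n. \<integral>z. std_normal_density z *\<^sub>R \<phi> (v - e n * z) \<partial>lborel) \<longlonglongrightarrow> (\<integral>z. std_normal_density z *\<^sub>R \<phi> v \<partial>lborel)"
    proof (rule integral_dominated_convergence[where w = "\<lambda>z. std_normal_density z * B"])
      show "AE z in lborel. (\<lambda>n. std_normal_density z *\<^sub>R \<phi> (v - e n * z)) \<longlonglongrightarrow> std_normal_density z *\<^sub>R \<phi> v"
      proof (intro AE_I2 tendsto_scaleR tendsto_const)
        fix z
        have "isCont \<phi> v" using cont by (simp add: continuous_on_eq_continuous_at)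
        moreover have "(\<lambda>n. v - e n * z) \<longlonglongrightarrow> v - 0 * z" by (intro tendsto_intros elim)
        ultimately show "(\<lambda>n. \<phi> (v - e n * z)) \<longlonglongrightarrow> \<phi> v"
          using isCont_tendsto_compose[of v \<phi> "\<lambda>n. v - e n * z"] by simp
      qed
    qed (use std bdd in \<open>auto intro!: mult_left_mono\<close>)
    then have "(\<lambda>n. R n v) \<longlonglongrightarrow> 2 * pi * (\<integral>z. std_normal_density z *\<^sub>R \<phi> v \<partial>lborel)"
      unfolding R_def by (intro tendsto_intros)
    then show ?thesis using std by simp
  qed
  have Rb: "norm (R n v) \<le> 2 * pi * B" for n v
  proof -
    have "norm (\<integral>z. std_normal_density z *\<^sub>R \<phi> (v - e n * z) \<partial>lborel) \<le> (\<integral>z. std_normal_density z * B \<partial>lborel)"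
    proof (rule Bochner_Integration.integral_norm_bound_integral)
      show "integrable lborel (\<lambda>z. std_normal_density z * B)" using std by simp
      then show "integrable lborel (\<lambda>z. std_normal_density z *\<^sub>R \<phi> (v - e n * z))"
        by (rule Bochner_Integration.integrable_bound)
          (use bdd in \<open>auto intro!: mult_left_mono order_trans[OF _ abs_ge_self] simp: abs_mult\<close>)
    qed (use bdd in \<open>auto intro!: mult_left_mono\<close>)
    then show ?thesis using std unfolding R_def by (simp add: norm_mult)
  qed
  have "(\<lambda>n. \<integral>v. g v *\<^sub>R R n v \<partial>lborel) \<longlonglongrightarrow> (\<integral>v. g v *\<^sub>R (2 * pi * \<phi> v) \<partial>lborel)"
  proof (rule integral_dominated_convergence[where w = "\<lambda>v. \<bar>g v\<bar> * (2 * pi * B)"])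
    show "AE v in lborel. (\<lambda>n. g v *\<^sub>R R n v) \<longlonglongrightarrow> g v *\<^sub>R (2 * pi * \<phi> v)"
      by (intro AE_I2 tendsto_scaleR tendsto_const Rlim)
    show "AE v in lborel. norm (g v *\<^sub>R R n v) \<le> \<bar>g v\<bar> * (2 * pi * B)" for n
      by (intro AE_I2) (simp add: Rb mult_left_mono del: mult.assoc)
  qed (use g in auto)
  \<comment> \<open>On the frequency side the dominating function is \<open>|F|\<close> times the L1
    norm of \<open>\<phi>\<close>, which bounds \<open>P\<close>; this is where the integrability of
    \<open>F\<close> enters.\<close>
  moreover have "(\<lambda>n. \<integral>\<xi>. complex_of_real (\<gamma> n \<xi>) * P \<xi> * F \<xi> \<partial>lborel) \<longlonglongrightarrow> (\<integral>\<xi>. complex_of_real 1 * P \<xi> * F \<xi> \<partial>lborel)"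
  proof (rule integral_dominated_convergence[where w = "\<lambda>\<xi>. norm (F \<xi>) * (\<integral>x. norm (\<phi> x) \<partial>lborel)"])
    show "AE \<xi> in lborel. (\<lambda>n. complex_of_real (\<gamma> n \<xi>) * P \<xi> * F \<xi>) \<longlonglongrightarrow> complex_of_real 1 * P \<xi> * F \<xi>"
    proof (intro AE_I2 tendsto_intros)
      fix \<xi>
      have "(\<lambda>n. exp (- (e n * \<xi>)\<^sup>2 / 2)) \<longlonglongrightarrow> exp (- (0 * \<xi>)\<^sup>2 / 2)" by (intro tendsto_intros elim) auto
      then show "(\<lambda>n. \<gamma> n \<xi>) \<longlonglongrightarrow> 1" unfolding \<gamma>_def by simp
    qed
    show "AE \<xi> in lborel. norm (complex_of_real (\<gamma> n \<xi>) * P \<xi> * F \<xi>) \<le> norm (F \<xi>) * (\<integral>x. norm (\<phi> x) \<partial>lborel)" for n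
    proof (intro AE_I2)
      fix \<xi>
      have "\<gamma> n \<xi> * norm (P \<xi>) \<le> 1 * (\<integral>x. norm (\<phi> x) \<partial>lborel)"
        using \<gamma>1 Pb by (intro mult_mono) auto
      then show "norm (complex_of_real (\<gamma> n \<xi>) * P \<xi> * F \<xi>) \<le> norm (F \<xi>) * (\<integral>x. norm (\<phi> x) \<partial>lborel)"
        using \<gamma>1 by (simp add: norm_mult mult.commute mult_left_mono)
    qed
  qed (use Fint in auto)
  ultimately have "(\<integral>v. g v *\<^sub>R (2 * pi * \<phi> v) \<partial>lborel) = (\<integral>\<xi>. complex_of_real 1 * P \<xi> * F \<xi> \<partial>lborel)"
    unfolding I using LIMSEQ_unique by blast
  then show ?thesis
    unfolding F_def[symmetric] P_def[symmetric] integral_mult_right_zero[symmetric]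
    by (simp add: mult.commute mult.left_commute)
qed

text \<open>Half of Plancherel's theorem: damp \<open>|u|\<^sup>2\<close> by a Gaussian, whose Fourier transform is an
  approximate identity of mass \<open>2 * pi\<close>, and apply Fatou's lemma.\<close>
lemma fourier_L2_bound:
  fixes G :: "real \<Rightarrow> complex"
  assumes G: "integrable lborel G" and G2: "integrable lborel (\<lambda>\<xi>. (norm (G \<xi>))\<^sup>2)"
  defines "u \<equiv> \<lambda>x. \<integral>\<xi>. G \<xi> * cis (- (\<xi> * x)) \<partial>lborel"
  shows "integrable lborel (\<lambda>x. (norm (u x))\<^sup>2)"
    and "(\<integral>x. (norm (u x))\<^sup>2 \<partial>lborel) \<le> 2 * pi * (\<integral>\<xi>. (norm (G \<xi>))\<^sup>2 \<partial>lborel)"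
proof -
  define J where "J = (\<integral>\<xi>. (norm (G \<xi>))\<^sup>2 \<partial>lborel)"
  have J0: "J \<ge> 0" unfolding J_def by simp
  have [measurable]: "G \<in> borel_measurable borel"
    using G by (simp add: borel_measurable_integrable)
  have [measurable]: "u \<in> borel_measurable borel" unfolding u_def by measurable
  define N where "N = (\<integral>\<xi>. norm (G \<xi>) \<partial>lborel)"
  have ub: "norm (u x) \<le> N" for x
    unfolding u_def N_def by (rule order_trans[OF integral_norm_bound]) (simp add: norm_mult)
  have u2: "complex_of_real ((norm (u x))\<^sup>2) = (\<integral>p. (case p of (\<xi>, \<eta>) \<Rightarrow> G \<xi> * cnj (G \<eta>)) * cis ((snd p - fst p) * x) \<partial>lborel)" for x
  proof -
    have cc: "(G \<xi> * cis (- (\<xi> * x))) * cnj (G \<eta> * cis (- (\<eta> * x))) = (G \<xi> * cnj (G \<eta>)) * cis ((\<eta> - \<xi>) * x)" for \<xi> \<eta>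
    proof -
      have 1: "cis (- (\<xi> * x)) * cnj (cis (- (\<eta> * x))) = cis ((\<eta> - \<xi>) * x)"
        by (simp add: cis_cnj cis_mult algebra_simps)
      have "(G \<xi> * cis (- (\<xi> * x))) * cnj (G \<eta> * cis (- (\<eta> * x))) =
          (G \<xi> * cnj (G \<eta>)) * (cis (- (\<xi> * x)) * cnj (cis (- (\<eta> * x))))"
        by (simp add: ac_simps del: cis_cnj)
      then show ?thesis unfolding 1 .
    qed
    have "complex_of_real ((norm (u x))\<^sup>2) = u x * cnj (u x)"
      by (rule complex_norm_square)
    also have "\<dots> = (\<integral>\<xi>. (\<integral>\<eta>. (G \<xi> * cis (- (\<xi> * x))) * cnj (G \<eta> * cis (- (\<eta> * x))) \<partial>lborel) \<partial>lborel)"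
      unfolding u_def integral_cnj[symmetric] by (simp del: complex_cnj_mult)
    also have "\<dots> = (\<integral>p. (case p of (\<xi>, \<eta>) \<Rightarrow> (G \<xi> * cis (- (\<xi> * x))) * cnj (G \<eta> * cis (- (\<eta> * x)))) \<partial>(lborel \<Otimes>\<^sub>M lborel))"
    proof (rule lborel_pair.integral_fst)
      have 1: "integrable lborel (\<lambda>\<xi>. G \<xi> * cis (- (\<xi> * x)))"
        by (rule Bochner_Integration.integrable_bound[OF G]) (auto simp: norm_mult)
      have 2: "integrable lborel (\<lambda>\<eta>. cnj (G \<eta> * cis (- (\<eta> * x))))"
        using 1 by (simp only: integrable_cnj)
      show "integrable (lborel \<Otimes>\<^sub>M lborel) (\<lambda>(\<xi>, \<eta>). (G \<xi> * cis (- (\<xi> * x))) * cnj (G \<eta> * cis (- (\<eta> * x))))"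
        by (rule integrable_pair_mult[OF 1 2])
    qed
    finally show ?thesis by (simp only: cc lborel_prod case_prod_beta')
  qed
  have main: "(\<integral>x. exp (- (e * x)\<^sup>2 / 2) * (norm (u x))\<^sup>2 \<partial>lborel) \<le> 2 * pi * J" if e: "e > 0" for e :: real
  proof -
    define k where "k y = 2 * pi / e * std_normal_density (y / e)" for y
    have k0: "k y \<ge> 0" and ksym: "k (- y) = k y" for y
      using e by (auto simp: k_def std_normal_density_def)
    have [measurable]: "k \<in> borel_measurable borel" unfolding k_def by measurable
    have std: "integrable lborel std_normal_density" "(\<integral>z. std_normal_density z \<partial>lborel) = 1"
      by (auto simp: integral_normal_density)
    have aff: "- c / e + 1 / e * y = (y - c) / e" for c y
      by (simp add: diff_divide_distrib)
    have ki: "integrable lborel (\<lambda>y. k (y - c))" for c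
      using lborel_integrable_real_affine[OF std(1), of "1 / e" "- c / e"] e
      unfolding aff by (simp add: k_def)
    have kI: "(\<integral>y. k (y - c) \<partial>lborel) = 2 * pi" for c
    proof -
      have "(\<integral>y. std_normal_density ((y - c) / e) \<partial>lborel) = e"
        using lborel_integral_real_affine[of "1 / e" std_normal_density "- c / e"] e std
        unfolding aff by (simp add: field_simps)
      then show ?thesis unfolding k_def using e by simp
    qed
    have kc: "k (c - y) = k (y - c)" for c y
      using ksym[of "y - c"] by simp
    have ki': "integrable lborel (\<lambda>y. k (c - y))" for c
      unfolding kc by (rule ki)
    have kI': "(\<integral>y. k (c - y) \<partial>lborel) = 2 * pi" for c
      unfolding kc by (rule kI)
    \<comment> \<open>Schur's test: \<open>|G \<xi>| * |G \<eta>|\<close> is at most half the sum of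
      the squares, and integrating \<open>k (\<eta> - \<xi>)\<close> in either variable alone gives
      \<open>2 * pi\<close>. The two square terms are prepared here.\<close>
    have A1: "integrable (lborel \<Otimes>\<^sub>M lborel) (\<lambda>(\<xi>, \<eta>). (norm (G \<xi>))\<^sup>2 * k (\<eta> - \<xi>))"
      by (rule lborel_pair.Fubini_integrable) (use ki kI G2 k0 in \<open>auto simp: abs_mult\<close>)
    have A2: "integrable (lborel \<Otimes>\<^sub>M lborel) (\<lambda>(\<eta>, \<xi>). (norm (G \<eta>))\<^sup>2 * k (\<eta> - \<xi>))"
      by (rule lborel_pair.Fubini_integrable) (use ki' kI' G2 k0 in \<open>auto simp: abs_mult\<close>)
    have A2': "integrable (lborel \<Otimes>\<^sub>M lborel) (\<lambda>(\<xi>, \<eta>). (norm (G \<eta>))\<^sup>2 * k (\<eta> - \<xi>))"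
      using lborel_pair.integrable_product_swap[OF A2] by (simp add: case_prod_beta')
    have V1: "(\<integral>p. (case p of (\<xi>, \<eta>) \<Rightarrow> (norm (G \<xi>))\<^sup>2 * k (\<eta> - \<xi>)) \<partial>(lborel \<Otimes>\<^sub>M lborel)) = 2 * pi * J"
      using lborel_pair.integral_fst[OF A1] kI by (simp add: J_def mult.commute)
    have V2: "(\<integral>p. (case p of (\<xi>, \<eta>) \<Rightarrow> (norm (G \<eta>))\<^sup>2 * k (\<eta> - \<xi>)) \<partial>(lborel \<Otimes>\<^sub>M lborel)) = 2 * pi * J"
      using lborel_pair.integral_snd[OF A2'] kI' by (simp add: J_def mult.commute)
    have Km: "(\<lambda>(x, p). cis ((snd p - fst p) * x)) \<in> borel_measurable ((borel :: real measure) \<Otimes>\<^sub>M (borel :: (real \<times> real) measure))"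
      unfolding borel_prod case_prod_beta' by (intro borel_measurable_continuous_onI continuous_intros)
    have "complex_of_real (\<integral>x. exp (- (e * x)\<^sup>2 / 2) * (norm (u x))\<^sup>2 \<partial>lborel)
        = (\<integral>x. complex_of_real (exp (- (e * x)\<^sup>2 / 2)) * complex_of_real ((norm (u x))\<^sup>2) \<partial>lborel)"
      by (simp only: integral_complex_of_real[symmetric] of_real_mult)
    also have "\<dots> = (\<integral>x. complex_of_real (exp (- (e * x)\<^sup>2 / 2)) *
       (\<integral>p. (case p of (\<xi>, \<eta>) \<Rightarrow> G \<xi> * cnj (G \<eta>)) * cis ((snd p - fst p) * x) \<partial>lborel) \<partial>lborel)"
      unfolding u2 ..
    also have "\<dots> = (\<integral>p. (case p of (\<xi>, \<eta>) \<Rightarrow> G \<xi> * cnj (G \<eta>)) *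
        (\<integral>x. complex_of_real (exp (- (e * x)\<^sup>2 / 2)) * cis ((snd p - fst p) * x) \<partial>lborel) \<partial>lborel)"
      by (rule integral_kernel_swap)
        (use gaussian_fourier(1)[OF e] integrable_pair_mult[OF G, of "\<lambda>\<eta>. cnj (G \<eta>)"] G Km in \<open>auto simp: lborel_prod\<close>)
    also have "\<dots> = (\<integral>p. (case p of (\<xi>, \<eta>) \<Rightarrow> G \<xi> * cnj (G \<eta>)) * complex_of_real (k (snd p - fst p)) \<partial>lborel)"
      unfolding gaussian_fourier(2)[OF e] k_def ..
    finally have eq: "complex_of_real (\<integral>x. exp (- (e * x)\<^sup>2 / 2) * (norm (u x))\<^sup>2 \<partial>lborel)
        = (\<integral>p. (case p of (\<xi>, \<eta>) \<Rightarrow> G \<xi> * cnj (G \<eta>)) * complex_of_real (k (snd p - fst p)) \<partial>lborel)" .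
    have S: "integrable lborel (\<lambda>p. case p of (\<xi>, \<eta>) \<Rightarrow> ((norm (G \<xi>))\<^sup>2 * k (\<eta> - \<xi>) + (norm (G \<eta>))\<^sup>2 * k (\<eta> - \<xi>)) / 2)"
      using Bochner_Integration.integrable_add[OF A1 A2', THEN integrable_divide_zero, of 2]
      by (simp add: case_prod_beta' lborel_prod)
    have pw: "norm ((case p of (\<xi>, \<eta>) \<Rightarrow> G \<xi> * cnj (G \<eta>)) * complex_of_real (k (snd p - fst p)))
      \<le> (case p of (\<xi>, \<eta>) \<Rightarrow> ((norm (G \<xi>))\<^sup>2 * k (\<eta> - \<xi>) + (norm (G \<eta>))\<^sup>2 * k (\<eta> - \<xi>)) / 2)" for p
    proof -
      obtain \<xi> \<eta> where p: "p = (\<xi>, \<eta>)" by force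
      have "norm (G \<xi>) * norm (G \<eta>) \<le> ((norm (G \<xi>))\<^sup>2 + (norm (G \<eta>))\<^sup>2) / 2"
        using sum_squares_bound[of "norm (G \<xi>)" "norm (G \<eta>)"] by simp
      then have "norm (G \<xi>) * norm (G \<eta>) * k (\<eta> - \<xi>) \<le> ((norm (G \<xi>))\<^sup>2 + (norm (G \<eta>))\<^sup>2) / 2 * k (\<eta> - \<xi>)"
        by (rule mult_right_mono) (rule k0)
      then show ?thesis using k0[of "\<eta> - \<xi>"] by (simp add: p norm_mult algebra_simps add_divide_distrib)
    qed
    have "(\<integral>x. exp (- (e * x)\<^sup>2 / 2) * (norm (u x))\<^sup>2 \<partial>lborel) \<le>
        norm (complex_of_real (\<integral>x. exp (- (e * x)\<^sup>2 / 2) * (norm (u x))\<^sup>2 \<partial>lborel))"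
      by simp
    also have "\<dots> \<le> (\<integral>p. (case p of (\<xi>, \<eta>) \<Rightarrow> ((norm (G \<xi>))\<^sup>2 * k (\<eta> - \<xi>) + (norm (G \<eta>))\<^sup>2 * k (\<eta> - \<xi>)) / 2) \<partial>lborel)"
      unfolding eq
      by (rule Bochner_Integration.integral_norm_bound_integral[OF Bochner_Integration.integrable_bound[OF S] S])
        (use pw in \<open>auto simp: case_prod_beta' lborel_prod[symmetric] intro!: order_trans[OF _ abs_ge_self]\<close>)
    also have "\<dots> = 2 * pi * J"
      using Bochner_Integration.integral_add[OF A1 A2'] V1 V2 by (simp add: case_prod_beta' lborel_prod)
    finally show ?thesis .
  qed
  have bound: "(\<integral>\<^sup>+x. ennreal ((norm (u x))\<^sup>2) \<partial>lborel) \<le> ennreal (2 * pi * J)"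
  proof -
    define w where "w n x = exp (- (1 / real (Suc n) * x)\<^sup>2 / 2) * (norm (u x))\<^sup>2" for n x
    have [measurable]: "w n \<in> borel_measurable borel" for n unfolding w_def by measurable
    have lim: "(\<lambda>n. w n x) \<longlonglongrightarrow> (norm (u x))\<^sup>2" for x
    proof -
      have "(\<lambda>n. w n x) \<longlonglongrightarrow> exp (- (0 * x)\<^sup>2 / 2) * (norm (u x))\<^sup>2"
        unfolding w_def by (intro tendsto_intros LIMSEQ_Suc[OF lim_1_over_n]) auto
      then show ?thesis by simp
    qed
    have "(\<integral>\<^sup>+x. ennreal ((norm (u x))\<^sup>2) \<partial>lborel) = (\<integral>\<^sup>+x. liminf (\<lambda>n. ennreal (w n x)) \<partial>lborel)"
      by (intro nn_integral_cong lim_imp_Liminf[symmetric] tendsto_ennrealI lim) auto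
    also have "\<dots> \<le> liminf (\<lambda>n. \<integral>\<^sup>+x. ennreal (w n x) \<partial>lborel)"
      by (rule nn_integral_liminf) measurable
    also have "\<dots> \<le> limsup (\<lambda>n. \<integral>\<^sup>+x. ennreal (w n x) \<partial>lborel)"
      by (rule Liminf_le_Limsup) auto
    also have "\<dots> \<le> ennreal (2 * pi * J)"
    proof (rule Limsup_bounded, intro always_eventually allI)
      fix n
      have "integrable lborel (w n)"
        by (rule Bochner_Integration.integrable_bound[OF integrable_mult_left[OF gaussian_fourier(1)[of "1 / real (Suc n)"], of "N\<^sup>2"]])
          (use ub in \<open>auto simp: w_def abs_mult power_mono intro!: mult_left_mono\<close>)
      moreover have "w n x \<ge> 0" for x unfolding w_def by simp
      ultimately have "(\<integral>\<^sup>+x. ennreal (w n x) \<partial>lborel) = ennreal (\<integral>x. w n x \<partial>lborel)"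
        by (intro nn_integral_eq_integral) auto
      also have "\<dots> \<le> ennreal (2 * pi * J)"
        using main[of "1 / real (Suc n)"] unfolding w_def by (intro ennreal_leI) simp
      finally show "(\<integral>\<^sup>+x. ennreal (w n x) \<partial>lborel) \<le> ennreal (2 * pi * J)" .
    qed
    finally show ?thesis .
  qed
  show int: "integrable lborel (\<lambda>x. (norm (u x))\<^sup>2)"
    by (rule integrableI_bounded) (use bound in \<open>auto simp: top_unique less_top[symmetric]\<close>)
  have "ennreal (\<integral>x. (norm (u x))\<^sup>2 \<partial>lborel) \<le> ennreal (2 * pi * J)"
    using bound nn_integral_eq_integral[OF int] by simp
  then show "(\<integral>x. (norm (u x))\<^sup>2 \<partial>lborel) \<le> 2 * pi * (\<integral>\<xi>. (norm (G \<xi>))\<^sup>2 \<partial>lborel)"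
    using J0 by (simp add: J_def ennreal_le_iff)
qed

section \<open>Exponential decay against powers and factorials\<close>

text \<open>This is \<open>z ^ k / fact k \<le> exp z\<close> at
  \<open>z = a / p * |x| powr (1 / p)\<close>, raised to the power \<open>p\<close>. The rate is
  divided by \<open>p\<close> beforehand so that the exponent comes out as
  \<open>a * |x| powr (1 / p)\<close>.\<close>

lemma abs_power_le_exp_powr:
  fixes x a p :: real
  assumes "0 < p" "0 < a"
  shows "\<bar>x\<bar> ^ k \<le> fact k powr p * ((p / a) powr p) ^ k * exp (a * \<bar>x\<bar> powr (1 / p))"
proof -
  define y where "y = \<bar>x\<bar> powr (1 / p)"
  have y0: "y \<ge> 0" unfolding y_def by simp
  have b0: "a / p > 0" using assms by simp
  have "(a / p * y) ^ k / fact k \<le> (\<Sum>n. (a / p * y) ^ n / fact n)"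
    using y0 b0 sum_le_suminf[of "\<lambda>n. (a / p * y) ^ n / fact n" "{k}"] summable_exp[of "a / p * y"]
    by (simp add: divide_inverse mult.commute)
  then have "(a / p * y) ^ k / fact k \<le> exp (a / p * y)"
    unfolding exp_def by (simp add: divide_inverse mult.commute)
  then have "(a / p * y) ^ k \<le> fact k * exp (a / p * y)"
    by (subst (asm) pos_divide_le_eq) (auto simp: mult.commute)
  then have "(p / a) ^ k * (a / p * y) ^ k \<le> (p / a) ^ k * (fact k * exp (a / p * y))"
    using assms by (intro mult_left_mono) auto
  moreover have "(p / a) ^ k * (a / p * y) ^ k = y ^ k"
    using assms by (simp flip: power_mult_distrib)
  ultimately have "y ^ k \<le> fact k * (p / a) ^ k * exp (a / p * y)"
    by (simp add: ac_simps)
  then have "(y ^ k) powr p \<le> (fact k * (p / a) ^ k * exp (a / p * y)) powr p"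
    using y0 assms by (intro powr_mono2) auto
  also have "\<dots> = fact k powr p * ((p / a) ^ k) powr p * exp (a * y)"
    using assms by (simp add: powr_mult exp_powr_real)
  also have "((p / a) ^ k) powr p = ((p / a) powr p) ^ k"
    using assms by (simp add: powr_power powr_realpow[symmetric] powr_powr mult.commute)
  also have "(y ^ k) powr p = \<bar>x\<bar> ^ k"
  proof (cases "x = 0")
    case True then show ?thesis using assms unfolding y_def by (cases k) auto
  next
    case False
    then have "(y ^ k) powr p = \<bar>x\<bar> powr real k"
      unfolding y_def using assms by (simp add: powr_realpow[symmetric] powr_powr)
    then show ?thesis using False by (simp add: powr_realpow)
  qed
  finally show ?thesis unfolding y_def .
qed

text \<open>The case \<open>k = 2\<close> of the preceding bound makes the exponential smaller than
  a multiple of \<open>1 / (1 + x\<^sup>2)\<close>.\<close>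

lemma integrable_exp_neg_powr:
  fixes a p :: real
  assumes "0 < p" "0 < a"
  shows "integrable lborel (\<lambda>x. exp (- (a * \<bar>x\<bar> powr (1 / p))))"
proof -
  define K where "K = fact 2 powr p * ((p / a) powr p) ^ 2"
  have K0: "K \<ge> 0" unfolding K_def by simp
  have i: "integrable lborel (\<lambda>x::real. inverse (1 + x\<^sup>2))"
    using integrable_inverse_1_plus_square by (simp add: set_integrable_def)
  show ?thesis
  proof (rule Bochner_Integration.integrable_bound[OF integrable_mult_right[OF i, of "1 + K"]])
    show "AE x in lborel. norm (exp (- (a * \<bar>x\<bar> powr (1 / p)))) \<le> norm ((1 + K) * inverse (1 + x\<^sup>2))"
    proof (intro AE_I2)
      fix x :: real
      define e where "e = exp (a * \<bar>x\<bar> powr (1 / p))"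
      have e1: "e \<ge> 1" unfolding e_def using assms by simp
      have "x\<^sup>2 \<le> K * e"
        using abs_power_le_exp_powr[OF assms, of x 2] unfolding K_def e_def by simp
      then have "1 + x\<^sup>2 \<le> (1 + K) * e" using e1 by (simp add: algebra_simps)
      then have "inverse e \<le> (1 + K) * inverse (1 + x\<^sup>2)"
        using e1 by (simp add: field_simps add_pos_nonneg)
      then show "norm (exp (- (a * \<bar>x\<bar> powr (1 / p)))) \<le> norm ((1 + K) * inverse (1 + x\<^sup>2))"
        using K0 by (simp add: e_def exp_minus)
    qed
  qed simp
qed

section \<open>Test functions and their Fourier transforms\<close>

lemma test_function_support:
  assumes "test_function \<phi>"
  obtains R where "R > 0" "\<And>j x. \<bar>x\<bar> > R \<Longrightarrow> (deriv ^^ j) \<phi> x = 0"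
proof -
  have "bounded {x. \<phi> x \<noteq> 0}"
    using assms unfolding test_function_def by (meson bounded_subset closure_subset compact_imp_bounded)
  then obtain R where R: "R > 0" "\<And>x. \<phi> x \<noteq> 0 \<Longrightarrow> norm x \<le> R"
    unfolding bounded_pos by auto
  have "\<bar>x\<bar> > R \<Longrightarrow> (deriv ^^ j) \<phi> x = 0" for j x
  proof (induction j arbitrary: x)
    case 0 then show ?case using R(2)[of x] by fastforce
  next
    case (Suc j)
    have "((\<lambda>_. 0) has_field_derivative 0) (at x)" by simp
    then have "((deriv ^^ j) \<phi> has_field_derivative 0) (at x)"
    proof (rule has_field_derivative_transform_within_open[of _ _ _ "{y. R < \<bar>y\<bar>}"])
      show "open {y::real. R < \<bar>y\<bar>}" by (intro open_Collect_less continuous_intros)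
    qed (use Suc in auto)
    then show ?case by (simp add: DERIV_imp_deriv)
  qed
  then show ?thesis using R(1) that by blast
qed

lemma test_function_deriv:
  assumes "test_function \<phi>"
  shows "((deriv ^^ j) \<phi> has_real_derivative (deriv ^^ Suc j) \<phi> x) (at x)"
  using assms unfolding test_function_def
  by (simp add: DERIV_deriv_iff_real_differentiable)

lemma test_function_continuous:
  assumes "test_function \<phi>"
  shows "continuous_on S ((deriv ^^ j) \<phi>)"
  by (meson DERIV_continuous assms continuous_at_imp_continuous_on test_function_deriv)

lemma test_function_integrable:
  assumes "test_function \<phi>"
  shows "integrable lborel ((deriv ^^ j) \<phi>)" and "\<exists>B. \<forall>x. \<bar>(deriv ^^ j) \<phi> x\<bar> \<le> B"
proof -
  obtain R where R: "R > 0" "\<And>j x. \<bar>x\<bar> > R \<Longrightarrow> (deriv ^^ j) \<phi> x = 0"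
    using test_function_support[OF assms] by metis
  have "(\<lambda>x. indicator {- R..R} x *\<^sub>R (deriv ^^ j) \<phi> x) = (deriv ^^ j) \<phi>"
    using R(2) by (force simp: indicator_def)
  moreover have "integrable lborel (\<lambda>x. indicator {- R..R} x *\<^sub>R (deriv ^^ j) \<phi> x)"
    by (intro borel_integrable_compact test_function_continuous assms) auto
  ultimately show "integrable lborel ((deriv ^^ j) \<phi>)"
    by simp
  have "bounded ((deriv ^^ j) \<phi> ` {- R..R})"
    by (intro compact_imp_bounded compact_continuous_image test_function_continuous assms) auto
  then obtain B where B: "B > 0" "\<And>x. x \<in> {- R..R} \<Longrightarrow> \<bar>(deriv ^^ j) \<phi> x\<bar> \<le> B"
    unfolding bounded_pos by auto
  have "\<bar>(deriv ^^ j) \<phi> x\<bar> \<le> B" for x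
    using B R(2)[of x j] by (cases "x \<in> {- R..R}") (auto simp: abs_le_iff not_le)
  then show "\<exists>B. \<forall>x. \<bar>(deriv ^^ j) \<phi> x\<bar> \<le> B" by blast
qed

lemma has_vector_derivative_cis:
  "((\<lambda>x. cis (c * x)) has_vector_derivative c *\<^sub>R (\<i> * cis (c * x))) (at x within S)"
proof -
  have "((\<lambda>z. exp (\<i> * (complex_of_real c * z))) has_field_derivative c *\<^sub>R (\<i> * cis (c * x))) (at (complex_of_real x))"
    by (auto intro!: derivative_eq_intros simp: cis_conv_exp scaleR_conv_of_real)
  from has_vector_derivative_real_field[OF this] show ?thesis
    by (simp add: cis_conv_exp)
qed

lemma test_function_fourier_deriv:
  assumes "test_function \<phi>"
  shows "(\<integral>x. complex_of_real ((deriv ^^ j) \<phi> x) * cis (- (\<xi> * x)) \<partial>lborel)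
    = (\<i> * \<xi>) ^ j * (\<integral>x. complex_of_real (\<phi> x) * cis (- (\<xi> * x)) \<partial>lborel)"
proof (induction j)
  case (Suc j)
  obtain R where R: "R > 0" "\<And>j x. \<bar>x\<bar> > R \<Longrightarrow> (deriv ^^ j) \<phi> x = 0"
    using test_function_support[OF assms] by metis
  define D where "D i x = complex_of_real ((deriv ^^ i) \<phi> x) * cis (- (\<xi> * x))" for i x
  have [measurable]: "(deriv ^^ i) \<phi> \<in> borel_measurable borel" for i
    using test_function_integrable(1)[OF assms, of i] by (simp add: borel_measurable_integrable)
  have [measurable]: "D i \<in> borel_measurable borel" for i
    unfolding D_def by measurable
  have Dint: "integrable lborel (D i)" for i
    by (rule Bochner_Integration.integrable_bound[OF test_function_integrable(1)[OF assms, of i]])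
      (use test_function_integrable(1)[OF assms, of i] in \<open>auto simp: D_def norm_mult\<close>)
  \<comment> \<open>\<open>h\<close> is the derivative of \<open>D j\<close>, which vanishes at both
    ends of an interval around the support; hence \<open>h\<close> has integral 0. This is
    integration by parts without boundary terms.\<close>
  define h where "h x = D (Suc j) x - \<i> * \<xi> * D j x" for x
  have hint: "integrable lborel h" unfolding h_def using Dint by auto
  have hd: "(D j has_vector_derivative h x) (at x within S)" for x S
  proof -
    have "((\<lambda>x. complex_of_real ((deriv ^^ j) \<phi> x)) has_vector_derivative complex_of_real ((deriv ^^ Suc j) \<phi> x)) (at x within S)"
      by (rule has_vector_derivative_of_real[OF has_field_derivative_at_within[OF test_function_deriv[OF assms]]])
    moreover have "((\<lambda>x. cis (- (\<xi> * x))) has_vector_derivative (- \<xi>) *\<^sub>R (\<i> * cis (- (\<xi> * x)))) (at x within S)"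
      using has_vector_derivative_cis[of "- \<xi>" x S] by simp
    ultimately show ?thesis
      unfolding D_def h_def
      by (rule has_vector_derivative_mult[THEN has_vector_derivative_eq_rhs])
        (simp add: scaleR_conv_of_real algebra_simps)
  qed
  have "(h has_integral (D j (R + 1) - D j (- R - 1))) {- R - 1..R + 1}"
    using R(1) by (intro fundamental_theorem_of_calculus hd) auto
  then have "(h has_integral 0) {- R - 1..R + 1}" using R by (simp add: D_def)
  then have "((\<lambda>x. if x \<in> {- R - 1..R + 1} then h x else 0) has_integral 0) UNIV"
    by (simp only: has_integral_restrict_UNIV)
  moreover have "(\<lambda>x. if x \<in> {- R - 1..R + 1} then h x else 0) = h"
  proof
    fix x show "(if x \<in> {- R - 1..R + 1} then h x else 0) = h x"
      using R(2)[of x j] R(2)[of x "Suc j"] by (cases "R < \<bar>x\<bar>") (auto simp: h_def D_def abs_le_iff not_less)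
  qed
  ultimately have "(h has_integral 0) UNIV" by simp
  moreover have "(h has_integral (\<integral>x. h x \<partial>lborel)) UNIV"
    by (rule has_integral_integral_lborel[OF hint])
  ultimately have "(\<integral>x. h x \<partial>lborel) = 0" by (rule has_integral_unique[symmetric])
  then have "(\<integral>x. D (Suc j) x \<partial>lborel) = \<i> * \<xi> * (\<integral>x. D j x \<partial>lborel)"
    unfolding h_def using Dint by simp
  then show ?case using Suc unfolding D_def by simp
qed simp

section \<open>Fourier transforms for the completed measure\<close>

text \<open>Sign and normalisation are those of characteristic functions; the factor
  \<open>2 * pi\<close> therefore sits in the inversion formula.\<close>

definition fourier :: "(real \<Rightarrow> real) \<Rightarrow> real \<Rightarrow> complex" where
  "fourier g \<xi> = (LINT v|lebesgue. g v *\<^sub>R cis (\<xi> * v))"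

text \<open>The definitions integrate against the completed measure, while product measures and
  parameter integrals are handled on \<open>lborel\<close>. This carries an integral over to a Borel
  representative; \<open>integrable_lebesgue_eq_lborel\<close> does the same for
  integrability.\<close>

lemma integral_lebesgue_eq_lborel:
  fixes g h :: "'a::euclidean_space \<Rightarrow> 'b::{banach, second_countable_topology}"
  assumes "g \<in> borel_measurable lebesgue" "h \<in> borel_measurable borel" "AE v in lborel. g v = h v"
  shows "(LINT v|lebesgue. g v) = (LINT v|lborel. h v)"
proof -
  have h: "h \<in> borel_measurable lborel" using assms(2) by simp
  have "(LINT v|lebesgue. g v) = (LINT v|lebesgue. h v)"
    using assms(3) by (intro integral_cong_AE assms(1) measurable_completion[OF h] AE_completion)
  then show ?thesis by (simp add: integral_completion[OF h])
qed

lemma lebesgue_borel_representative: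
  fixes g :: "'a::euclidean_space \<Rightarrow> real"
  assumes "g \<in> borel_measurable lebesgue"
  obtains h where "h \<in> borel_measurable borel" "AE v in lborel. g v = h v"
  using completion_ex_borel_measurable_real[OF assms] by auto

lemma fourier_eq_lborel:
  assumes g: "g \<in> borel_measurable lebesgue" and h: "h \<in> borel_measurable borel"
    and "AE v in lborel. g v = h v"
  shows "fourier g \<xi> = (\<integral>v. h v *\<^sub>R cis (\<xi> * v) \<partial>lborel)"
  unfolding fourier_def
proof (rule integral_lebesgue_eq_lborel)
  have "(\<lambda>v. cis (\<xi> * v)) \<in> borel_measurable lborel" by measurable
  then show "(\<lambda>v. g v *\<^sub>R cis (\<xi> * v)) \<in> borel_measurable lebesgue"
    by (intro borel_measurable_scaleR g measurable_completion)
qed (use assms in auto)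

lemma integrable_lebesgue_eq_lborel:
  fixes g h :: "'a::euclidean_space \<Rightarrow> 'b::{banach, second_countable_topology}"
  assumes "g \<in> borel_measurable lebesgue" "h \<in> borel_measurable borel" "AE v in lborel. g v = h v"
  shows "integrable lebesgue g \<longleftrightarrow> integrable lborel h"
proof -
  have h: "h \<in> borel_measurable lborel" using assms(2) by simp
  have "integrable lebesgue g \<longleftrightarrow> integrable lebesgue h"
    using assms(3) by (intro integrable_cong_AE assms(1) measurable_completion[OF h] AE_completion)
  then show ?thesis by (simp add: integrable_completion[OF h])
qed

text \<open>The \<open>k\<close>-th derivative is obtained by inverting
  \<open>(- \<i> * \<xi>) ^ k * F \<xi> / (2 * pi)\<close>. Half of the exponential decay absorbs
  \<open>|\<xi>| ^ k\<close> at the price \<open>fact k powr p * B ^ k\<close>; the other half,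
  \<open>E\<close>, keeps the multiplied transform in L1 and L2. The L2 bound then yields the Gevrey
  estimate, and the weak inversion formula identifies the derivative.\<close>

lemma gevrey_if_fourier_decay:
  assumes g: "integrable lebesgue g" and p: "0 < p" "p \<le> \<alpha>" and a: "0 < a"
    and decay: "\<And>\<xi>. norm (fourier g \<xi>) \<le> M * exp (- (a * \<bar>\<xi>\<bar> powr (1 / p)))"
  shows "g \<in> gevrey \<alpha>"
proof -
  have gm: "g \<in> borel_measurable lebesgue" using g by (rule borel_measurable_integrable)
  obtain h where hm[measurable]: "h \<in> borel_measurable borel" and gh: "AE v in lborel. g v = h v"
    by (rule lebesgue_borel_representative[OF gm])
  have h: "integrable lborel h" using g integrable_lebesgue_eq_lborel[OF gm hm gh] by simp
  define F where "F \<xi> = (\<integral>v. h v *\<^sub>R cis (\<xi> * v) \<partial>lborel)" for \<xi>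
  have [measurable]: "F \<in> borel_measurable borel" unfolding F_def by measurable
  have dec: "norm (F \<xi>) \<le> M * exp (- (a * \<bar>\<xi>\<bar> powr (1 / p)))" for \<xi>
    using decay[of \<xi>] unfolding fourier_eq_lborel[OF gm hm gh] F_def .
  have M0: "0 \<le> M" using order_trans[OF norm_ge_zero dec[of 0]] p by simp
  define B where "B = (p / (a / 2)) powr p"
  have B0: "B \<ge> 0" unfolding B_def by simp
  define E where "E \<xi> = exp (- (a / 2 * \<bar>\<xi>\<bar> powr (1 / p)))" for \<xi>
  have E0: "E \<xi> \<ge> 0" for \<xi> unfolding E_def by simp
  have E1: "E \<xi> \<le> 1" for \<xi> unfolding E_def using a by simp
  have Eint: "integrable lborel E" unfolding E_def using integrable_exp_neg_powr[OF p(1), of "a / 2"] a by simp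
  have [measurable]: "E \<in> borel_measurable borel" using Eint by (simp add: borel_measurable_integrable)
  have E2int: "integrable lborel (\<lambda>\<xi>. (E \<xi>)\<^sup>2)"
    by (rule Bochner_Integration.integrable_bound[OF Eint])
      (use E0 E1 in \<open>auto simp: power2_eq_square intro!: mult_left_le\<close>)
  define G where "G k \<xi> = (- \<i> * \<xi>) ^ k * F \<xi> / (2 * pi)" for k \<xi>
  have [measurable]: "G k \<in> borel_measurable borel" for k unfolding G_def by measurable
  define K where "K k = M / (2 * pi) * fact k powr p * B ^ k" for k
  have K0: "K k \<ge> 0" for k unfolding K_def using M0 B0 by simp
  have Gb: "norm (G k \<xi>) \<le> K k * E \<xi>" for k \<xi>
  proof -
    have "\<bar>\<xi>\<bar> ^ k * norm (F \<xi>) \<le> (fact k powr p * B ^ k * exp (a / 2 * \<bar>\<xi>\<bar> powr (1 / p))) * (M * exp (- (a * \<bar>\<xi>\<bar> powr (1 / p))))"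
      using abs_power_le_exp_powr[OF p(1), of "a / 2" \<xi> k] dec[of \<xi>] a unfolding B_def by (intro mult_mono) auto
    also have "\<dots> = M * fact k powr p * B ^ k * (exp (a / 2 * \<bar>\<xi>\<bar> powr (1 / p)) * exp (- (a * \<bar>\<xi>\<bar> powr (1 / p))))"
      by (simp add: ac_simps)
    also have "exp (a / 2 * \<bar>\<xi>\<bar> powr (1 / p)) * exp (- (a * \<bar>\<xi>\<bar> powr (1 / p))) = E \<xi>"
      unfolding E_def exp_add[symmetric] by (simp add: field_simps)
    finally show ?thesis
      unfolding G_def K_def by (simp add: norm_mult norm_divide norm_power divide_right_mono)
  qed
  have Gint: "integrable lborel (G k)" for k
    by (rule Bochner_Integration.integrable_bound[OF integrable_mult_right[OF Eint, of "K k"]])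
      (auto intro: order_trans[OF Gb abs_ge_self])
  have Gb2: "(norm (G k \<xi>))\<^sup>2 \<le> (K k)\<^sup>2 * (E \<xi>)\<^sup>2" for k \<xi>
    using power_mono[OF Gb norm_ge_zero, of k \<xi> 2] by (simp add: power_mult_distrib)
  have G2int: "integrable lborel (\<lambda>\<xi>. (norm (G k \<xi>))\<^sup>2)" for k
    by (rule Bochner_Integration.integrable_bound[OF integrable_mult_right[OF E2int, of "(K k)\<^sup>2"]])
      (use Gb2 in \<open>simp_all add: always_eventually\<close>)
  define J where "J = (\<integral>\<xi>. (E \<xi>)\<^sup>2 \<partial>lborel)"
  have J0: "J \<ge> 0" unfolding J_def by simp
  have G2: "(\<integral>\<xi>. (norm (G k \<xi>))\<^sup>2 \<partial>lborel) \<le> (K k)\<^sup>2 * J" for k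
    using integral_mono[OF G2int[of k] integrable_mult_right[OF E2int, of "(K k)\<^sup>2"]] Gb2
    unfolding J_def by simp
  define u where "u k x = (\<integral>\<xi>. G k \<xi> * cis (- (\<xi> * x)) \<partial>lborel)" for k x
  have um[measurable]: "u k \<in> borel_measurable borel" for k unfolding u_def by measurable
  have ub: "norm (u k x) \<le> (\<integral>\<xi>. norm (G k \<xi>) \<partial>lborel)" for k x
    unfolding u_def by (rule order_trans[OF integral_norm_bound]) (simp add: norm_mult)
  \<comment> \<open>As \<open>g\<close> is real, the real part of the duality formula suffices; this
    avoids a separate proof that \<open>u k\<close> is real-valued.\<close>
  define w where "w k x = Re (u k x)" for k x
  have wm[measurable]: "w k \<in> borel_measurable borel" for k unfolding w_def by measurable
  have w2int: "integrable lborel (\<lambda>x. (w k x)\<^sup>2)" for k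
    by (rule Bochner_Integration.integrable_bound[OF fourier_L2_bound(1)[OF Gint[of k] G2int[of k]]])
      (auto simp: w_def u_def[symmetric] cmod_def)
  have w2: "(\<integral>x. (w k x)\<^sup>2 \<partial>lborel) \<le> 2 * pi * (K k)\<^sup>2 * J" for k
  proof -
    have "(\<integral>x. (w k x)\<^sup>2 \<partial>lborel) \<le> (\<integral>x. (norm (u k x))\<^sup>2 \<partial>lborel)"
      using fourier_L2_bound(1)[OF Gint[of k] G2int[of k]]
      by (intro integral_mono w2int) (auto simp: w_def u_def[symmetric] cmod_def)
    also have "\<dots> \<le> 2 * pi * (\<integral>\<xi>. (norm (G k \<xi>))\<^sup>2 \<partial>lborel)"
      unfolding u_def by (rule fourier_L2_bound(2)[OF Gint G2int])
    also have "\<dots> \<le> 2 * pi * ((K k)\<^sup>2 * J)" using G2 by (intro mult_left_mono) auto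
    finally show ?thesis by (simp add: mult.assoc)
  qed
  have wd: "weak_derivative k g (w k)" for k
    unfolding weak_derivative_def
  proof (intro conjI allI impI)
    fix c d :: real
    show "g absolutely_integrable_on {c..d}"
      unfolding set_integrable_def by (intro integrable_mult_indicator g) simp
    have "integrable lborel (\<lambda>x. indicator {c..d} x *\<^sub>R w k x)"
    proof (rule Bochner_Integration.integrable_bound)
      show "integrable lborel (\<lambda>x. indicator {c..d} x * (\<integral>\<xi>. norm (G k \<xi>) \<partial>lborel))"
        by (intro integrable_mult_left integrable_real_indicator) (auto simp: emeasure_lborel_Icc_eq)
      show "AE x in lborel. norm (indicator {c..d} x *\<^sub>R w k x) \<le> norm (indicator {c..d} x * (\<integral>\<xi>. norm (G k \<xi>) \<partial>lborel))"
        using ub[of k] abs_Re_le_cmod[of "u k _"] by (auto simp: w_def indicator_def intro: order_trans)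
    qed measurable
    then show "w k absolutely_integrable_on {c..d}"
      unfolding set_integrable_def by (subst integrable_completion) auto
  next
    fix \<phi> assume T: "test_function \<phi>"
    have [measurable]: "(deriv ^^ i) \<phi> \<in> borel_measurable borel" for i
      using test_function_integrable(1)[OF T, of i] by (simp add: borel_measurable_integrable)
    have \<phi>m[measurable]: "\<phi> \<in> borel_measurable borel" and \<phi>i: "integrable lborel \<phi>"
      using test_function_integrable(1)[OF T, of 0] by (simp_all add: borel_measurable_integrable)
    obtain C where C: "\<And>x. \<bar>(deriv ^^ k) \<phi> x\<bar> \<le> C" using test_function_integrable(2)[OF T, of k] by blast
    define P where "P \<xi> = (\<integral>x. complex_of_real (\<phi> x) * cis (- (\<xi> * x)) \<partial>lborel)" for \<xi>
    have Fint: "integrable lborel F"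
      using integrable_mult_right[OF Gint[of 0], of "2 * pi"] by (simp add: G_def)
    have "2 * pi * (\<integral>v. h v *\<^sub>R complex_of_real ((deriv ^^ k) \<phi> v) \<partial>lborel)
      = (\<integral>\<xi>. F \<xi> * (\<integral>x. complex_of_real ((deriv ^^ k) \<phi> x) * cis (- (\<xi> * x)) \<partial>lborel) \<partial>lborel)"
      unfolding F_def
    proof (rule fourier_inversion_weak[symmetric, where B = C])
      show "complex_integrable lborel (\<lambda>x. complex_of_real ((deriv ^^ k) \<phi> x))"
        using test_function_integrable(1)[OF T, of k] by simp
      show "continuous_on UNIV (\<lambda>x. complex_of_real ((deriv ^^ k) \<phi> x))"
        by (intro continuous_on_of_real test_function_continuous T)
      show "complex_integrable lborel (\<lambda>\<xi>. \<integral>v. h v *\<^sub>R cis (\<xi> * v) \<partial>lborel)"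
        using Fint unfolding F_def .
    qed (use C h in auto)
    also have "\<dots> = (\<integral>\<xi>. F \<xi> * ((\<i> * \<xi>) ^ k * P \<xi>) \<partial>lborel)"
      unfolding test_function_fourier_deriv[OF T] P_def ..
    \<comment> \<open>The transform of \<open>\<phi>\<close> uses \<open>cis\<close> with the
      opposite sign, so differentiating \<open>\<phi>\<close> produces \<open>\<i> * \<xi>\<close>
      whereas \<open>G k\<close> carries \<open>- \<i> * \<xi>\<close>. The mismatch is the sign in
      \<open>weak_derivative\<close>.\<close>
    also have "\<dots> = (\<integral>\<xi>. (- 1) ^ k * (2 * pi) * (G k \<xi> * P \<xi>) \<partial>lborel)"
    proof (rule Bochner_Integration.integral_cong[OF refl])
      fix \<xi> :: real
      have "(- \<i> * \<xi>) ^ k = (- 1) ^ k * (\<i> * \<xi>) ^ k"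
        by (simp flip: power_mult_distrib)
      moreover have "(- 1 :: complex) ^ k * (- 1) ^ k = 1" by (simp flip: power_mult_distrib)
      ultimately show "F \<xi> * ((\<i> * \<xi>) ^ k * P \<xi>) = (- 1) ^ k * (2 * pi) * (G k \<xi> * P \<xi>)"
        unfolding G_def by (simp add: field_simps)
    qed
    also have "\<dots> = (- 1) ^ k * (2 * pi) * (\<integral>\<xi>. G k \<xi> * P \<xi> \<partial>lborel)"
      by simp
    also have "(\<integral>\<xi>. G k \<xi> * P \<xi> \<partial>lborel) = (\<integral>x. complex_of_real (\<phi> x) * u k x \<partial>lborel)"
      unfolding P_def u_def by (rule integral_kernel_swap) (use Gint \<phi>i in auto)
    finally have "(\<integral>v. h v *\<^sub>R complex_of_real ((deriv ^^ k) \<phi> v) \<partial>lborel) = (- 1) ^ k * (\<integral>x. complex_of_real (\<phi> x) * u k x \<partial>lborel)"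
      by simp
    then have "Re (\<integral>v. h v *\<^sub>R complex_of_real ((deriv ^^ k) \<phi> v) \<partial>lborel) = Re ((- 1) ^ k * (\<integral>x. complex_of_real (\<phi> x) * u k x \<partial>lborel))"
      by simp
    moreover have "(\<integral>v. h v *\<^sub>R complex_of_real ((deriv ^^ k) \<phi> v) \<partial>lborel) = complex_of_real (\<integral>v. h v * (deriv ^^ k) \<phi> v \<partial>lborel)"
      by (simp add: scaleR_conv_of_real flip: of_real_mult)
    moreover have "Re ((- 1) ^ k * (\<integral>x. complex_of_real (\<phi> x) * u k x \<partial>lborel)) = (- 1) ^ k * Re (\<integral>x. complex_of_real (\<phi> x) * u k x \<partial>lborel)"
      by (cases "even k") auto
    moreover have "Re (\<integral>x. complex_of_real (\<phi> x) * u k x \<partial>lborel) = (\<integral>x. w k x * \<phi> x \<partial>lborel)"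
    proof -
      have "integrable lborel (\<lambda>x. complex_of_real (\<phi> x) * u k x)"
        by (rule Bochner_Integration.integrable_bound[OF integrable_mult_left[OF \<phi>i, of "\<integral>\<xi>. norm (G k \<xi>) \<partial>lborel"]])
          (use ub[of k] in \<open>auto simp: norm_mult abs_mult intro!: mult_left_mono\<close>)
      then show ?thesis by (subst integral_Re[symmetric]) (auto simp: w_def mult.commute)
    qed
    ultimately have "(\<integral>v. h v * (deriv ^^ k) \<phi> v \<partial>lborel) = (- 1) ^ k * (\<integral>x. w k x * \<phi> x \<partial>lborel)"
      by simp
    moreover have "(LINT v|lebesgue. g v * (deriv ^^ k) \<phi> v) = (\<integral>v. h v * (deriv ^^ k) \<phi> v \<partial>lborel)"
    proof (rule integral_lebesgue_eq_lborel)
      have "(deriv ^^ k) \<phi> \<in> borel_measurable lborel" by measurable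
      then show "(\<lambda>v. g v * (deriv ^^ k) \<phi> v) \<in> borel_measurable lebesgue"
        by (intro borel_measurable_times gm measurable_completion)
    qed (use gh in auto)
    moreover have "(LINT v|lebesgue. w k v * \<phi> v) = (\<integral>x. w k x * \<phi> x \<partial>lborel)"
      by (rule integral_completion) measurable
    ultimately show "(LINT v|lebesgue. g v * (deriv ^^ k) \<phi> v) = (- 1) ^ k * (LINT v|lebesgue. w k v * \<phi> v)"
      by simp
  qed
  define D where "D = M / (2 * pi) * sqrt (2 * pi * J)"
  have D0: "D \<ge> 0" unfolding D_def using M0 J0 by simp
  \<comment> \<open>One constant has to dominate both the prefactor \<open>D\<close> and the ratio
    \<open>B\<close>; the summand 1 makes it positive. The exponent passes from \<open>p\<close> to
    \<open>\<alpha>\<close> because factorials are at least 1.\<close>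
  define C where "C = 1 + D + B"
  have C: "C \<ge> 1" "D \<le> C" "B \<le> C" unfolding C_def using D0 B0 by auto
  have "sqrt (LINT v|lebesgue. (w k v)\<^sup>2) \<le> C ^ (k + 1) * fact k powr \<alpha>" for k
  proof -
    have "(LINT v|lebesgue. (w k v)\<^sup>2) = (\<integral>x. (w k x)\<^sup>2 \<partial>lborel)"
      by (rule integral_completion) measurable
    then have "sqrt (LINT v|lebesgue. (w k v)\<^sup>2) \<le> sqrt (2 * pi * J * (K k)\<^sup>2)"
      using w2[of k] by (intro real_sqrt_le_mono) (simp add: ac_simps)
    also have "\<dots> = sqrt (2 * pi * J) * K k"
      using K0 by (simp add: real_sqrt_mult)
    also have "\<dots> = D * B ^ k * fact k powr p"
      by (simp add: K_def D_def)
    also have "\<dots> \<le> C * C ^ k * fact k powr \<alpha>"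
      using C B0 D0 p by (intro mult_mono power_mono powr_mono) auto
    finally show ?thesis by simp
  qed
  moreover have "w k \<in> borel_measurable lebesgue" for k
    by (rule measurable_completion) simp
  moreover have "integrable lebesgue (\<lambda>v. (w k v)\<^sup>2)" for k
    using w2int[of k] by (subst integrable_completion) auto
  ultimately show ?thesis
    unfolding gevrey_def using wd C(1) by (intro CollectI exI[of _ C]) force
qed

section \<open>Smooth cutoff functions\<close>

text \<open>For \<open>p = 1\<close> this is the classical smooth function
  \<open>exp (- (1 / x))\<close> extended by 0. The polynomial in \<open>1 / x\<close> makes the
  family closed under differentiation.\<close>

definition exp_cutoff :: "real poly \<Rightarrow> real \<Rightarrow> real" where
  "exp_cutoff p x = (if 0 < x then poly p (1 / x) * exp (- (1 / x)) else 0)"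

lemma poly_times_exp_neg_tendsto_0: "((\<lambda>y::real. poly p y * exp (- y)) \<longlongrightarrow> 0) at_top"
proof -
  have "((\<lambda>y. \<Sum>i\<le>degree p. coeff p i * (y ^ i / exp y)) \<longlongrightarrow> (\<Sum>i\<le>degree p. coeff p i * 0)) at_top"
    by (intro tendsto_sum tendsto_mult tendsto_const tendsto_power_div_exp_0)
  then show ?thesis
    by (simp add: poly_altdef sum_distrib_right exp_minus divide_inverse mult.assoc)
qed

text \<open>With \<open>y = 1 / x\<close> the chain rule produces
  \<open>y\<^sup>2 * (p y - p' y) * exp (- y)\<close>, which explains the polynomial. At 0 the
  difference quotient from the right is \<open>y * p y * exp (- y)\<close> with \<open>y\<close>
  tending to infinity; \<open>pCons 0 p\<close> encodes the extra factor \<open>y\<close>.\<close>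

lemma exp_cutoff_has_derivative:
  "(exp_cutoff p has_real_derivative exp_cutoff ([:0, 0, 1:] * (p - pderiv p)) x) (at x)"
proof -
  consider "x > 0" | "x < 0" | "x = 0" by linarith
  then show ?thesis
  proof cases
    case 1
    have "((\<lambda>x. poly p (1 / x) * exp (- (1 / x))) has_real_derivative
        exp_cutoff ([:0, 0, 1:] * (p - pderiv p)) x) (at x)"
      using 1 by (auto intro!: derivative_eq_intros DERIV_chain2[OF poly_DERIV]
          simp: exp_cutoff_def field_simps power2_eq_square)
    then show ?thesis
      by (rule has_field_derivative_transform_within_open[of _ _ _ "{0<..}"])
        (use 1 in \<open>auto simp: exp_cutoff_def\<close>)
  next
    case 2
    have "((\<lambda>x::real. 0) has_real_derivative 0) (at x)" by simp
    then have "(exp_cutoff p has_real_derivative 0) (at x)"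
      by (rule has_field_derivative_transform_within_open[of _ _ _ "{..<0}"])
        (use 2 in \<open>auto simp: exp_cutoff_def\<close>)
    then show ?thesis using 2 by (simp add: exp_cutoff_def)
  next
    case 3
    have "((\<lambda>h. poly (pCons 0 p) (inverse h) * exp (- inverse h)) \<longlongrightarrow> 0) (at_right (0::real))"
      by (rule filterlim_compose[OF poly_times_exp_neg_tendsto_0 filterlim_inverse_at_top_right])
    then have r: "((\<lambda>h. exp_cutoff p h / h) \<longlongrightarrow> 0) (at_right 0)"
      by (rule Lim_transform_eventually)
        (auto simp: eventually_at_right_field exp_cutoff_def divide_inverse ac_simps intro!: exI[of _ 1])
    have l: "((\<lambda>h. exp_cutoff p h / h) \<longlongrightarrow> 0) (at_left 0)"
      by (rule Lim_transform_eventually[OF tendsto_const])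
        (auto simp: eventually_at_left_field exp_cutoff_def intro!: exI[of _ "-1"])
    have "((\<lambda>h. exp_cutoff p h / h) \<longlongrightarrow> 0) (at 0)"
      using l r by (simp add: filterlim_split_at)
    then show ?thesis using 3 by (simp add: DERIV_def exp_cutoff_def)
  qed
qed

text \<open>An algebra large enough for bumps and for their products with
  \<open>sin (\<xi> * v)\<close> and \<open>cos (\<xi> * v)\<close>. Smoothness becomes an induction
  over the generators, so that no iterated derivative has to be computed.\<close>

inductive_set smooth_gen :: "(real \<Rightarrow> real) set" where
  const: "(\<lambda>_. c) \<in> smooth_gen"
| sin: "(\<lambda>x. sin (c * x)) \<in> smooth_gen"
| cos: "(\<lambda>x. cos (c * x)) \<in> smooth_gen"
| cutoff: "(\<lambda>x. exp_cutoff p (c * x + d)) \<in> smooth_gen"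
| add: "f \<in> smooth_gen \<Longrightarrow> g \<in> smooth_gen \<Longrightarrow> (\<lambda>x. f x + g x) \<in> smooth_gen"
| mult: "f \<in> smooth_gen \<Longrightarrow> g \<in> smooth_gen \<Longrightarrow> (\<lambda>x. f x * g x) \<in> smooth_gen"

text \<open>\<open>smooth_gen\<close> is closed under differentiation, so its members are smooth.\<close>
lemma smooth_gen_derivative:
  assumes "f \<in> smooth_gen"
  shows "\<exists>f'\<in>smooth_gen. \<forall>x. (f has_real_derivative f' x) (at x)"
  using assms
proof induction
  case (const c)
  show ?case by (rule bexI[OF _ smooth_gen.const[of 0]]) simp
next
  case (sin c)
  show ?case
    by (rule bexI[OF _ smooth_gen.mult[OF smooth_gen.const[of c] smooth_gen.cos[of c]]])
      (auto intro!: derivative_eq_intros)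
next
  case (cos c)
  show ?case
    by (rule bexI[OF _ smooth_gen.mult[OF smooth_gen.const[of "- c"] smooth_gen.sin[of c]]])
      (auto intro!: derivative_eq_intros)
next
  case (cutoff p c d)
  have "((\<lambda>x. exp_cutoff p (c * x + d)) has_real_derivative exp_cutoff ([:0, 0, 1:] * (p - pderiv p)) (c * x + d) * c) (at x)" for x
    by (rule DERIV_chain2[OF exp_cutoff_has_derivative]) (auto intro!: derivative_eq_intros)
  then show ?case
    by (intro bexI[OF _ smooth_gen.mult[OF smooth_gen.cutoff smooth_gen.const]]) auto
next
  case (add f g)
  then obtain f' g' where "f' \<in> smooth_gen" "g' \<in> smooth_gen"
    and "\<And>x. (f has_real_derivative f' x) (at x)" "\<And>x. (g has_real_derivative g' x) (at x)" by blast
  then show ?case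
    by (intro bexI[OF _ smooth_gen.add[of f' g']]) (auto intro: DERIV_add)
next
  case (mult f g)
  then obtain f' g' where "f' \<in> smooth_gen" "g' \<in> smooth_gen"
    and "\<And>x. (f has_real_derivative f' x) (at x)" "\<And>x. (g has_real_derivative g' x) (at x)" by blast
  with mult show ?case
    by (intro bexI[OF _ smooth_gen.add[OF smooth_gen.mult[of f' g] smooth_gen.mult[of g' f]]])
      (auto intro: DERIV_mult)
qed

lemma smooth_gen_deriv_funpow:
  assumes "f \<in> smooth_gen"
  shows "(deriv ^^ k) f \<in> smooth_gen"
proof (induction k)
  case (Suc k)
  then obtain f' where "f' \<in> smooth_gen" "\<And>x. ((deriv ^^ k) f has_real_derivative f' x) (at x)"
    using smooth_gen_derivative by blast
  moreover from this(2) have "deriv ((deriv ^^ k) f) = f'" by (auto simp: DERIV_imp_deriv)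
  ultimately show ?case by simp
qed (use assms in simp)

lemma test_function_smooth_gen:
  assumes "f \<in> smooth_gen" and supp: "\<And>x. x \<notin> {a..b} \<Longrightarrow> f x = 0"
  shows "test_function f"
  unfolding test_function_def
proof (intro conjI allI)
  fix k x
  show "(deriv ^^ k) f differentiable (at x)"
    using smooth_gen_derivative[OF smooth_gen_deriv_funpow[OF assms(1), of k]]
    by (auto simp: real_differentiable_def)
next
  have "{x. f x \<noteq> 0} \<subseteq> {a..b}" using supp by blast
  then have "closure {x. f x \<noteq> 0} \<subseteq> {a..b}" by (simp add: closure_minimal)
  then show "compact (closure {x. f x \<noteq> 0})"
    using compact_Icc closed_closure by (metis compact_Int_closed inf.absorb_iff2)
qed

text \<open>The same function serves as a localiser, being positive exactly between \<open>l\<close>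
  and \<open>r\<close>, and as a cutoff, since both factors tend to 1 when \<open>l\<close> and
  \<open>r\<close> go to minus and plus infinity.\<close>

definition bump :: "real \<Rightarrow> real \<Rightarrow> real \<Rightarrow> real" where
  "bump l r x = exp_cutoff 1 (x - l) * exp_cutoff 1 (r - x)"

lemma exp_cutoff_1_bounds: "0 \<le> exp_cutoff 1 x" "exp_cutoff 1 x \<le> 1" "0 < x \<Longrightarrow> 0 < exp_cutoff 1 x"
  by (auto simp: exp_cutoff_def)

lemma bump_smooth_gen: "bump l r \<in> smooth_gen"
  using smooth_gen.mult[OF smooth_gen.cutoff[of 1 1 "- l"] smooth_gen.cutoff[of 1 "- 1" r]]
  by (simp add: bump_def[abs_def])

lemma bump_bounds: "0 \<le> bump l r x" "bump l r x \<le> 1"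
  and bump_pos: "l < x \<Longrightarrow> x < r \<Longrightarrow> 0 < bump l r x"
  and bump_eq_0: "x \<notin> {l<..<r} \<Longrightarrow> bump l r x = 0"
  using exp_cutoff_1_bounds by (auto simp: bump_def intro!: mult_le_one) (auto simp: exp_cutoff_def)

text \<open>The derivative is \<open>y\<^sup>2 * exp (- y)\<close> with \<open>y = 1 / z\<close>,
  and \<open>exp y \<ge> y\<^sup>2 / 2\<close> bounds it by 2.\<close>

lemma exp_cutoff_1_lipschitz: "\<bar>exp_cutoff 1 x - exp_cutoff 1 y\<bar> \<le> 2 * \<bar>x - y\<bar>"
proof -
  have "\<bar>exp_cutoff ([:0, 0, 1:] * (1 - pderiv 1)) z\<bar> \<le> 2" for z
  proof (cases "0 < z")
    case True
    have "(1 / z)\<^sup>2 / 2 \<le> exp (1 / z)"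
      using exp_lower_Taylor_quadratic[of "1 / z"] True by (intro order_trans[OF _ exp_lower_Taylor_quadratic]) auto
    then have "(1 / z)\<^sup>2 * exp (- (1 / z)) \<le> 2 * exp (1 / z) * exp (- (1 / z))"
      by (intro mult_right_mono) auto
    also have "\<dots> = 2" by (simp add: mult.assoc flip: exp_add)
    finally show ?thesis using True by (simp add: exp_cutoff_def power2_eq_square abs_mult)
  qed (simp add: exp_cutoff_def)
  then have "norm (exp_cutoff 1 x - exp_cutoff 1 y) \<le> 2 * norm (x - y)"
    by (intro field_differentiable_bound[of UNIV "exp_cutoff 1" "exp_cutoff ([:0, 0, 1:] * (1 - pderiv 1))"])
      (use exp_cutoff_has_derivative[of 1] in auto)
  then show ?thesis by simp
qed

lemma abs_mult_diff_le:
  fixes a b c d :: real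
  assumes "\<bar>a\<bar> \<le> 1" "\<bar>d\<bar> \<le> 1"
  shows "\<bar>a * b - c * d\<bar> \<le> \<bar>b - d\<bar> + \<bar>a - c\<bar>"
proof -
  have "a * b - c * d = a * (b - d) + (a - c) * d" by (simp add: algebra_simps)
  then have "\<bar>a * b - c * d\<bar> \<le> \<bar>a\<bar> * \<bar>b - d\<bar> + \<bar>a - c\<bar> * \<bar>d\<bar>" by (metis abs_mult abs_triangle_ineq)
  also have "\<dots> \<le> 1 * \<bar>b - d\<bar> + \<bar>a - c\<bar> * 1" using assms by (intro add_mono mult_mono) auto
  finally show ?thesis by simp
qed

text \<open>That the constant depends on neither \<open>l\<close> nor \<open>r\<close> gives uniform
  Lipschitz bounds for the truncations in \<open>weak_equation_smooth\<close>.\<close>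

lemma bump_lipschitz: "\<bar>bump l r x - bump l r y\<bar> \<le> 4 * \<bar>x - y\<bar>"
proof -
  have "\<bar>bump l r x - bump l r y\<bar> \<le> \<bar>exp_cutoff 1 (r - x) - exp_cutoff 1 (r - y)\<bar> + \<bar>exp_cutoff 1 (x - l) - exp_cutoff 1 (y - l)\<bar>"
    unfolding bump_def using exp_cutoff_1_bounds by (intro abs_mult_diff_le) (auto simp: abs_le_iff intro: order_trans[of _ 0])
  also have "\<dots> \<le> 2 * \<bar>r - x - (r - y)\<bar> + 2 * \<bar>x - l - (y - l)\<bar>"
    by (intro add_mono exp_cutoff_1_lipschitz)
  finally show ?thesis using abs_minus_commute[of y x] by simp
qed

lemma bump_tendsto_1: "(\<lambda>n. bump (- real n) (real n) x) \<longlonglongrightarrow> 1"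
proof -
  have c: "((\<lambda>z. exp_cutoff 1 z) \<longlongrightarrow> 1) at_top"
  proof (rule Lim_transform_eventually)
    show "((\<lambda>z::real. exp (- inverse z)) \<longlongrightarrow> 1) at_top"
      using tendsto_exp[OF tendsto_minus[OF tendsto_inverse_0_at_top[OF filterlim_ident]]] by simp
    show "\<forall>\<^sub>F z in at_top. exp (- inverse z) = exp_cutoff 1 z"
      using eventually_gt_at_top[of 0] by eventually_elim (simp add: exp_cutoff_def divide_inverse)
  qed
  have "(\<lambda>n. exp_cutoff 1 (x + real n) * exp_cutoff 1 (- x + real n)) \<longlonglongrightarrow> 1 * 1"
    by (intro tendsto_mult filterlim_compose[OF c] filterlim_tendsto_add_at_top[OF tendsto_const filterlim_real_sequentially])
  then show ?thesis by (simp add: bump_def)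
qed

section \<open>The collision operator in Fourier variables\<close>

lemma kac_kernel_measurable [measurable]: "kac_kernel C s \<in> borel_measurable borel"
  unfolding kac_kernel_def[abs_def] by measurable

lemma kac_kernel_nonneg: "0 \<le> C \<Longrightarrow> 0 \<le> kac_kernel C s \<theta>"
  unfolding kac_kernel_def by simp

text \<open>On \<open>(0, pi / 2)\<close> the integrand is
  \<open>C * cos \<theta> * sin \<theta> powr (- 2 * s)\<close>, whose antiderivative
  \<open>H\<close> is a multiple of \<open>sin \<theta> powr (1 - 2 * s)\<close>;
  \<open>s < 1 / 2\<close> makes \<open>H\<close> continuous at 0. Negative angles follow by
  reflection.\<close>

lemma kac_kernel_times_sin_integrable:
  assumes "0 \<le> C" and s: "s < 1 / 2"
  shows "integrable lborel (\<lambda>\<theta>. indicator {- pi / 2..pi / 2} \<theta> * (kac_kernel C s \<theta> * \<bar>sin \<theta>\<bar>))"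
proof -
  define h where "h \<theta> = kac_kernel C s \<theta> * \<bar>sin \<theta>\<bar>" for \<theta>
  have [measurable]: "h \<in> borel_measurable borel" unfolding h_def by measurable
  define H where "H \<theta> = C / (1 - 2 * s) * sin \<theta> powr (1 - 2 * s)" for \<theta>
  have "(h has_integral (H (pi / 2) - H 0)) {0..pi / 2}"
  proof (rule fundamental_theorem_of_calculus_interior)
    show "continuous_on {0..pi / 2} H"
      unfolding H_def using s
      by (intro continuous_intros continuous_on_powr') (auto intro!: sin_ge_zero)
  next
    fix x :: real assume x: "x \<in> {0<..<pi / 2}"
    then have sp: "0 < sin x" "0 < cos x" by (auto intro!: sin_gt_zero cos_gt_zero)
    have "(H has_real_derivative C / (1 - 2 * s) * ((1 - 2 * s) * sin x powr (1 - 2 * s - 1) * cos x)) (at x)"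
      unfolding H_def using sp by (auto intro!: derivative_eq_intros)
    moreover have "C / (1 - 2 * s) * ((1 - 2 * s) * sin x powr (1 - 2 * s - 1) * cos x) = h x"
    proof -
      have "sin x powr (1 - 2 * s - 1) = sin x / sin x powr (1 + 2 * s)"
        using sp by (simp add: powr_add powr_minus field_simps)
      then show ?thesis using sp s unfolding h_def kac_kernel_def by (simp add: field_simps)
    qed
    ultimately show "(H has_vector_derivative h x) (at x)"
      by (simp add: has_real_derivative_iff_has_vector_derivative)
  qed simp
  then have "h absolutely_integrable_on {0..pi / 2}"
    using kac_kernel_nonneg[OF assms(1)]
    by (intro nonnegative_absolutely_integrable_1) (auto simp: h_def has_integral_integrable)
  then have i: "integrable lborel (\<lambda>\<theta>. indicator {0..pi / 2} \<theta> * h \<theta>)"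
    by (simp add: set_integrable_def integrable_completion)
  have "integrable lborel (\<lambda>\<theta>. indicator {0..pi / 2} (- \<theta>) * h (- \<theta>))"
    using lborel_integrable_real_affine[OF i, of "- 1" 0] by simp
  from Bochner_Integration.integrable_add[OF i this]
  have "integrable lborel (\<lambda>\<theta>. indicator {0..pi / 2} \<theta> * h \<theta> + indicator {0..pi / 2} (- \<theta>) * h (- \<theta>))" .
  moreover have "indicator {0..pi / 2} \<theta> * h \<theta> + indicator {0..pi / 2} (- \<theta>) * h (- \<theta>)
     = indicator {- pi / 2..pi / 2} \<theta> * h \<theta>" for \<theta>
  proof -
    have "h (- \<theta>) = h \<theta>" "h 0 = 0" by (simp_all add: h_def kac_kernel_def)
    then show ?thesis by (cases "\<theta> = 0") (auto simp: indicator_def)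
  qed
  ultimately show ?thesis by (simp add: h_def)
qed

lemma borel_measurable_lebesgue_AE_eq:
  fixes g h :: "'a::euclidean_space \<Rightarrow> 'b::topological_space"
  assumes h: "h \<in> borel_measurable borel" and ae: "AE x in lborel. g x = h x"
  shows "g \<in> borel_measurable lebesgue"
proof (rule measurableI)
  fix A :: "'b set" assume "A \<in> sets borel"
  then have "h -` A \<in> sets lebesgue"
    using measurable_sets_borel[OF h] by (auto simp: sets_completionI_sets)
  moreover have "AE x in lebesgue. x \<in> h -` A \<longleftrightarrow> x \<in> g -` A"
    using AE_completion[OF ae] by eventually_elim auto
  ultimately have "g -` A \<in> sets lebesgue"
    using completion.in_sets_AE[of "h -` A" "g -` A" lborel] by simp
  then show "g -` A \<inter> space lebesgue \<in> sets lebesgue" by simp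
qed simp

lemma AE_lborel_pair:
  assumes "AE x in (lborel :: 'a::euclidean_space measure). P x"
    and "AE y in (lborel :: 'b::euclidean_space measure). Q y"
  shows "AE p in (lborel :: ('a \<times> 'b) measure). P (fst p) \<and> Q (snd p)"
proof -
  obtain N where N: "{x. \<not> P x} \<subseteq> N" "N \<in> null_sets (lborel :: 'a measure)"
    using assms(1) unfolding eventually_ae_filter by auto
  obtain M where M: "{y. \<not> Q y} \<subseteq> M" "M \<in> null_sets (lborel :: 'b measure)"
    using assms(2) unfolding eventually_ae_filter by auto
  have "N \<times> UNIV \<in> null_sets (lborel \<Otimes>\<^sub>M (lborel :: 'b measure))"
    using lborel.times_in_null_sets1[OF N(2), of UNIV] by simp
  moreover have "UNIV \<times> M \<in> null_sets ((lborel :: 'a measure) \<Otimes>\<^sub>M lborel)"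
    using lborel.times_in_null_sets2[OF _ M(2), of UNIV lborel] by simp
  ultimately have "N \<times> UNIV \<union> UNIV \<times> M \<in> null_sets (lborel :: ('a \<times> 'b) measure)"
    unfolding lborel_prod by (rule null_sets.Un)
  then show ?thesis
    by (rule AE_I') (use N(1) M(1) in auto)
qed

lemma integral_pair_mult:
  fixes A :: "'a::euclidean_space \<Rightarrow> 'c::{real_normed_field, banach, second_countable_topology}"
    and B :: "'b::euclidean_space \<Rightarrow> 'c"
  assumes A: "integrable lborel A" and B: "integrable lborel B"
  shows "(\<integral>p. (case p of (x, y) \<Rightarrow> A x * B y) \<partial>lborel) = (\<integral>x. A x \<partial>lborel) * (\<integral>y. B y \<partial>lborel)"
  using lborel_pair.integral_fst[OF integrable_pair_mult[OF A B]]
  by (simp add: lborel_prod)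

lemma one_minus_cos_le_abs_sin:
  fixes x :: real
  assumes "x \<in> {- pi / 2..pi / 2}"
  shows "\<bar>cos x - 1\<bar> \<le> \<bar>sin x\<bar>"
proof -
  have c: "0 \<le> cos x" using assms by (intro cos_ge_zero) auto
  have "(1 - cos x) * 1 \<le> (1 - cos x) * (1 + cos x)" using c by (intro mult_left_mono) auto
  also have "\<dots> = \<bar>sin x\<bar> * \<bar>sin x\<bar>"
    using sin_cos_squared_add[of x] by (simp add: algebra_simps power2_eq_square)
  also have "\<dots> \<le> \<bar>sin x\<bar> * 1" by (intro mult_left_mono) auto
  finally show ?thesis by simp
qed

lemma abs_post_velocity_diff_le:
  assumes "\<theta> \<in> {- pi / 2..pi / 2}"
  shows "\<bar>post_velocity v w \<theta> - v\<bar> \<le> (\<bar>v\<bar> + \<bar>w\<bar>) * \<bar>sin \<theta>\<bar>"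
proof -
  have "\<bar>post_velocity v w \<theta> - v\<bar> = \<bar>v * (cos \<theta> - 1) - w * sin \<theta>\<bar>"
    by (simp add: post_velocity_def algebra_simps)
  also have "\<dots> \<le> \<bar>v\<bar> * \<bar>cos \<theta> - 1\<bar> + \<bar>w\<bar> * \<bar>sin \<theta>\<bar>"
    by (metis abs_mult abs_triangle_ineq4)
  also have "\<dots> \<le> \<bar>v\<bar> * \<bar>sin \<theta>\<bar> + \<bar>w\<bar> * \<bar>sin \<theta>\<bar>"
    using one_minus_cos_le_abs_sin[OF assms] by (intro add_mono mult_left_mono) auto
  finally show ?thesis by (simp add: algebra_simps)
qed

lemma norm_cis_diff_le: "norm (cis (\<xi> * x) - cis (\<xi> * y)) \<le> \<bar>\<xi>\<bar> * \<bar>x - y\<bar>"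
proof -
  have "norm (cis (\<xi> * x) - cis (\<xi> * y)) \<le> \<bar>\<xi>\<bar> * norm (x - y)"
  proof (rule differentiable_bound[of UNIV "\<lambda>x. cis (\<xi> * x)" "\<lambda>x h. h *\<^sub>R (\<xi> *\<^sub>R (\<i> * cis (\<xi> * x)))"])
    show "((\<lambda>x. cis (\<xi> * x)) has_derivative (\<lambda>h. h *\<^sub>R (\<xi> *\<^sub>R (\<i> * cis (\<xi> * x))))) (at x within UNIV)" for x
      using has_vector_derivative_cis[of \<xi> x UNIV] unfolding has_vector_derivative_def .
    show "onorm (\<lambda>h. h *\<^sub>R (\<xi> *\<^sub>R (\<i> * cis (\<xi> * x)))) \<le> \<bar>\<xi>\<bar>" for x
      by (rule onorm_le) (simp add: norm_mult abs_mult)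
  qed auto
  then show ?thesis by simp
qed

text \<open>This is \<open>|g v| * |g w| * (|v| + |w|)\<close>, split into two products of functions
  of one variable each, so that the product lemmas apply.\<close>

definition moment_weight :: "(real \<Rightarrow> real) \<Rightarrow> real \<times> real \<Rightarrow> real" where
  "moment_weight g p = (case p of (v, w) \<Rightarrow> \<bar>g v\<bar> * \<bar>v\<bar> * \<bar>g w\<bar>) + (case p of (v, w) \<Rightarrow> \<bar>g v\<bar> * (\<bar>g w\<bar> * \<bar>w\<bar>))"

lemma moment_weight:
  assumes "integrable lborel g" "integrable lborel (\<lambda>v. \<bar>g v\<bar> * \<bar>v\<bar>)"
  shows "integrable lborel (moment_weight g)"
    and "(\<integral>p. moment_weight g p \<partial>lborel) = 2 * (\<integral>v. \<bar>g v\<bar> \<partial>lborel) * (\<integral>v. \<bar>g v\<bar> * \<bar>v\<bar> \<partial>lborel)"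
proof -
  have g: "integrable lborel (\<lambda>v. \<bar>g v\<bar>)" using assms(1) by simp
  have 1: "integrable lborel (\<lambda>p. case p of (v, w) \<Rightarrow> \<bar>g v\<bar> * \<bar>v\<bar> * \<bar>g w\<bar>)"
    using integrable_pair_mult[OF assms(2) g] unfolding lborel_prod .
  have 2: "integrable lborel (\<lambda>p. case p of (v, w) \<Rightarrow> \<bar>g v\<bar> * (\<bar>g w\<bar> * \<bar>w\<bar>))"
    using integrable_pair_mult[OF g assms(2)] unfolding lborel_prod .
  show "integrable lborel (moment_weight g)"
    unfolding moment_weight_def[abs_def] by (rule Bochner_Integration.integrable_add[OF 1 2])
  show "(\<integral>p. moment_weight g p \<partial>lborel) = 2 * (\<integral>v. \<bar>g v\<bar> \<partial>lborel) * (\<integral>v. \<bar>g v\<bar> * \<bar>v\<bar> \<partial>lborel)"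
    unfolding moment_weight_def[abs_def] Bochner_Integration.integral_add[OF 1 2]
      integral_pair_mult[OF assms(2) g] integral_pair_mult[OF g assms(2)] by simp
qed

section \<open>The weak collision integral for an abstract angular kernel\<close>

text \<open>The estimates of the weak form see the kernel only through its integral against
  \<open>|sin \<theta>|\<close>; the precise strength of the singularity enters later, in
  \<open>kac_kernel_gain\<close>.\<close>

locale angular_kernel =
  fixes \<beta> :: "real \<Rightarrow> real"
  assumes \<beta>_measurable [measurable]: "\<beta> \<in> borel_measurable borel"
    and \<beta>_nonneg: "\<And>\<theta>. 0 \<le> \<beta> \<theta>"
    and \<beta>_integrable: "integrable lborel (\<lambda>\<theta>. indicator {- pi / 2..pi / 2} \<theta> * (\<beta> \<theta> * \<bar>sin \<theta>\<bar>))"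
begin

definition b :: "real \<Rightarrow> real" where
  "b \<theta> = indicator {- pi / 2..pi / 2} \<theta> * \<beta> \<theta>"

definition B1 :: real where "B1 = (\<integral>\<theta>. b \<theta> * \<bar>sin \<theta>\<bar> \<partial>lborel)"

lemma b_measurable [measurable]: "b \<in> borel_measurable borel"
  unfolding b_def[abs_def] by measurable

lemma b_nonneg: "0 \<le> b \<theta>" by (simp add: b_def \<beta>_nonneg)

lemma b_eq_0: "\<theta> \<notin> {- pi / 2..pi / 2} \<Longrightarrow> b \<theta> = 0" by (simp add: b_def)

lemma b_sin_integrable: "integrable lborel (\<lambda>\<theta>. b \<theta> * \<bar>sin \<theta>\<bar>)"
  using \<beta>_integrable by (simp add: b_def mult.assoc)

lemma B1_nonneg: "0 \<le> B1"
  unfolding B1_def by (intro integral_nonneg_AE) (simp add: b_nonneg)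

text \<open>The value space is left general so that the same bounds cover real test functions and
  the complex \<open>cis (\<xi> * v)\<close>.\<close>

definition collision :: "(real \<Rightarrow> 'b::{banach, second_countable_topology}) \<Rightarrow> (real \<Rightarrow> real) \<Rightarrow> (real \<times> real) \<Rightarrow> real \<Rightarrow> 'b" where
  "collision \<phi> g p \<theta> = (b \<theta> * g (snd p) * g (fst p)) *\<^sub>R (\<phi> (post_velocity (fst p) (snd p) \<theta>) - \<phi> (fst p))"

text \<open>The velocity jump is at most \<open>(|v| + |w|) * |sin \<theta>|\<close>, so a Lipschitz
  \<open>\<phi>\<close> supplies the factor that tames the singularity of \<open>\<beta>\<close> at
  0. The bound separates the pair from the angle and depends on \<open>\<phi>\<close> through
  \<open>L\<close> alone, so it also serves as a dominating function.\<close>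

lemma collision_bound:
  assumes L: "\<And>x y. norm (\<phi> x - \<phi> y) \<le> L * \<bar>x - y\<bar>"
  shows "norm (collision \<phi> g p \<theta>) \<le> L * (moment_weight g p * (b \<theta> * \<bar>sin \<theta>\<bar>))"
proof (cases "\<theta> \<in> {- pi / 2..pi / 2}")
  case True
  obtain v w where p: "p = (v, w)" by force
  have L0: "0 \<le> L" using order_trans[OF norm_ge_zero L[of 1 0]] by simp
  have "norm (\<phi> (post_velocity v w \<theta>) - \<phi> v) \<le> L * ((\<bar>v\<bar> + \<bar>w\<bar>) * \<bar>sin \<theta>\<bar>)"
    by (rule order_trans[OF L mult_left_mono[OF abs_post_velocity_diff_le[OF True] L0]])
  then have "b \<theta> * \<bar>g w\<bar> * \<bar>g v\<bar> * norm (\<phi> (post_velocity v w \<theta>) - \<phi> v) \<le> b \<theta> * \<bar>g w\<bar> * \<bar>g v\<bar> * (L * ((\<bar>v\<bar> + \<bar>w\<bar>) * \<bar>sin \<theta>\<bar>))"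
    by (intro mult_left_mono) (auto simp: b_nonneg)
  then show ?thesis
    unfolding p collision_def norm_scaleR by (simp add: moment_weight_def abs_mult b_nonneg algebra_simps)
qed (simp add: collision_def b_eq_0)

lemma collision_measurable:
  assumes [measurable]: "\<phi> \<in> borel_measurable borel" "g \<in> borel_measurable borel"
  shows "(\<lambda>(p, \<theta>). collision \<phi> g p \<theta>) \<in> borel_measurable (borel \<Otimes>\<^sub>M borel)"
  unfolding collision_def post_velocity_def borel_prod[symmetric] by measurable

lemma collision_integrable:
  fixes \<phi> :: "real \<Rightarrow> 'b::{banach, second_countable_topology}"
  assumes \<phi>: "\<phi> \<in> borel_measurable borel" and L: "\<And>x y. norm (\<phi> x - \<phi> y) \<le> L * \<bar>x - y\<bar>"
    and g: "integrable lborel g" "integrable lborel (\<lambda>v. \<bar>g v\<bar> * \<bar>v\<bar>)"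
  shows "integrable (lborel \<Otimes>\<^sub>M lborel) (\<lambda>(p, \<theta>). collision \<phi> g p \<theta>)"
proof (rule Bochner_Integration.integrable_bound)
  show "integrable (lborel \<Otimes>\<^sub>M lborel) (\<lambda>z. L * (case z of (p, \<theta>) \<Rightarrow> moment_weight g p * (b \<theta> * \<bar>sin \<theta>\<bar>)))"
    by (intro integrable_mult_right integrable_pair_mult moment_weight g b_sin_integrable)
  show "AE z in lborel \<Otimes>\<^sub>M lborel. norm (case z of (p, \<theta>) \<Rightarrow> collision \<phi> g p \<theta>)
      \<le> norm (L * (case z of (p, \<theta>) \<Rightarrow> moment_weight g p * (b \<theta> * \<bar>sin \<theta>\<bar>)))"
    using collision_bound[OF L, of g] by (intro always_eventually) (auto intro: order_trans[OF _ abs_ge_self])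
  show "(\<lambda>(p, \<theta>). collision \<phi> g p \<theta>) \<in> borel_measurable (lborel \<Otimes>\<^sub>M lborel)"
    using collision_measurable[OF \<phi>, of g] g(1) by (simp add: borel_measurable_integrable cong: measurable_cong_sets)
qed

lemma collision_integral_bound:
  fixes \<phi> :: "real \<Rightarrow> 'b::{banach, second_countable_topology}"
  assumes \<phi>: "\<phi> \<in> borel_measurable borel" and L: "\<And>x y. norm (\<phi> x - \<phi> y) \<le> L * \<bar>x - y\<bar>"
    and g: "integrable lborel g" "integrable lborel (\<lambda>v. \<bar>g v\<bar> * \<bar>v\<bar>)"
  shows "norm (\<integral>z. (case z of (p, \<theta>) \<Rightarrow> collision \<phi> g p \<theta>) \<partial>(lborel \<Otimes>\<^sub>M lborel))
    \<le> L * (2 * (\<integral>v. \<bar>g v\<bar> \<partial>lborel) * (\<integral>v. \<bar>g v\<bar> * \<bar>v\<bar> \<partial>lborel) * B1)"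
proof -
  have "norm (\<integral>z. (case z of (p, \<theta>) \<Rightarrow> collision \<phi> g p \<theta>) \<partial>(lborel \<Otimes>\<^sub>M lborel))
    \<le> (\<integral>z. L * (case z of (p, \<theta>) \<Rightarrow> moment_weight g p * (b \<theta> * \<bar>sin \<theta>\<bar>)) \<partial>(lborel \<Otimes>\<^sub>M lborel))"
    by (intro Bochner_Integration.integral_norm_bound_integral collision_integrable[OF assms] integrable_mult_right integrable_pair_mult moment_weight g b_sin_integrable)
      (use collision_bound[OF L, of g] in auto)
  also have "\<dots> = L * (2 * (\<integral>v. \<bar>g v\<bar> \<partial>lborel) * (\<integral>v. \<bar>g v\<bar> * \<bar>v\<bar> \<partial>lborel) * B1)"
    using integral_pair_mult[OF moment_weight(1)[OF g] b_sin_integrable] moment_weight(2)[OF g]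
    by (simp add: lborel_prod B1_def)
  finally show ?thesis .
qed

text \<open>Stated as an iterated integral of an arbitrary Borel version, so that it also applies to
  slices of a jointly Borel function when measurability in time is proved.\<close>

lemma kac_weak_form_eq_iterated:
  assumes h[measurable]: "h \<in> borel_measurable borel" and gh: "AE v in lborel. g v = h v"
    and \<phi>[measurable]: "\<phi> \<in> borel_measurable borel"
  shows "kac_weak_form \<beta> g \<phi> = (\<integral>p. (\<integral>\<theta>. collision \<phi> h p \<theta> \<partial>lborel) \<partial>lborel)"
proof -
  note cm[measurable] = collision_measurable[OF \<phi> h]
  have ae: "AE p in lborel. (case p of (v, w) \<Rightarrow>
           (LINT \<theta>:{-pi/2..pi/2}|lebesgue.
              \<beta> \<theta> * g w * g v * (\<phi> (post_velocity v w \<theta>) - \<phi> v))) = (\<integral>\<theta>. collision \<phi> h p \<theta> \<partial>lborel)"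
    using AE_lborel_pair[OF gh gh]
  proof eventually_elim
    case (elim p)
    obtain v w where p: "p = (v, w)" by force
    have "(\<lambda>\<theta>. collision \<phi> h p \<theta>) \<in> borel_measurable lborel"
      unfolding p collision_def post_velocity_def by measurable
    from integral_completion[OF this]
    have "(LINT \<theta>|lebesgue. collision \<phi> h p \<theta>) = (\<integral>\<theta>. collision \<phi> h p \<theta> \<partial>lborel)" .
    then show ?case using elim
      by (simp add: p collision_def b_def set_lebesgue_integral_def mult.assoc)
  qed
  have m: "(\<lambda>p. \<integral>\<theta>. collision \<phi> h p \<theta> \<partial>lborel) \<in> borel_measurable borel"
    using lborel.borel_measurable_lebesgue_integral[of "\<lambda>p \<theta>. collision \<phi> h p \<theta>" borel] cm
    by (simp cong: measurable_cong_sets)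
  show ?thesis unfolding kac_weak_form_def
    by (rule integral_lebesgue_eq_lborel[OF borel_measurable_lebesgue_AE_eq[OF m ae] m ae])
qed

lemma kac_weak_form_eq:
  assumes h: "integrable lborel h" "integrable lborel (\<lambda>v. \<bar>h v\<bar> * \<bar>v\<bar>)" and gh: "AE v in lborel. g v = h v"
    and \<phi>: "\<phi> \<in> borel_measurable borel" and L: "\<And>x y. norm (\<phi> x - \<phi> y) \<le> L * \<bar>x - y\<bar>"
  shows "kac_weak_form \<beta> g \<phi> = (\<integral>z. (case z of (p, \<theta>) \<Rightarrow> collision \<phi> h p \<theta>) \<partial>(lborel \<Otimes>\<^sub>M lborel))"
  using kac_weak_form_eq_iterated[OF _ gh \<phi>] h(1)
    lborel_pair.integral_fst[OF collision_integrable[OF \<phi> L h]]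
  by (simp add: borel_measurable_integrable)

definition bobylev :: "(real \<Rightarrow> complex) \<Rightarrow> real \<Rightarrow> real \<Rightarrow> complex" where
  "bobylev F \<xi> \<theta> = b \<theta> *\<^sub>R (F (\<xi> * cos \<theta>) * F (- (\<xi> * sin \<theta>)) - F 0 * F \<xi>)"

text \<open>At the post-collisional velocity, \<open>cis\<close> splits into a function of
  \<open>v\<close> times a function of \<open>w\<close>, so integrating over the pair first gives
  products of values of \<open>F\<close>. Gain and loss stay together throughout, since separately
  neither need be integrable in \<open>\<theta>\<close>.\<close>

lemma collision_cis:
  fixes h :: "real \<Rightarrow> real" and \<xi> :: real
  assumes h: "integrable lborel h" "integrable lborel (\<lambda>v. \<bar>h v\<bar> * \<bar>v\<bar>)"
  defines "F \<equiv> \<lambda>\<xi>. \<integral>v. h v *\<^sub>R cis (\<xi> * v) \<partial>lborel"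
  shows "integrable lborel (bobylev F \<xi>)"
    and "(\<integral>z. (case z of (p, \<theta>) \<Rightarrow> collision (\<lambda>v. cis (\<xi> * v)) h p \<theta>) \<partial>(lborel \<Otimes>\<^sub>M lborel)) = (\<integral>\<theta>. bobylev F \<xi> \<theta> \<partial>lborel)"
proof -
  have [measurable]: "h \<in> borel_measurable borel" using h by (simp add: borel_measurable_integrable)
  have hc: "integrable lborel (\<lambda>v. complex_of_real (h v) * cis (\<eta> * v))" for \<eta>
    by (rule Bochner_Integration.integrable_bound[OF h(1)]) (auto simp: norm_mult)
  have Fc: "(\<integral>v. complex_of_real (h v) * cis (\<eta> * v) \<partial>lborel) = F \<eta>" for \<eta>
    by (simp add: F_def scaleR_conv_of_real)
  have I: "integrable (lborel \<Otimes>\<^sub>M lborel) (\<lambda>(p, \<theta>). collision (\<lambda>v. cis (\<xi> * v)) h p \<theta>)"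
    by (rule collision_integrable[OF _ norm_cis_diff_le h]) measurable
  have inner: "(\<integral>p. collision (\<lambda>v. cis (\<xi> * v)) h p \<theta> \<partial>lborel) = bobylev F \<xi> \<theta>" for \<theta>
  proof -
    let ?c = "\<lambda>\<eta> v. complex_of_real (h v) * cis (\<eta> * v)"
    have i1: "integrable lborel (\<lambda>p. case p of (v, w) \<Rightarrow> ?c (\<xi> * cos \<theta>) v * ?c (- (\<xi> * sin \<theta>)) w)"
      and i2: "integrable lborel (\<lambda>p. case p of (v, w) \<Rightarrow> ?c \<xi> v * ?c 0 w)"
      using integrable_pair_mult[OF hc hc] unfolding lborel_prod by blast+
    have eq: "collision (\<lambda>v. cis (\<xi> * v)) h p \<theta> = b \<theta> *\<^sub>R
       ((case p of (v, w) \<Rightarrow> ?c (\<xi> * cos \<theta>) v * ?c (- (\<xi> * sin \<theta>)) w) - (case p of (v, w) \<Rightarrow> ?c \<xi> v * ?c 0 w))" for p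
    proof -
      obtain v w where p: "p = (v, w)" by force
      have "cis (\<xi> * post_velocity v w \<theta>) = cis (\<xi> * cos \<theta> * v) * cis (- (\<xi> * sin \<theta>) * w)"
        by (simp add: cis_mult post_velocity_def algebra_simps)
      then show ?thesis by (simp add: p collision_def scaleR_conv_of_real algebra_simps)
    qed
    have "(\<integral>p. collision (\<lambda>v. cis (\<xi> * v)) h p \<theta> \<partial>lborel) = b \<theta> *\<^sub>R
       ((\<integral>p. (case p of (v, w) \<Rightarrow> ?c (\<xi> * cos \<theta>) v * ?c (- (\<xi> * sin \<theta>)) w) \<partial>lborel) - (\<integral>p. (case p of (v, w) \<Rightarrow> ?c \<xi> v * ?c 0 w) \<partial>lborel))"
      by (simp only: eq integral_scaleR_right Bochner_Integration.integral_diff[OF i1 i2])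
    then show ?thesis
      unfolding integral_pair_mult[OF hc hc] Fc bobylev_def by (simp add: mult.commute)
  qed
  show "integrable lborel (bobylev F \<xi>)"
    using lborel_pair.integrable_snd[OF I] unfolding inner .
  show "(\<integral>z. (case z of (p, \<theta>) \<Rightarrow> collision (\<lambda>v. cis (\<xi> * v)) h p \<theta>) \<partial>(lborel \<Otimes>\<^sub>M lborel)) = (\<integral>\<theta>. bobylev F \<xi> \<theta> \<partial>lborel)"
    using lborel_pair.integral_snd[OF I] unfolding inner by simp
qed

end

section \<open>The barrier\<close>

text \<open>The derivative of \<open>g\<close> compares \<open>(1 + z) powr (s - 1)\<close> with its
  value at the shifted point \<open>x + z\<close>, and is nonnegative because the exponent is
  nonpositive. The claim is \<open>g 0 \<le> g y\<close>.\<close>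

lemma powr_one_plus_subadditive:
  fixes s x y :: real
  assumes "0 \<le> s" "s \<le> 1" "0 \<le> x" "0 \<le> y"
  shows "(1 + (x + y)) powr s - 1 \<le> ((1 + x) powr s - 1) + ((1 + y) powr s - 1)"
proof -
  define g where "g z = (1 + z) powr s - (1 + (x + z)) powr s" for z
  have "g 0 \<le> g y"
  proof (rule DERIV_nonneg_imp_nondecreasing[OF assms(4)])
    fix z assume z: "0 \<le> z" "z \<le> y"
    have "(g has_real_derivative s * (1 + z) powr (s - 1) - s * (1 + (x + z)) powr (s - 1)) (at z)"
      unfolding g_def using z assms by (auto intro!: derivative_eq_intros)
    moreover have "(1 + (x + z)) powr (s - 1) \<le> (1 + z) powr (s - 1)"
      using z assms by (intro powr_mono2') auto
    ultimately show "\<exists>d. (g has_real_derivative d) (at z) \<and> 0 \<le> d"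
      using assms(1) by (intro exI[of _ "s * (1 + z) powr (s - 1) - s * (1 + (x + z)) powr (s - 1)"] conjI) (auto intro!: mult_left_mono)
  qed
  then show ?thesis unfolding g_def by simp
qed

lemma powr_one_plus_le_linear:
  fixes s x :: real
  assumes "0 \<le> s" "s \<le> 1" "0 \<le> x"
  shows "(1 + x) powr s - 1 \<le> x"
proof -
  have "(1 + x) powr s \<le> (1 + x) powr 1" using assms by (intro powr_mono) auto
  then show ?thesis using assms by simp
qed

text \<open>Numbers in \<open>(0, 1]\<close> do not decrease when raised to the power
  \<open>s\<close>; applied to \<open>1 / (1 + x)\<close> and \<open>x / (1 + x)\<close>, which sum
  to 1, this gives \<open>(1 + x) powr s \<le> 1 + x powr s\<close>.\<close>

lemma powr_one_plus_le_powr: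
  fixes s x :: real
  assumes "0 \<le> s" "s \<le> 1" "0 < x"
  shows "(1 + x) powr s - 1 \<le> x powr s"
proof -
  have *: "a \<le> a powr s" if "0 < a" "a \<le> 1" for a :: real
    using powr_mono'[of s 1 a] that assms by simp
  have "1 = 1 / (1 + x) + x / (1 + x)" using assms by (simp add: field_simps)
  also have "\<dots> \<le> (1 / (1 + x)) powr s + (x / (1 + x)) powr s"
    using assms by (intro add_mono *) auto
  also have "\<dots> = (1 + x powr s) / (1 + x) powr s"
    using assms by (simp add: powr_divide add_divide_distrib)
  finally show ?thesis using assms by (simp add: le_divide_eq)
qed

text \<open>Half of the gap \<open>d * x\<close> pays for the growth of the exponential:
  \<open>m - d * x \<le> (m - d / 2 * x) * (1 - k * x)\<close>, and
  \<open>1 - k * x \<le> exp (- (k * x))\<close>. It is used with \<open>d = \<delta>\<close> and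
  \<open>k = c * t\<close>.\<close>

lemma exp_mult_le_one_minus:
  fixes m d x k :: real
  assumes "0 < m" "0 \<le> d" "0 \<le> x" "d * x \<le> m" "0 \<le> k" "k * m \<le> d / 2"
  shows "exp (k * x) * (m - d * x) \<le> m - d / 2 * x"
proof -
  have kx: "k * x * m \<le> d / 2 * x" using mult_right_mono[OF assms(6,3)] by (simp add: ac_simps)
  define c where "c = d / 2"
  have d: "d = 2 * c" by (simp add: c_def)
  have "(m - d * x) \<le> (m - d / 2 * x) * (1 - k * x)"
  proof -
    have "(m - c * x) * (1 - k * x) = m - 2 * c * x + (c * x - k * x * m) + c * x * (k * x)"
      by (simp add: algebra_simps)
    moreover have "0 \<le> c * x * (k * x)" using assms d by simp
    ultimately show ?thesis using kx by (simp add: d)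
  qed
  also have "\<dots> \<le> (m - d / 2 * x) * exp (- (k * x))"
    using exp_ge_add_one_self[of "- (k * x)"] assms by (intro mult_left_mono) auto
  finally have "exp (k * x) * (m - d * x) \<le> exp (k * x) * ((m - d / 2 * x) * exp (- (k * x)))"
    by (intro mult_left_mono) auto
  also have "\<dots> = m - d / 2 * x"
    by (simp add: exp_minus field_simps)
  finally show ?thesis .
qed

section \<open>The maximum principle\<close>

text \<open>\<open>small\<close> keeps the barrier above the gap bound for
  \<open>|\<xi>| \<le> \<eta>\<close>. \<open>gain\<close> provides, for each higher frequency, a
  minorant \<open>W\<close> of \<open>b \<theta> * (sin \<theta>)\<^sup>2\<close> supported where
  \<open>\<xi> * sin \<theta>\<close> lies in the gap region; its strict inequality says that the
  dissipation there beats the relative decay rate of the barrier.\<close>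

locale kac_barrier = angular_kernel +
  fixes F :: "real \<Rightarrow> real \<Rightarrow> complex" and T s m c \<delta> \<eta> :: real
  assumes T: "0 < T" and s: "0 \<le> s" "s \<le> 1" and m: "0 < m" and c: "0 < c" and \<delta>: "0 < \<delta>" and \<eta>: "0 < \<eta>"
    and cont: "continuous_on ({0..T} \<times> UNIV) (\<lambda>(t, \<xi>). F t \<xi>)"
    and deriv: "\<And>t \<xi>. t \<in> {0..T} \<Longrightarrow>
        ((\<lambda>t. F t \<xi>) has_vector_derivative (\<integral>\<theta>. bobylev (F t) \<xi> \<theta> \<partial>lborel)) (at t within {0..T})"
    and int: "\<And>t \<xi>. t \<in> {0..T} \<Longrightarrow> integrable lborel (bobylev (F t) \<xi>)"
    and F0: "\<And>t. t \<in> {0..T} \<Longrightarrow> F t 0 = m"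
    and bound: "\<And>t \<xi>. t \<in> {0..T} \<Longrightarrow> norm (F t \<xi>) \<le> m"
    and gap: "\<And>t \<xi>. t \<in> {0..T} \<Longrightarrow> \<bar>\<xi>\<bar> \<le> \<eta> \<Longrightarrow> norm (F t \<xi>) \<le> m - \<delta> * \<xi>\<^sup>2"
    and small: "c * T * m \<le> \<delta> / 2"
    and gain: "\<And>\<xi>. \<eta> \<le> \<bar>\<xi>\<bar> \<Longrightarrow> \<exists>W. integrable lborel W \<and>
        (\<forall>\<theta>. 0 \<le> W \<theta> \<and> W \<theta> \<le> b \<theta> * (sin \<theta>)\<^sup>2 \<and> (W \<theta> \<noteq> 0 \<longrightarrow> \<bar>\<xi> * sin \<theta>\<bar> \<le> \<eta>)) \<and>
        c * ((1 + \<xi>\<^sup>2) powr s - 1) < \<delta> / 2 * \<xi>\<^sup>2 * (\<integral>\<theta>. W \<theta> \<partial>lborel)"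
begin

definition \<psi> :: "real \<Rightarrow> real" where "\<psi> \<xi> = (1 + \<xi>\<^sup>2) powr s - 1"

definition H :: "real \<Rightarrow> real \<Rightarrow> real" where "H t \<xi> = m * exp (- (c * t * \<psi> \<xi>))"

lemma \<psi>_nonneg: "0 \<le> \<psi> \<xi>"
  unfolding \<psi>_def using s by (simp add: ge_one_powr_ge_zero)

lemma \<psi>_le: "\<psi> \<xi> \<le> \<xi>\<^sup>2"
  unfolding \<psi>_def by (rule powr_one_plus_le_linear) (use s in auto)

lemma \<psi>_cos_sin: "\<psi> \<xi> \<le> \<psi> (\<xi> * cos \<theta>) + \<psi> (- (\<xi> * sin \<theta>))"
proof -
  have "\<xi>\<^sup>2 = (\<xi> * cos \<theta>)\<^sup>2 + (- (\<xi> * sin \<theta>))\<^sup>2"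
    by (simp add: power_mult_distrib flip: distrib_left)
  then show ?thesis
    unfolding \<psi>_def using powr_one_plus_subadditive[OF s, of "(\<xi> * cos \<theta>)\<^sup>2" "(- (\<xi> * sin \<theta>))\<^sup>2"] by simp
qed

lemma H_pos: "0 < H t \<xi>" unfolding H_def using m by simp

lemma H_le: "0 \<le> t \<Longrightarrow> H t \<xi> \<le> m"
  unfolding H_def using m c \<psi>_nonneg[of \<xi>] by (simp add: mult_left_le)

text \<open>Linearising the exponential from below gives
  \<open>H t \<xi> \<ge> m - m * c * t * \<psi> \<xi>\<close>; then
  \<open>\<psi> \<xi> \<le> \<xi>\<^sup>2\<close> and \<open>small\<close> keep this loss within the
  gap \<open>\<delta> * \<xi>\<^sup>2\<close>.\<close>

lemma F_le_H_low:
  assumes t: "t \<in> {0..T}" and "\<bar>\<xi>\<bar> \<le> \<eta>"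
  shows "norm (F t \<xi>) \<le> H t \<xi>"
proof -
  have "c * t * \<psi> \<xi> * m \<le> c * T * \<xi>\<^sup>2 * m"
    using t m c \<psi>_le[of \<xi>] \<psi>_nonneg[of \<xi>] by (intro mult_right_mono mult_mono) auto
  also have "\<dots> \<le> \<delta> / 2 * \<xi>\<^sup>2" using mult_right_mono[OF small, of "\<xi>\<^sup>2"] by (simp add: ac_simps)
  also have "\<dots> \<le> \<delta> * \<xi>\<^sup>2" using \<delta> by simp
  finally have "m - \<delta> * \<xi>\<^sup>2 \<le> m * (1 + - (c * t * \<psi> \<xi>))" by (simp add: algebra_simps)
  also have "\<dots> \<le> H t \<xi>" unfolding H_def using m by (intro mult_left_mono exp_ge_add_one_self) auto
  finally show ?thesis using gap[OF assms] by simp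
qed

text \<open>At a contact point no angle contributes a positive amount, because subadditivity of
  \<open>\<psi>\<close> bounds the product of the barrier values at
  \<open>\<xi> * cos \<theta>\<close> and \<open>- (\<xi> * sin \<theta>)\<close> by
  \<open>m\<close> times the value at \<open>\<xi>\<close>. Angles with \<open>W \<noteq> 0\<close>
  put the sine frequency into the gap region, which yields a quantitative loss. Here
  \<open>W\<close> is the value of the minorant at the single angle \<open>\<theta>\<close>.\<close>

lemma dissipation:
  assumes t: "t \<in> {0..T}" and \<nu>: "0 \<le> \<nu>"
    and le: "\<And>\<zeta>. norm (F t \<zeta>) \<le> H t \<zeta> + \<nu> * \<zeta>\<^sup>2"
    and eq: "norm (F t \<xi>) = H t \<xi> + \<nu> * \<xi>\<^sup>2"
    and W: "0 \<le> W" "W \<le> b \<theta> * (sin \<theta>)\<^sup>2" "W \<noteq> 0 \<Longrightarrow> \<bar>\<xi> * sin \<theta>\<bar> \<le> \<eta>"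
  shows "Re (cnj (F t \<xi>) * bobylev (F t) \<xi> \<theta>) \<le> - (norm (F t \<xi>) * H t \<xi> * (\<delta> / 2 * \<xi>\<^sup>2)) * W"
proof -
  define G where "G = norm (F t \<xi>)"
  define A where "A = norm (F t (\<xi> * cos \<theta>))"
  define S where "S = norm (F t (- (\<xi> * sin \<theta>)))"
  define Hc where "Hc = H t (\<xi> * cos \<theta>)"
  define Hs where "Hs = H t (- (\<xi> * sin \<theta>))"
  define Hx where "Hx = H t \<xi>"
  define x where "x = \<xi>\<^sup>2 * (sin \<theta>)\<^sup>2"
  define y where "y = \<xi>\<^sup>2 * (cos \<theta>)\<^sup>2"
  have xy: "\<xi>\<^sup>2 = x + y" unfolding x_def y_def by (simp flip: distrib_left)
  have x0: "0 \<le> x" "0 \<le> y" unfolding x_def y_def by auto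
  have G0: "0 \<le> G" "0 \<le> A" "0 \<le> S" unfolding G_def A_def S_def by auto
  have Hp: "0 < Hc" "0 < Hs" "0 < Hx" unfolding Hc_def Hs_def Hx_def by (auto intro: H_pos)
  have Sm: "S \<le> m" unfolding S_def by (rule bound[OF t])
  have Hcm: "Hc \<le> m" unfolding Hc_def using t by (intro H_le) auto
  have AH: "A \<le> Hc + \<nu> * y" using le[of "\<xi> * cos \<theta>"] by (simp add: A_def Hc_def y_def power_mult_distrib)
  have SH: "S \<le> Hs + \<nu> * x" using le[of "- (\<xi> * sin \<theta>)"] by (simp add: S_def Hs_def x_def power_mult_distrib)
  have GH: "G = Hx + \<nu> * (x + y)" using eq xy by (simp add: G_def Hx_def)
  have t0: "0 \<le> t" "t \<le> T" using t by auto
  have "Re (cnj (F t \<xi>) * bobylev (F t) \<xi> \<theta>) =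
      b \<theta> * (Re (cnj (F t \<xi>) * (F t (\<xi> * cos \<theta>) * F t (- (\<xi> * sin \<theta>)))) - m * Re (cnj (F t \<xi>) * F t \<xi>))"
    by (simp add: bobylev_def F0[OF t] algebra_simps)
  also have "Re (cnj (F t \<xi>) * F t \<xi>) = G * G"
    unfolding G_def using cmod_power2[of "F t \<xi>"] by (simp add: power2_eq_square)
  also have "b \<theta> * (Re (cnj (F t \<xi>) * (F t (\<xi> * cos \<theta>) * F t (- (\<xi> * sin \<theta>)))) - m * (G * G)) \<le> b \<theta> * (G * (A * S) - m * (G * G))"
    using complex_Re_le_cmod[of "cnj (F t \<xi>) * (F t (\<xi> * cos \<theta>) * F t (- (\<xi> * sin \<theta>)))"]
    by (intro mult_left_mono b_nonneg) (simp add: norm_mult G_def A_def S_def)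
  also have "\<dots> = b \<theta> * G * (A * S - m * G)" by (simp add: algebra_simps)
  finally have main: "Re (cnj (F t \<xi>) * bobylev (F t) \<xi> \<theta>) \<le> b \<theta> * G * (A * S - m * G)" .
  show ?thesis
  proof (cases "W = 0")
    case True
    \<comment> \<open>Since \<open>S\<close> and \<open>Hc\<close> are at most \<open>m\<close>, the
      perturbations add up to at most \<open>m * \<nu> * (x + y)\<close>, exactly the perturbation
      contained in \<open>m * G\<close>.\<close>
    have "A * S \<le> (Hc + \<nu> * y) * S" using AH G0 by (intro mult_right_mono)
    also have "\<dots> \<le> Hc * (Hs + \<nu> * x) + \<nu> * y * m"
      unfolding distrib_right using SH Sm Hp x0 \<nu> by (intro add_mono mult_left_mono) auto
    also have "\<dots> = Hc * Hs + \<nu> * x * Hc + \<nu> * y * m" by (simp add: algebra_simps)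
    also have "\<dots> \<le> Hc * Hs + \<nu> * x * m + \<nu> * y * m" using Hcm x0 \<nu> by (auto intro!: mult_left_mono)
    also have "Hc * Hs \<le> m * Hx"
    proof -
      have "c * t * \<psi> \<xi> \<le> c * t * (\<psi> (\<xi> * cos \<theta>) + \<psi> (- (\<xi> * sin \<theta>)))"
        using \<psi>_cos_sin t0 c by (intro mult_left_mono) auto
      then have "exp (- (c * t * \<psi> (\<xi> * cos \<theta>))) * exp (- (c * t * \<psi> (- (\<xi> * sin \<theta>)))) \<le> exp (- (c * t * \<psi> \<xi>))"
        unfolding exp_add[symmetric] by (simp add: algebra_simps)
      then have "m * m * (exp (- (c * t * \<psi> (\<xi> * cos \<theta>))) * exp (- (c * t * \<psi> (- (\<xi> * sin \<theta>))))) \<le> m * m * exp (- (c * t * \<psi> \<xi>))"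
        using m by (intro mult_left_mono) auto
      then show ?thesis unfolding Hc_def Hs_def Hx_def H_def by (simp add: ac_simps)
    qed
    finally have "A * S - m * G \<le> 0" unfolding GH by (simp add: algebra_simps)
    then have "b \<theta> * G * (A * S - m * G) \<le> 0"
      using b_nonneg[of \<theta>] G0 by (intro mult_nonneg_nonpos) auto
    then show ?thesis using main True by simp
  next
    case False
    then have sm: "\<bar>- (\<xi> * sin \<theta>)\<bar> \<le> \<eta>" using W(3) by simp
    \<comment> \<open>The gap improves the sine factor to \<open>m - \<delta> * x\<close>, while
      replacing the barrier at \<open>\<xi> * cos \<theta>\<close> by the one at
      \<open>\<xi>\<close> costs at most \<open>exp (c * t * x)\<close>, as \<open>\<psi>\<close>
      drops by at most \<open>x\<close>. \<open>exp_mult_le_one_minus\<close> balances the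
      two.\<close>
    have Sx: "S \<le> m - \<delta> * x" using gap[OF t sm] by (simp add: S_def x_def power_mult_distrib)
    have "\<psi> \<xi> - \<psi> (\<xi> * cos \<theta>) \<le> x"
      using \<psi>_cos_sin[of \<xi> \<theta>] \<psi>_le[of "- (\<xi> * sin \<theta>)"] by (simp add: x_def power_mult_distrib)
    then have "c * t * (\<psi> \<xi> - \<psi> (\<xi> * cos \<theta>)) \<le> c * t * x" using c t0 by (intro mult_left_mono) auto
    then have "exp (- (c * t * \<psi> (\<xi> * cos \<theta>))) \<le> exp (- (c * t * \<psi> \<xi>)) * exp (c * t * x)"
      unfolding exp_add[symmetric] by (simp add: algebra_simps)
    then have Hcx: "Hc \<le> Hx * exp (c * t * x)"
      unfolding Hc_def Hx_def H_def using m by simp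
    have "c * t * m \<le> c * T * m" using c t0 m by simp
    then have k: "c * t * m \<le> \<delta> / 2" using small by simp
    have dx: "\<delta> * x \<le> m" using Sx G0 by simp
    have "A * S \<le> (Hc + \<nu> * y) * (m - \<delta> * x)"
      using AH Sx G0 Hp \<nu> x0 by (intro mult_mono) auto
    also have "\<dots> \<le> Hx * exp (c * t * x) * (m - \<delta> * x) + \<nu> * y * m"
      unfolding distrib_right using Hcx dx x0 \<nu> \<delta> by (intro add_mono mult_left_mono mult_right_mono) auto
    also have "\<dots> = Hx * (exp (c * t * x) * (m - \<delta> * x)) + \<nu> * y * m" by simp
    also have "\<dots> \<le> Hx * (m - \<delta> / 2 * x) + \<nu> * y * m"
      using Hp exp_mult_le_one_minus[OF m _ x0(1) dx _ k] \<delta> c t0 by (intro add_right_mono mult_left_mono) auto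
    also have "\<dots> \<le> Hx * (m - \<delta> / 2 * x) + \<nu> * (x + y) * m"
      using \<nu> x0 m by (intro add_left_mono mult_right_mono mult_left_mono) auto
    finally have "A * S - m * G \<le> - (Hx * (\<delta> / 2 * x))" unfolding GH by (simp add: algebra_simps)
    then have "b \<theta> * G * (A * S - m * G) \<le> b \<theta> * G * (- (Hx * (\<delta> / 2 * x)))"
      using b_nonneg G0 by (intro mult_left_mono) auto
    also have "\<dots> = - (G * Hx * (\<delta> / 2 * \<xi>\<^sup>2)) * (b \<theta> * (sin \<theta>)\<^sup>2)" by (simp add: x_def)
    also have "\<dots> \<le> - (G * Hx * (\<delta> / 2 * \<xi>\<^sup>2)) * W"
      using W(2) G0 Hp \<delta> by (intro mult_left_mono_neg) auto
    finally show ?thesis using main by (simp add: G_def Hx_def)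
  qed
qed

lemma F_continuous_t: "continuous_on {0..T} (\<lambda>t. F t \<xi>)"
  by (rule continuous_on_compose2[OF cont, of _ "\<lambda>t. (t, \<xi>)", simplified]) (auto intro!: continuous_intros)

lemma H_continuous_t: "continuous_on A (\<lambda>t. H t \<xi>)"
  unfolding H_def by (intro continuous_intros)

text \<open>The term \<open>\<nu> * \<xi>\<^sup>2\<close> confines the contact set to a compact set. It costs nothing in the collision term,
  as \<open>\<xi>\<^sup>2 = (\<xi> cos \<theta>)\<^sup>2 + (\<xi> sin \<theta>)\<^sup>2\<close>.\<close>
lemma barrier_perturbed:
  assumes \<nu>: "0 < \<nu>" and t: "t \<in> {0..T}"
  shows "norm (F t \<xi>) \<le> H t \<xi> + \<nu> * \<xi>\<^sup>2"
proof (rule ccontr)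
  assume neg: "\<not> ?thesis"
  define P where "P = (\<lambda>(t, \<xi>). H t \<xi> + \<nu> * \<xi>\<^sup>2 - norm (F t \<xi>))"
  \<comment> \<open>From \<open>|\<xi>| = X\<close> on, the term
    \<open>\<nu> * \<xi>\<^sup>2\<close> alone is at least \<open>m\<close>, the bound for
    \<open>|F|\<close>.\<close>
  define X where "X = sqrt (m / \<nu>)"
  have low: "0 \<le> P (t, \<xi>)" if "t \<in> {0..T}" "\<bar>\<xi>\<bar> \<le> \<eta>" for t \<xi>
  proof -
    have "0 \<le> \<nu> * \<xi>\<^sup>2" using \<nu> by simp
    then show ?thesis unfolding P_def using F_le_H_low[OF that] by simp
  qed
  have high: "0 \<le> P (t, \<xi>)" if "t \<in> {0..T}" "X \<le> \<bar>\<xi>\<bar>" for t \<xi>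
  proof -
    have "X\<^sup>2 \<le> \<xi>\<^sup>2" using power_mono[OF that(2), of 2] m \<nu> by (simp add: X_def)
    then have "m \<le> \<nu> * \<xi>\<^sup>2" using m \<nu> by (simp add: X_def field_simps)
    then show ?thesis unfolding P_def using bound[OF that(1), of \<xi>] H_pos[of t \<xi>] by simp
  qed
  define K where "K = {0..T} \<times> ({- X..X} \<inter> {\<xi>. \<eta> \<le> \<bar>\<xi>\<bar>})"
  have "closed {\<xi>::real. \<eta> \<le> \<bar>\<xi>\<bar>}" by (intro closed_Collect_le continuous_intros)
  then have K: "compact K" unfolding K_def by (intro compact_Times compact_Int_closed) auto
  have "continuous_on K (\<lambda>x. norm ((\<lambda>(t, \<xi>). F t \<xi>) x))"
    by (intro continuous_on_norm continuous_on_subset[OF cont]) (auto simp: K_def)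
  moreover have "continuous_on K (\<lambda>x. H (fst x) (snd x) + \<nu> * (snd x)\<^sup>2)"
    unfolding H_def \<psi>_def by (intro continuous_intros continuous_on_powr') (auto simp: add_nonneg_eq_0_iff)
  ultimately have "continuous_on K (\<lambda>x. H (fst x) (snd x) + \<nu> * (snd x)\<^sup>2 - norm ((\<lambda>(t, \<xi>). F t \<xi>) x))"
    by (intro continuous_on_diff)
  then have contP: "continuous_on K P" by (simp add: P_def case_prod_beta')
  \<comment> \<open>The nonstrict condition \<open>P \<le> 0\<close> makes \<open>Z\<close> closed,
    so a point of earliest time exists. By \<open>low\<close> and \<open>high\<close>, every point
    where the bound fails lies in \<open>Z\<close>.\<close>
  define Z where "Z = K \<inter> P -` {..0}"
  have "closed Z" unfolding Z_def by (intro continuous_closed_preimage contP compact_imp_closed[OF K] closed_atMost)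
  then have Zc: "compact Z" using compact_Int_closed[OF K, of Z] by (simp add: Z_def Int_absorb1 Int_assoc[symmetric])
  have outside: "0 < P (t, \<xi>)" if "t \<in> {0..T}" "(t, \<xi>) \<notin> Z" "\<eta> \<le> \<bar>\<xi>\<bar>" "\<bar>\<xi>\<bar> \<le> X" for t \<xi>
    using that by (auto simp: Z_def K_def abs_le_iff)
  have inZ: "(t, \<xi>) \<in> Z" if "t \<in> {0..T}" "P (t, \<xi>) < 0" for t \<xi>
    using low[OF that(1), of \<xi>] high[OF that(1), of \<xi>] outside[OF that(1), of \<xi>] that(2) by fastforce
  have "P (t, \<xi>) < 0" using neg by (simp add: P_def)
  then have "Z \<noteq> {}" using inZ[OF t] by blast
  then obtain z where z: "z \<in> Z" "\<And>y. y \<in> Z \<Longrightarrow> fst z \<le> fst y"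
    using continuous_attains_inf[OF Zc, of fst] continuous_on_fst[OF continuous_on_id] by blast
  obtain t0 \<xi>0 where zt: "z = (t0, \<xi>0)" by force
  have t0: "t0 \<in> {0..T}" and \<xi>0: "\<eta> \<le> \<bar>\<xi>0\<bar>" and P0: "P (t0, \<xi>0) \<le> 0"
    using z(1) unfolding zt Z_def K_def by auto
  have "0 < \<xi>0\<^sup>2" using \<xi>0 \<eta> by (simp add: zero_less_power2) 
  have pos: "0 < t0"
  proof (rule ccontr)
    assume "\<not> 0 < t0"
    then have "t0 = 0" using t0 by simp
    then have "P (t0, \<xi>0) = m + \<nu> * \<xi>0\<^sup>2 - norm (F 0 \<xi>0)" by (simp add: P_def H_def)
    moreover have "norm (F 0 \<xi>0) \<le> m" using bound[of 0] T by simp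
    moreover have "0 < \<nu> * \<xi>0\<^sup>2" using \<open>0 < \<xi>0\<^sup>2\<close> \<nu> by simp
    ultimately show False using P0 by simp
  qed
  have before: "0 \<le> P (\<tau>, \<zeta>)" if "0 \<le> \<tau>" "\<tau> < t0" for \<tau> \<zeta>
    using inZ[of \<tau> \<zeta>] z(2)[of "(\<tau>, \<zeta>)"] that t0 unfolding zt by fastforce
  \<comment> \<open>Before \<open>t0\<close> the bound holds at all frequencies, and left continuity
    carries it to \<open>t0\<close>. This supplies the bound at all frequencies that
    \<open>dissipation\<close> assumes at the contact time.\<close>
  have at: "0 \<le> P (t0, \<zeta>)" for \<zeta>
  proof (rule tendsto_lowerbound[of "\<lambda>\<tau>. P (\<tau>, \<zeta>)" _ "at_left t0"])
    have "continuous_on {0..t0} (\<lambda>\<tau>. P (\<tau>, \<zeta>))"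
      unfolding P_def using t0
      by (auto intro!: continuous_intros H_continuous_t continuous_on_subset[OF F_continuous_t])
    then show "((\<lambda>\<tau>. P (\<tau>, \<zeta>)) \<longlongrightarrow> P (t0, \<zeta>)) (at_left t0)"
      using pos by (rule continuous_on_Icc_at_leftD)
    show "\<forall>\<^sub>F \<tau> in at_left t0. 0 \<le> P (\<tau>, \<zeta>)"
      unfolding eventually_at_left_field using before pos by (intro exI[of _ 0]) auto
  qed simp
  have le: "norm (F t0 \<zeta>) \<le> H t0 \<zeta> + \<nu> * \<zeta>\<^sup>2" for \<zeta>
    using at[of \<zeta>] by (simp add: P_def)
  have eq: "norm (F t0 \<xi>0) = H t0 \<xi>0 + \<nu> * \<xi>0\<^sup>2"
    using at[of \<xi>0] P0 by (simp add: P_def)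
  define G where "G = norm (F t0 \<xi>0)"
  define h where "h = H t0 \<xi>0"
  define Q where "Q = (\<integral>\<theta>. bobylev (F t0) \<xi>0 \<theta> \<partial>lborel)"
  have h0: "0 < h" unfolding h_def by (rule H_pos)
  have G0: "0 < G" unfolding G_def eq h_def[symmetric] using h0 \<nu> by (simp add: add_pos_nonneg)
  obtain W where W: "integrable lborel W" "\<And>\<theta>. 0 \<le> W \<theta>" "\<And>\<theta>. W \<theta> \<le> b \<theta> * (sin \<theta>)\<^sup>2"
      "\<And>\<theta>. W \<theta> \<noteq> 0 \<Longrightarrow> \<bar>\<xi>0 * sin \<theta>\<bar> \<le> \<eta>"
    and gW: "c * \<psi> \<xi>0 < \<delta> / 2 * \<xi>0\<^sup>2 * (\<integral>\<theta>. W \<theta> \<partial>lborel)"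
    using gain[OF \<xi>0] unfolding \<psi>_def by blast
  have "Re (cnj (F t0 \<xi>0) * Q) = (\<integral>\<theta>. Re (cnj (F t0 \<xi>0) * bobylev (F t0) \<xi>0 \<theta>) \<partial>lborel)"
    unfolding Q_def using int[OF t0, of \<xi>0] by (subst integral_Re) auto
  also have "\<dots> \<le> (\<integral>\<theta>. - (G * h * (\<delta> / 2 * \<xi>0\<^sup>2)) * W \<theta> \<partial>lborel)"
  proof (rule integral_mono)
    show "integrable lborel (\<lambda>\<theta>. Re (cnj (F t0 \<xi>0) * bobylev (F t0) \<xi>0 \<theta>))"
      using int[OF t0, of \<xi>0] by (intro integrable_Re integrable_mult_right)
    show "integrable lborel (\<lambda>\<theta>. - (G * h * (\<delta> / 2 * \<xi>0\<^sup>2)) * W \<theta>)"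
      using W(1) by (intro integrable_mult_right)
    show "Re (cnj (F t0 \<xi>0) * bobylev (F t0) \<xi>0 \<theta>) \<le> - (G * h * (\<delta> / 2 * \<xi>0\<^sup>2)) * W \<theta>" for \<theta>
      unfolding G_def h_def using dissipation[OF t0 _ le eq W(2,3,4)] \<nu> by simp
  qed
  also have "\<dots> = - (G * h * (\<delta> / 2 * \<xi>0\<^sup>2 * (\<integral>\<theta>. W \<theta> \<partial>lborel)))" by simp
  also have "\<dots> < - (G * h * (c * \<psi> \<xi>0))"
    using gW G0 h0 by simp
  finally have ReQ: "Re (cnj (F t0 \<xi>0) * Q) < - (G * h * (c * \<psi> \<xi>0))" .
  \<comment> \<open>Squares are compared because the squared modulus is a polynomial in the real and
    imaginary parts, hence differentiable with them. The derivative at \<open>t0\<close> turns out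
    positive while \<open>D t0 = 0\<close>, so \<open>D\<close> is negative just before
    \<open>t0\<close>, against \<open>before\<close>.\<close>
  define D where "D \<tau> = (H \<tau> \<xi>0 + \<nu> * \<xi>0\<^sup>2)\<^sup>2 - ((Re (F \<tau> \<xi>0))\<^sup>2 + (Im (F \<tau> \<xi>0))\<^sup>2)" for \<tau>
  have D_eq: "D \<tau> = (H \<tau> \<xi>0 + \<nu> * \<xi>0\<^sup>2)\<^sup>2 - (norm (F \<tau> \<xi>0))\<^sup>2" for \<tau>
    unfolding D_def cmod_power2 ..
  have dH: "((\<lambda>\<tau>. H \<tau> \<xi>0) has_real_derivative - (c * \<psi> \<xi>0) * h) (at t0 within {0..T})"
    unfolding H_def h_def by (auto intro!: derivative_eq_intros)
  have dF: "((\<lambda>\<tau>. F \<tau> \<xi>0) has_vector_derivative Q) (at t0 within {0..T})"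
    unfolding Q_def by (rule deriv[OF t0])
  have dR: "((\<lambda>\<tau>. Re (F \<tau> \<xi>0)) has_real_derivative Re Q) (at t0 within {0..T})"
    and dI: "((\<lambda>\<tau>. Im (F \<tau> \<xi>0)) has_real_derivative Im Q) (at t0 within {0..T})"
    unfolding has_real_derivative_iff_has_vector_derivative
    by (rule bounded_linear.has_vector_derivative[OF bounded_linear_Re dF]
        bounded_linear.has_vector_derivative[OF bounded_linear_Im dF])+
  have "(D has_real_derivative 2 * G * (- (c * \<psi> \<xi>0) * h) - 2 * Re (cnj (F t0 \<xi>0) * Q)) (at t0 within {0..T})"
    unfolding D_def
    by (rule derivative_eq_intros dH dR dI refl)+ (simp add: G_def eq h_def algebra_simps)
  moreover have "0 < 2 * G * (- (c * \<psi> \<xi>0) * h) - 2 * Re (cnj (F t0 \<xi>0) * Q)"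
    using ReQ by (simp add: algebra_simps)
  ultimately obtain d where d: "d > 0" "\<And>k. 0 < k \<Longrightarrow> t0 - k \<in> {0..T} \<Longrightarrow> k < d \<Longrightarrow> D (t0 - k) < D t0"
    using has_real_derivative_pos_inc_left[of D _ t0 "{0..T}"] by blast
  define k where "k = min (d / 2) t0"
  have k: "0 < k" "k < d" "k \<le> t0" unfolding k_def using d(1) pos by auto
  have "D (t0 - k) < D t0" using d(2)[of k] k t0 by auto
  moreover have "D t0 = 0" unfolding D_eq eq by simp
  moreover have "0 \<le> D (t0 - k)"
  proof -
    have "norm (F (t0 - k) \<xi>0) \<le> H (t0 - k) \<xi>0 + \<nu> * \<xi>0\<^sup>2"
      using before[of "t0 - k" \<xi>0] k by (simp add: P_def)
    then show ?thesis unfolding D_eq by (simp add: power_mono)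
  qed
  ultimately show False by simp
qed

theorem barrier:
  assumes t: "t \<in> {0..T}"
  shows "norm (F t \<xi>) \<le> m * exp (- (c * t * ((1 + \<xi>\<^sup>2) powr s - 1)))"
proof -
  have "norm (F t \<xi>) \<le> H t \<xi> + e" if "0 < e" for e
  proof -
    have p: "0 < 1 + \<xi>\<^sup>2" by (simp add: add_pos_nonneg)
    \<comment> \<open>The frequency is fixed here, so \<open>\<nu>\<close> may depend on it; this
      choice makes the perturbation at most \<open>e\<close>.\<close>
    have "norm (F t \<xi>) \<le> H t \<xi> + e / (1 + \<xi>\<^sup>2) * \<xi>\<^sup>2"
      using that p by (intro barrier_perturbed t) simp
    also have "e / (1 + \<xi>\<^sup>2) * \<xi>\<^sup>2 \<le> e" using that p by (simp add: divide_le_eq algebra_simps)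
    finally show ?thesis by simp
  qed
  then show ?thesis unfolding H_def \<psi>_def by (rule field_le_epsilon)
qed

end

section \<open>Weak solutions in Fourier variables\<close>

lemma cos_lipschitz: "norm (cos (\<xi> * x) - cos (\<xi> * y)) \<le> \<bar>\<xi>\<bar> * \<bar>x - y\<bar>" for \<xi> x y :: real
  using order_trans[OF abs_Re_le_cmod norm_cis_diff_le[of \<xi> x y]] by simp

lemma sin_lipschitz: "norm (sin (\<xi> * x) - sin (\<xi> * y)) \<le> \<bar>\<xi>\<bar> * \<bar>x - y\<bar>" for \<xi> x y :: real
  using order_trans[OF abs_Im_le_cmod norm_cis_diff_le[of \<xi> x y]] by simp

locale kac_flow = angular_kernel \<beta> for \<beta> +
  fixes f0 :: "real \<Rightarrow> real" and T :: real and f :: "real \<Rightarrow> real \<Rightarrow> real"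
  assumes T: "0 < T"
    and joint: "(\<lambda>(t, v). f t v) \<in> borel_measurable (lebesgue_on ({0..T} \<times> UNIV))"
    and sol: "kac_weak_solution \<beta> f0 T f"
    and f0_integrable: "integrable lebesgue f0"
begin

definition mass :: real where "mass = (LINT v|lebesgue. f0 v)"

definition energy :: real where "energy = (LINT v|lebesgue. f0 v * \<bar>v\<bar>\<^sup>2)"

text \<open>A bound for the weak form per unit of Lipschitz constant: two symmetric terms, each mass
  times first moment, with the first moment at most \<open>mass + energy\<close> because
  \<open>|v| \<le> 1 + |v|\<^sup>2\<close>. Conservation makes it the same at all times.\<close>

definition K :: real where "K = 2 * mass * (mass + energy) * B1"

definition F :: "real \<Rightarrow> real \<Rightarrow> complex" where "F t = fourier (f t)"

lemma solution:
  assumes "t \<in> {0..T}"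
  shows "AE v in lebesgue. 0 \<le> f t v"
    and "integrable lebesgue (f t)" "(LINT v|lebesgue. f t v) = mass"
    and "integrable lebesgue (\<lambda>v. f t v * \<bar>v\<bar>\<^sup>2)" "(LINT v|lebesgue. f t v * \<bar>v\<bar>\<^sup>2) = energy"
  using sol assms unfolding kac_weak_solution_def mass_def energy_def by blast+

lemma weak_equation:
  assumes "t \<in> {0..T}" "test_function \<phi>"
  shows "(LINT v|lebesgue. f t v * \<phi> v) - (LINT v|lebesgue. f0 v * \<phi> v)
    = (LINT \<tau>:{0..t}|lebesgue. kac_weak_form \<beta> (f \<tau>) \<phi>)"
  using sol assms unfolding kac_weak_solution_def by blast

text \<open>The maximum with 0 makes the representative nonnegative everywhere. As the conservation
  laws hold at every time, so do these bounds, not merely at almost every time.\<close>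

lemma borel_representative:
  assumes t: "t \<in> {0..T}"
  obtains h where "h \<in> borel_measurable borel" "\<And>v. 0 \<le> h v" "AE v in lborel. f t v = h v"
    "integrable lborel h" "(\<integral>v. h v \<partial>lborel) = mass"
    "integrable lborel (\<lambda>v. \<bar>h v\<bar> * \<bar>v\<bar>)" "(\<integral>v. \<bar>h v\<bar> * \<bar>v\<bar> \<partial>lborel) \<le> mass + energy"
proof -
  have fm: "f t \<in> borel_measurable lebesgue" using solution(2)[OF t] by (rule borel_measurable_integrable)
  obtain g where g[measurable]: "g \<in> borel_measurable borel" and fg: "AE v in lborel. f t v = g v"
    by (rule lebesgue_borel_representative[OF fm])
  define h where "h v = max 0 (g v)" for v
  have hm[measurable]: "h \<in> borel_measurable borel" unfolding h_def by measurable
  have h0: "0 \<le> h v" for v by (simp add: h_def)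
  have "AE v in lborel. 0 \<le> f t v" using solution(1)[OF t] by (simp add: AE_completion_iff)
  then have fh: "AE v in lborel. f t v = h v" using fg by eventually_elim (simp add: h_def)
  have hi: "integrable lborel h" using integrable_lebesgue_eq_lborel[OF fm hm fh] solution(2)[OF t] by simp
  have hI: "(\<integral>v. h v \<partial>lborel) = mass" using integral_lebesgue_eq_lborel[OF fm hm fh] solution(3)[OF t] by simp
  have m2: "(\<lambda>v. f t v * \<bar>v\<bar>\<^sup>2) \<in> borel_measurable lebesgue" using solution(4)[OF t] by (rule borel_measurable_integrable)
  have h2m: "(\<lambda>v. h v * \<bar>v\<bar>\<^sup>2) \<in> borel_measurable borel" by measurable
  have fh2: "AE v in lborel. f t v * \<bar>v\<bar>\<^sup>2 = h v * \<bar>v\<bar>\<^sup>2" using fh by eventually_elim simp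
  have h2i: "integrable lborel (\<lambda>v. h v * \<bar>v\<bar>\<^sup>2)"
    using integrable_lebesgue_eq_lborel[OF m2 h2m fh2] solution(4)[OF t] by simp
  have h2I: "(\<integral>v. h v * \<bar>v\<bar>\<^sup>2 \<partial>lborel) = energy"
    using integral_lebesgue_eq_lborel[OF m2 h2m fh2] solution(5)[OF t] by simp
  have b: "\<bar>h v\<bar> * \<bar>v\<bar> \<le> h v + h v * \<bar>v\<bar>\<^sup>2" for v
  proof -
    have "0 \<le> (\<bar>v\<bar> - 1)\<^sup>2" by simp
    then have "2 * \<bar>v\<bar> \<le> 1 + \<bar>v\<bar>\<^sup>2" by (simp add: power2_eq_square algebra_simps)
    then have "\<bar>v\<bar> \<le> 1 + \<bar>v\<bar>\<^sup>2" using abs_ge_zero[of v] by linarith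
    then have "h v * \<bar>v\<bar> \<le> h v * (1 + \<bar>v\<bar>\<^sup>2)" using h0 by (intro mult_left_mono) auto
    then show ?thesis using h0[of v] by (simp add: algebra_simps)
  qed
  have h1: "integrable lborel (\<lambda>v. \<bar>h v\<bar> * \<bar>v\<bar>)"
    by (rule Bochner_Integration.integrable_bound[OF Bochner_Integration.integrable_add[OF hi h2i]])
      (use b in \<open>auto intro: order_trans[OF _ abs_ge_self]\<close>)
  have "(\<integral>v. \<bar>h v\<bar> * \<bar>v\<bar> \<partial>lborel) \<le> (\<integral>v. h v + h v * \<bar>v\<bar>\<^sup>2 \<partial>lborel)"
    using b by (intro integral_mono h1 Bochner_Integration.integrable_add hi h2i)
  also have "\<dots> = mass + energy" using hi h2i hI h2I by simp
  finally show ?thesis using that hm h0 fh hi hI h1 by blast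
qed

lemma mass_nonneg: "0 \<le> mass" and energy_nonneg: "0 \<le> energy"
proof -
  have t: "0 \<in> {0..T}" using T by simp
  show "0 \<le> mass" unfolding solution(3)[OF t, symmetric]
    by (rule integral_nonneg_AE[OF solution(1)[OF t]])
  show "0 \<le> energy" unfolding solution(5)[OF t, symmetric]
    by (rule integral_nonneg_AE) (use solution(1)[OF t] in \<open>eventually_elim, simp\<close>)
qed

lemma K_nonneg: "0 \<le> K"
  unfolding K_def using mass_nonneg energy_nonneg B1_nonneg by simp

lemma kac_weak_form_bound:
  assumes t: "t \<in> {0..T}" and \<phi>: "\<phi> \<in> borel_measurable borel" and L: "\<And>x y. norm (\<phi> x - \<phi> y) \<le> L * \<bar>x - y\<bar>"
  shows "\<bar>kac_weak_form \<beta> (f t) \<phi>\<bar> \<le> L * K"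
proof -
  obtain h where h: "h \<in> borel_measurable borel" "\<And>v. 0 \<le> h v" "AE v in lborel. f t v = h v"
    "integrable lborel h" "(\<integral>v. h v \<partial>lborel) = mass"
    "integrable lborel (\<lambda>v. \<bar>h v\<bar> * \<bar>v\<bar>)" "(\<integral>v. \<bar>h v\<bar> * \<bar>v\<bar> \<partial>lborel) \<le> mass + energy"
    by (rule borel_representative[OF t]) blast
  have L0: "0 \<le> L" using order_trans[OF norm_ge_zero L[of 1 0]] by simp
  have "\<bar>kac_weak_form \<beta> (f t) \<phi>\<bar> \<le> L * (2 * (\<integral>v. \<bar>h v\<bar> \<partial>lborel) * (\<integral>v. \<bar>h v\<bar> * \<bar>v\<bar> \<partial>lborel) * B1)"
    unfolding kac_weak_form_eq[OF h(4,6,3) \<phi> L]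
    using collision_integral_bound[OF \<phi> L h(4,6)] by simp
  also have "(\<integral>v. \<bar>h v\<bar> \<partial>lborel) = mass" using h(2,5) by simp
  also have "L * (2 * mass * (\<integral>v. \<bar>h v\<bar> * \<bar>v\<bar> \<partial>lborel) * B1) \<le> L * K"
    unfolding K_def using L0 h(7) mass_nonneg B1_nonneg by (intro mult_left_mono mult_right_mono) auto
  finally show ?thesis .
qed

text \<open>The solution is only jointly Lebesgue measurable, so a jointly Borel version, equal to \<open>f \<tau>\<close> for
  almost every \<open>\<tau>\<close>, is integrated instead.\<close>
lemma kac_weak_form_measurable:
  assumes \<phi>[measurable]: "\<phi> \<in> borel_measurable borel"
  shows "(\<lambda>\<tau>. indicator {0..T} \<tau> *\<^sub>R kac_weak_form \<beta> (f \<tau>) \<phi>) \<in> borel_measurable lebesgue"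
proof -
  have S: "{0..T} \<times> (UNIV :: real set) \<in> sets lebesgue"
    using borel_closed[of "{0..T} \<times> (UNIV :: real set)"] closed_Times[of "{0..T}" "UNIV :: real set"]
    by (auto simp: sets_completionI_sets)
  \<comment> \<open>Extension by 0 off the strip gives a Lebesgue measurable function on the whole
    plane, which has a Borel version \<open>k\<close>; almost every time slice then agrees with that
    of \<open>k\<close> almost everywhere.\<close>
  have "(\<lambda>x. if x \<in> {0..T} \<times> UNIV then (\<lambda>(t, v). f t v) x else 0) \<in> borel_measurable lebesgue"
    using borel_measurable_if[OF S, of "\<lambda>(t, v). f t v"] joint by simp
  then obtain k where k: "k \<in> borel_measurable borel"
    and ae: "AE x in lborel. (if x \<in> {0..T} \<times> UNIV then (\<lambda>(t, v). f t v) x else 0) = k x"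
    by (rule lebesgue_borel_representative)
  have km[measurable]: "k \<in> borel_measurable (borel \<Otimes>\<^sub>M borel)" using k by (simp add: borel_prod)
  have "AE \<tau> in lborel. AE v in lborel. (if (\<tau>, v) \<in> {0..T} \<times> UNIV then (\<lambda>(t, v). f t v) (\<tau>, v) else 0) = k (\<tau>, v)"
    by (rule lborel_pair.AE_pair) (use ae in \<open>simp only: lborel_prod\<close>)
  then have fk: "AE \<tau> in lborel. \<tau> \<in> {0..T} \<longrightarrow> (AE v in lborel. f \<tau> v = k (\<tau>, v))"
  proof eventually_elim
    case (elim \<tau>)
    then show ?case by (intro impI) simp
  qed
  have ks: "(\<lambda>v. k (\<tau>, v)) \<in> borel_measurable borel" for \<tau> by measurable
  define R where "R \<tau> = indicator {0..T} \<tau> * (\<integral>p. (\<integral>\<theta>. collision \<phi> (\<lambda>v. k (\<tau>, v)) p \<theta> \<partial>lborel) \<partial>lborel)" for \<tau> :: real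
  have [measurable]: "R \<in> borel_measurable borel"
    unfolding R_def collision_def post_velocity_def lborel_prod[symmetric] by measurable
  have "AE \<tau> in lborel. indicator {0..T} \<tau> *\<^sub>R kac_weak_form \<beta> (f \<tau>) \<phi> = R \<tau>"
    using fk
  proof eventually_elim
    case (elim \<tau>)
    then show ?case
      using kac_weak_form_eq_iterated[OF ks _ \<phi>, of "f \<tau>" \<tau>] by (cases "\<tau> \<in> {0..T}") (auto simp: R_def)
  qed
  then show ?thesis by (intro borel_measurable_lebesgue_AE_eq[of R]) auto
qed

lemma kac_weak_form_integrable:
  assumes \<phi>: "\<phi> \<in> borel_measurable borel" and L: "\<And>x y. norm (\<phi> x - \<phi> y) \<le> L * \<bar>x - y\<bar>"
    and ac: "0 \<le> a" "c \<le> T"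
  shows "set_integrable lebesgue {a..c} (\<lambda>\<tau>. kac_weak_form \<beta> (f \<tau>) \<phi>)"
proof -
  have "integrable lebesgue (\<lambda>\<tau>. indicator {0..T} \<tau> *\<^sub>R kac_weak_form \<beta> (f \<tau>) \<phi>)"
  proof (rule Bochner_Integration.integrable_bound[of _ "\<lambda>\<tau>. indicator {0..T} \<tau> * (L * K)"])
    show "integrable lebesgue (\<lambda>\<tau>. indicator {0..T} \<tau> * (L * K))"
      by (intro integrable_mult_left integrable_real_indicator) (auto simp: emeasure_lborel_Icc_eq)
    show "AE \<tau> in lebesgue. norm (indicator {0..T} \<tau> *\<^sub>R kac_weak_form \<beta> (f \<tau>) \<phi>) \<le> norm (indicator {0..T} \<tau> * (L * K))"
      using kac_weak_form_bound[OF _ \<phi> L] by (auto simp: indicator_def intro: order_trans[OF _ abs_ge_self])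
  qed (rule kac_weak_form_measurable[OF \<phi>])
  then have "set_integrable lebesgue {0..T} (\<lambda>\<tau>. kac_weak_form \<beta> (f \<tau>) \<phi>)"
    by (simp add: set_integrable_def)
  then show ?thesis by (rule set_integrable_subset) (use ac in auto)
qed

section \<open>Beyond compactly supported test functions\<close>

text \<open>A common Lipschitz constant gives a common dominating function for the collision
  integrands, so pointwise convergence of the test functions suffices.\<close>

lemma kac_weak_form_tendsto:
  assumes t: "t \<in> {0..T}"
    and \<phi>: "\<And>n. \<phi> n \<in> borel_measurable borel" and L: "\<And>n x y. norm (\<phi> n x - \<phi> n y) \<le> L * \<bar>x - y\<bar>"
    and lim: "\<And>x. (\<lambda>n. \<phi> n x) \<longlonglongrightarrow> \<phi>' x"
  shows "(\<lambda>n. kac_weak_form \<beta> (f t) (\<phi> n)) \<longlonglongrightarrow> kac_weak_form \<beta> (f t) \<phi>'"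
proof -
  obtain h where h: "h \<in> borel_measurable borel" "\<And>v. 0 \<le> h v" "AE v in lborel. f t v = h v"
    "integrable lborel h" "(\<integral>v. h v \<partial>lborel) = mass"
    "integrable lborel (\<lambda>v. \<bar>h v\<bar> * \<bar>v\<bar>)" "(\<integral>v. \<bar>h v\<bar> * \<bar>v\<bar> \<partial>lborel) \<le> mass + energy"
    by (rule borel_representative[OF t]) blast
  have \<phi>'m: "\<phi>' \<in> borel_measurable borel"
    by (rule borel_measurable_LIMSEQ_real[OF lim \<phi>])
  have L': "norm (\<phi>' x - \<phi>' y) \<le> L * \<bar>x - y\<bar>" for x y
    by (rule tendsto_upperbound[OF tendsto_norm[OF tendsto_diff[OF lim lim]]]) (auto simp: L[unfolded real_norm_def] intro!: always_eventually)
  note eq = kac_weak_form_eq[OF h(4,6,3)]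
  show ?thesis
    unfolding eq[OF \<phi> L] eq[OF \<phi>'m L']
  proof (rule integral_dominated_convergence[where w = "\<lambda>z. L * (case z of (p, \<theta>) \<Rightarrow> moment_weight h p * (b \<theta> * \<bar>sin \<theta>\<bar>))"])
    show "(\<lambda>(p, \<theta>). collision \<phi>' h p \<theta>) \<in> borel_measurable (lborel \<Otimes>\<^sub>M lborel)"
      using collision_integrable[OF \<phi>'m L' h(4,6)] by (rule borel_measurable_integrable)
    show "(\<lambda>(p, \<theta>). collision (\<phi> n) h p \<theta>) \<in> borel_measurable (lborel \<Otimes>\<^sub>M lborel)" for n
      using collision_integrable[OF \<phi> L h(4,6)] by (rule borel_measurable_integrable)
    show "integrable (lborel \<Otimes>\<^sub>M lborel) (\<lambda>z. L * (case z of (p, \<theta>) \<Rightarrow> moment_weight h p * (b \<theta> * \<bar>sin \<theta>\<bar>)))"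
      by (intro integrable_mult_right integrable_pair_mult moment_weight h(4,6) b_sin_integrable)
    show "AE z in lborel \<Otimes>\<^sub>M lborel. norm (case z of (p, \<theta>) \<Rightarrow> collision (\<phi> n) h p \<theta>)
        \<le> L * (case z of (p, \<theta>) \<Rightarrow> moment_weight h p * (b \<theta> * \<bar>sin \<theta>\<bar>))" for n
      using collision_bound[OF L[of n], of h] by (intro always_eventually) auto
    show "AE z in lborel \<Otimes>\<^sub>M lborel. (\<lambda>n. case z of (p, \<theta>) \<Rightarrow> collision (\<phi> n) h p \<theta>)
        \<longlonglongrightarrow> (case z of (p, \<theta>) \<Rightarrow> collision \<phi>' h p \<theta>)"
      unfolding collision_def by (intro always_eventually allI) (auto intro!: tendsto_intros lim)
  qed
qed

lemma smooth_gen_measurable: "\<phi> \<in> smooth_gen \<Longrightarrow> \<phi> \<in> borel_measurable borel"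
  by (rule borel_measurable_continuous_onI)
    (metis DERIV_continuous continuous_at_imp_continuous_on smooth_gen_derivative)

text \<open>Multiplication by \<open>bump (- real n) (real n)\<close> yields test functions with
  Lipschitz constant \<open>L + 4\<close> for all \<open>n\<close>, so both sides of the weak
  equation pass to the limit.\<close>

lemma weak_equation_smooth:
  assumes t: "t \<in> {0..T}" and \<phi>: "\<phi> \<in> smooth_gen" and \<phi>1: "\<And>x. \<bar>\<phi> x\<bar> \<le> 1"
    and L: "\<And>x y. norm (\<phi> x - \<phi> y) \<le> L * \<bar>x - y\<bar>"
  shows "(LINT v|lebesgue. f t v * \<phi> v) - (LINT v|lebesgue. f0 v * \<phi> v)
    = (LINT \<tau>:{0..t}|lebesgue. kac_weak_form \<beta> (f \<tau>) \<phi>)"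
proof -
  define \<phi>n where "\<phi>n n x = bump (- real n) (real n) x * \<phi> x" for n x
  have sm: "\<phi>n n \<in> smooth_gen" for n
    unfolding \<phi>n_def[abs_def] by (intro smooth_gen.mult bump_smooth_gen \<phi>)
  note ms = smooth_gen_measurable[OF sm] smooth_gen_measurable[OF \<phi>]
  have test: "test_function (\<phi>n n)" for n
    by (rule test_function_smooth_gen[OF sm, where a = "- real n" and b = "real n"]) (auto simp: \<phi>n_def bump_eq_0)
  have bnd: "\<bar>\<phi>n n x\<bar> \<le> 1" for n x
    unfolding \<phi>n_def abs_mult using bump_bounds \<phi>1 by (intro mult_le_one) auto
  have Ln: "norm (\<phi>n n x - \<phi>n n y) \<le> (L + 4) * \<bar>x - y\<bar>" for n x y
  proof -
    have "\<bar>\<phi>n n x - \<phi>n n y\<bar> \<le> \<bar>\<phi> x - \<phi> y\<bar> + \<bar>bump (- real n) (real n) x - bump (- real n) (real n) y\<bar>"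
      unfolding \<phi>n_def by (intro abs_mult_diff_le \<phi>1) (use bump_bounds in auto)
    also have "\<dots> \<le> L * \<bar>x - y\<bar> + 4 * \<bar>x - y\<bar>"
      using L[of x y] bump_lipschitz[of "- real n" "real n" x y] by (intro add_mono) auto
    finally show ?thesis by (simp add: algebra_simps)
  qed
  have lim: "(\<lambda>n. \<phi>n n x) \<longlonglongrightarrow> \<phi> x" for x
    using tendsto_mult[OF bump_tendsto_1[of x] tendsto_const[of "\<phi> x"]] by (simp add: \<phi>n_def)
  have mleb: "\<phi>n n \<in> borel_measurable lebesgue" "\<phi> \<in> borel_measurable lebesgue" for n
    by (rule measurable_completion, use ms in simp)+
  have left: "(\<lambda>n. LINT v|lebesgue. g v * \<phi>n n v) \<longlonglongrightarrow> (LINT v|lebesgue. g v * \<phi> v)" if g: "integrable lebesgue g" for g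
  proof (rule integral_dominated_convergence[where w = "\<lambda>v. \<bar>g v\<bar>"])
    show "AE x in lebesgue. (\<lambda>n. g x * \<phi>n n x) \<longlonglongrightarrow> g x * \<phi> x"
      by (intro AE_I2 tendsto_intros lim)
    show "AE x in lebesgue. norm (g x * \<phi>n n x) \<le> \<bar>g x\<bar>" for n
      using bnd by (auto simp: abs_mult intro!: mult_left_le)
  qed (use g mleb borel_measurable_integrable[OF g] in auto)
  have right: "(\<lambda>n. LINT \<tau>:{0..t}|lebesgue. kac_weak_form \<beta> (f \<tau>) (\<phi>n n)) \<longlonglongrightarrow> (LINT \<tau>:{0..t}|lebesgue. kac_weak_form \<beta> (f \<tau>) \<phi>)"
    unfolding set_lebesgue_integral_def
  proof (rule integral_dominated_convergence[where w = "\<lambda>\<tau>. indicator {0..t} \<tau> * ((L + 4) * K)"])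
    show "(\<lambda>\<tau>. indicator {0..t} \<tau> *\<^sub>R kac_weak_form \<beta> (f \<tau>) \<phi>) \<in> borel_measurable lebesgue"
      using kac_weak_form_integrable[OF ms(2) L, of 0 t] t unfolding set_integrable_def
      by (intro borel_measurable_integrable) auto
    show "(\<lambda>\<tau>. indicator {0..t} \<tau> *\<^sub>R kac_weak_form \<beta> (f \<tau>) (\<phi>n n)) \<in> borel_measurable lebesgue" for n
      using kac_weak_form_integrable[OF ms(1) Ln, of 0 t n] t unfolding set_integrable_def
      by (intro borel_measurable_integrable) auto
    show "integrable lebesgue (\<lambda>\<tau>. indicator {0..t} \<tau> * ((L + 4) * K))"
      by (intro integrable_mult_left integrable_real_indicator) (auto simp: emeasure_lborel_Icc_eq)
    show "AE \<tau> in lebesgue. norm (indicator {0..t} \<tau> *\<^sub>R kac_weak_form \<beta> (f \<tau>) (\<phi>n n)) \<le> indicator {0..t} \<tau> * ((L + 4) * K)" for n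
      using kac_weak_form_bound[OF _ ms(1) Ln] t by (auto simp: indicator_def)
    show "AE \<tau> in lebesgue. (\<lambda>n. indicator {0..t} \<tau> *\<^sub>R kac_weak_form \<beta> (f \<tau>) (\<phi>n n)) \<longlonglongrightarrow> indicator {0..t} \<tau> *\<^sub>R kac_weak_form \<beta> (f \<tau>) \<phi>"
      using kac_weak_form_tendsto[OF _ ms(1) Ln lim] t by (intro AE_I2) (auto simp: indicator_def)
  qed
  have "(\<lambda>n. (LINT v|lebesgue. f t v * \<phi>n n v) - (LINT v|lebesgue. f0 v * \<phi>n n v))
      \<longlonglongrightarrow> (LINT v|lebesgue. f t v * \<phi> v) - (LINT v|lebesgue. f0 v * \<phi> v)"
    by (intro tendsto_diff left solution(2)[OF t] f0_integrable)
  then show ?thesis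
    unfolding weak_equation[OF t test] using right LIMSEQ_unique by blast
qed

text \<open>Used twice: for the continuity of \<open>F\<close> in time, and for the persistence of
  the bump averages behind the spectral gap.\<close>

lemma time_lipschitz:
  assumes t: "0 \<le> t" "t \<le> t'" "t' \<le> T" and \<phi>: "\<phi> \<in> smooth_gen" and \<phi>1: "\<And>x. \<bar>\<phi> x\<bar> \<le> 1"
    and L: "\<And>x y. norm (\<phi> x - \<phi> y) \<le> L * \<bar>x - y\<bar>"
  shows "\<bar>(LINT v|lebesgue. f t' v * \<phi> v) - (LINT v|lebesgue. f t v * \<phi> v)\<bar> \<le> L * K * (t' - t)"
proof -
  note \<phi>m = smooth_gen_measurable[OF \<phi>]
  let ?k = "\<lambda>\<tau>. kac_weak_form \<beta> (f \<tau>) \<phi>"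
  have si: "set_integrable lebesgue {a..c} ?k" if "0 \<le> a" "c \<le> T" for a c
    by (rule kac_weak_form_integrable[OF \<phi>m L that])
  have ab: "?k absolutely_integrable_on {a..c}" if "0 \<le> a" "c \<le> T" for a c
    using si[OF that] .
  have eq: "(LINT \<tau>:{a..c}|lebesgue. ?k \<tau>) = integral {a..c} ?k" if "0 \<le> a" "c \<le> T" for a c
    using set_lebesgue_integral_eq_integral(2)[OF ab[OF that]] .
  have "(LINT v|lebesgue. f t' v * \<phi> v) - (LINT v|lebesgue. f t v * \<phi> v) = integral {0..t'} ?k - integral {0..t} ?k"
    using weak_equation_smooth[OF _ \<phi> \<phi>1 L, of t] weak_equation_smooth[OF _ \<phi> \<phi>1 L, of t'] t eq[of 0 t] eq[of 0 t'] by simp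
  also have "\<dots> = integral {t..t'} ?k"
    using Henstock_Kurzweil_Integration.integral_combine[of 0 t t' ?k] t
      set_lebesgue_integral_eq_integral(1)[OF ab[of 0 t']] by simp
  also have "\<bar>\<dots>\<bar> \<le> L * K * (t' - t)"
  proof -
    have "norm (integral {t..t'} ?k) \<le> L * K * measure lborel {t..t'}"
      unfolding interval_cbox
    proof (rule integrable_bound)
      show "0 \<le> L * K" using order_trans[OF abs_ge_zero kac_weak_form_bound[OF _ \<phi>m L, of 0]] T by simp
      show "?k integrable_on cbox t t'"
        using set_lebesgue_integral_eq_integral(1)[OF ab[of t t']] t by simp
    qed (use kac_weak_form_bound[OF _ \<phi>m L] t in auto)
    then show ?thesis using t by simp
  qed
  finally show ?thesis .
qed

section \<open>Regularity of the Fourier transform and Bobylev's equation\<close>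

text \<open>Test functions are real, so the equation for \<open>F\<close> is assembled from its real
  and imaginary parts, tested with cosine and sine. The Lipschitz bound in the frequency expresses
  the finite first moment.\<close>

lemma F_bounds:
  assumes t: "t \<in> {0..T}"
  shows "F t 0 = mass" and "norm (F t \<xi>) \<le> mass"
    and "norm (F t \<xi> - F t \<zeta>) \<le> (mass + energy) * \<bar>\<xi> - \<zeta>\<bar>"
    and "integrable lborel (bobylev (F t) \<xi>)"
    and "kac_weak_form \<beta> (f t) (\<lambda>v. cos (\<xi> * v)) = Re (\<integral>\<theta>. bobylev (F t) \<xi> \<theta> \<partial>lborel)"
    and "kac_weak_form \<beta> (f t) (\<lambda>v. sin (\<xi> * v)) = Im (\<integral>\<theta>. bobylev (F t) \<xi> \<theta> \<partial>lborel)"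
    and "Re (F t \<xi>) = (LINT v|lebesgue. f t v * cos (\<xi> * v))"
    and "Im (F t \<xi>) = (LINT v|lebesgue. f t v * sin (\<xi> * v))"
proof -
  obtain h where h: "h \<in> borel_measurable borel" "\<And>v. 0 \<le> h v" "AE v in lborel. f t v = h v"
    "integrable lborel h" "(\<integral>v. h v \<partial>lborel) = mass"
    "integrable lborel (\<lambda>v. \<bar>h v\<bar> * \<bar>v\<bar>)" "(\<integral>v. \<bar>h v\<bar> * \<bar>v\<bar> \<partial>lborel) \<le> mass + energy"
    by (rule borel_representative[OF t]) blast
  have hm[measurable]: "h \<in> borel_measurable borel" by (rule h(1))
  have fm: "f t \<in> borel_measurable lebesgue" using solution(2)[OF t] by (rule borel_measurable_integrable)
  have Fh: "F t = (\<lambda>\<xi>. \<integral>v. h v *\<^sub>R cis (\<xi> * v) \<partial>lborel)"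
    unfolding F_def by (intro ext fourier_eq_lborel fm h)
  have hc: "integrable lborel (\<lambda>v. h v *\<^sub>R cis (\<xi> * v))" for \<xi>
    by (rule Bochner_Integration.integrable_bound[OF h(4)]) auto
  show "F t 0 = mass" unfolding Fh using h(5) by (simp add: scaleR_conv_of_real)
  show "norm (F t \<xi>) \<le> mass"
    unfolding Fh using integral_norm_bound[of lborel "\<lambda>v. h v *\<^sub>R cis (\<xi> * v)"] h(2,5) by simp
  have "norm (F t \<xi> - F t \<zeta>) = norm (\<integral>v. h v *\<^sub>R cis (\<xi> * v) - h v *\<^sub>R cis (\<zeta> * v) \<partial>lborel)"
    unfolding Fh using hc by simp
  also have "\<dots> \<le> (\<integral>v. \<bar>h v\<bar> * \<bar>v\<bar> * \<bar>\<xi> - \<zeta>\<bar> \<partial>lborel)"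
  proof (rule Bochner_Integration.integral_norm_bound_integral)
    show "integrable lborel (\<lambda>v. h v *\<^sub>R cis (\<xi> * v) - h v *\<^sub>R cis (\<zeta> * v))"
      by (intro Bochner_Integration.integrable_diff hc)
    show "integrable lborel (\<lambda>v. \<bar>h v\<bar> * \<bar>v\<bar> * \<bar>\<xi> - \<zeta>\<bar>)"
      using h(6) by (intro integrable_mult_left)
    show "norm (h v *\<^sub>R cis (\<xi> * v) - h v *\<^sub>R cis (\<zeta> * v)) \<le> \<bar>h v\<bar> * \<bar>v\<bar> * \<bar>\<xi> - \<zeta>\<bar>" for v
    proof -
      have "norm (h v *\<^sub>R cis (\<xi> * v) - h v *\<^sub>R cis (\<zeta> * v)) = \<bar>h v\<bar> * norm (cis (v * \<xi>) - cis (v * \<zeta>))"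
        unfolding scaleR_diff_right[symmetric] norm_scaleR by (simp add: mult.commute)
      also have "\<dots> \<le> \<bar>h v\<bar> * (\<bar>v\<bar> * \<bar>\<xi> - \<zeta>\<bar>)" by (intro mult_left_mono norm_cis_diff_le) auto
      finally show ?thesis by (simp add: mult.assoc)
    qed
  qed
  also have "\<dots> \<le> (mass + energy) * \<bar>\<xi> - \<zeta>\<bar>"
    using h(7) by (simp add: mult_right_mono)
  finally show "norm (F t \<xi> - F t \<zeta>) \<le> (mass + energy) * \<bar>\<xi> - \<zeta>\<bar>" .
  show "integrable lborel (bobylev (F t) \<xi>)"
    unfolding Fh by (rule collision_cis(1)[OF h(4,6)])
  have I: "integrable (lborel \<Otimes>\<^sub>M lborel) (\<lambda>(p, \<theta>). collision (\<lambda>v. cis (\<xi> * v)) h p \<theta>)"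
    by (rule collision_integrable[OF _ norm_cis_diff_le h(4,6)]) measurable
  have C: "(\<integral>z. (case z of (p, \<theta>) \<Rightarrow> collision (\<lambda>v. cis (\<xi> * v)) h p \<theta>) \<partial>(lborel \<Otimes>\<^sub>M lborel)) = (\<integral>\<theta>. bobylev (F t) \<xi> \<theta> \<partial>lborel)"
    unfolding Fh by (rule collision_cis(2)[OF h(4,6)])
  show "kac_weak_form \<beta> (f t) (\<lambda>v. cos (\<xi> * v)) = Re (\<integral>\<theta>. bobylev (F t) \<xi> \<theta> \<partial>lborel)"
    unfolding C[symmetric] integral_Re[OF I, symmetric]
    by (subst kac_weak_form_eq[OF h(4,6,3) _ cos_lipschitz])
      (auto intro!: Bochner_Integration.integral_cong simp: collision_def)
  show "kac_weak_form \<beta> (f t) (\<lambda>v. sin (\<xi> * v)) = Im (\<integral>\<theta>. bobylev (F t) \<xi> \<theta> \<partial>lborel)"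
    unfolding C[symmetric] integral_Im[OF I, symmetric]
    by (subst kac_weak_form_eq[OF h(4,6,3) _ sin_lipschitz])
      (auto intro!: Bochner_Integration.integral_cong simp: collision_def)
  have "(\<lambda>v. cis (\<xi> * v)) \<in> borel_measurable lborel" by measurable
  then have "(\<lambda>v. f t v *\<^sub>R cis (\<xi> * v)) \<in> borel_measurable lebesgue"
    by (intro borel_measurable_scaleR fm measurable_completion)
  then have fi: "integrable lebesgue (\<lambda>v. f t v *\<^sub>R cis (\<xi> * v))"
    by (rule Bochner_Integration.integrable_bound[OF solution(2)[OF t]]) auto
  show "Re (F t \<xi>) = (LINT v|lebesgue. f t v * cos (\<xi> * v))"
    unfolding F_def fourier_def integral_Re[OF fi, symmetric] by simp
  show "Im (F t \<xi>) = (LINT v|lebesgue. f t v * sin (\<xi> * v))"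
    unfolding F_def fourier_def integral_Im[OF fi, symmetric] by simp
qed

lemma F_time_lipschitz:
  assumes "t \<in> {0..T}" "t' \<in> {0..T}"
  shows "norm (F t' \<xi> - F t \<xi>) \<le> 2 * \<bar>\<xi>\<bar> * K * \<bar>t' - t\<bar>"
proof -
  have *: "norm (F t' \<xi> - F t \<xi>) \<le> 2 * \<bar>\<xi>\<bar> * K * \<bar>t' - t\<bar>" if t: "0 \<le> t" "t \<le> t'" "t' \<le> T" for t t'
  proof -
    have "\<bar>Re (F t' \<xi> - F t \<xi>)\<bar> \<le> \<bar>\<xi>\<bar> * K * (t' - t)"
      using time_lipschitz[OF t smooth_gen.cos abs_cos_le_one cos_lipschitz] t by (simp add: F_bounds(7))
    moreover have "\<bar>Im (F t' \<xi> - F t \<xi>)\<bar> \<le> \<bar>\<xi>\<bar> * K * (t' - t)"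
      using time_lipschitz[OF t smooth_gen.sin abs_sin_le_one sin_lipschitz] t by (simp add: F_bounds(8))
    ultimately show ?thesis using cmod_le[of "F t' \<xi> - F t \<xi>"] t by simp
  qed
  show ?thesis
  proof (cases "t \<le> t'")
    case True then show ?thesis using *[of t t'] assms by simp
  next
    case False then show ?thesis using *[of t' t] assms by (simp add: norm_minus_commute abs_minus_commute)
  qed
qed

text \<open>One moves in frequency at the current time, where the Lipschitz constant is uniform, and
  then in time at the fixed frequency \<open>\<xi>0\<close>. Joint continuity is what makes the
  contact set of the maximum principle compact.\<close>

lemma F_continuous: "continuous_on ({0..T} \<times> UNIV) (\<lambda>(t, \<xi>). F t \<xi>)"
  unfolding continuous_on_def
proof
  fix x assume x: "x \<in> {0..T} \<times> (UNIV :: real set)"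
  obtain t0 \<xi>0 where x0: "x = (t0, \<xi>0)" by force
  let ?b = "\<lambda>y. (mass + energy) * \<bar>snd y - \<xi>0\<bar> + 2 * \<bar>\<xi>0\<bar> * K * \<bar>fst y - t0\<bar>"
  have "(?b \<longlongrightarrow> (mass + energy) * \<bar>snd x - \<xi>0\<bar> + 2 * \<bar>\<xi>0\<bar> * K * \<bar>fst x - t0\<bar>) (at x within {0..T} \<times> UNIV)"
    by (intro tendsto_intros)
  then have b0: "(?b \<longlongrightarrow> 0) (at x within {0..T} \<times> UNIV)" by (simp add: x0)
  have "\<forall>\<^sub>F y in at x within {0..T} \<times> UNIV. norm ((\<lambda>(t, \<xi>). F t \<xi>) y - F t0 \<xi>0) \<le> ?b y"
    unfolding eventually_at_filter
  proof (intro always_eventually allI impI)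
    fix y assume y: "y \<in> {0..T} \<times> (UNIV :: real set)"
    obtain t \<xi> where y0: "y = (t, \<xi>)" by force
    have "norm (F t \<xi> - F t0 \<xi>0) \<le> norm (F t \<xi> - F t \<xi>0) + norm (F t \<xi>0 - F t0 \<xi>0)"
      using norm_triangle_ineq[of "F t \<xi> - F t \<xi>0" "F t \<xi>0 - F t0 \<xi>0"] by simp
    also have "\<dots> \<le> ?b y"
      using F_bounds(3)[of t \<xi> \<xi>0] F_time_lipschitz[of t0 t \<xi>0] x y by (simp add: x0 y0)
    finally show "norm ((\<lambda>(t, \<xi>). F t \<xi>) y - F t0 \<xi>0) \<le> ?b y" by (simp add: y0)
  qed
  then have "((\<lambda>y. (\<lambda>(t, \<xi>). F t \<xi>) y - F t0 \<xi>0) \<longlongrightarrow> 0) (at x within {0..T} \<times> UNIV)"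
    by (rule Lim_null_comparison[OF _ b0])
  then show "((\<lambda>(t, \<xi>). F t \<xi>) \<longlongrightarrow> (\<lambda>(t, \<xi>). F t \<xi>) x) (at x within {0..T} \<times> UNIV)"
    by (simp add: x0 LIM_zero_iff)
qed

text \<open>The difference of products telescopes: \<open>\<xi> * cos \<theta>\<close> is within
  \<open>|\<xi>| * |sin \<theta>|\<close> of \<open>\<xi>\<close>, and the sine frequency within the
  same distance of 0. Uniformity in time makes the bound a dominating function in
  \<open>F_derivative\<close>.\<close>

lemma norm_bobylev_le:
  assumes t: "t \<in> {0..T}"
  shows "norm (bobylev (F t) \<xi> \<theta>) \<le> 2 * mass * (mass + energy) * \<bar>\<xi>\<bar> * (b \<theta> * \<bar>sin \<theta>\<bar>)"
proof (cases "\<theta> \<in> {- pi / 2..pi / 2}")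
  case True
  define M where "M = mass + energy"
  have M0: "0 \<le> M" unfolding M_def using mass_nonneg energy_nonneg by simp
  let ?c = "F t (\<xi> * cos \<theta>)" and ?s = "F t (- (\<xi> * sin \<theta>))"
  have e: "?c * ?s - F t 0 * F t \<xi> = (?c - F t \<xi>) * ?s + F t \<xi> * (?s - F t 0)"
    by (simp add: algebra_simps)
  have "norm (?c - F t \<xi>) \<le> M * \<bar>\<xi> * cos \<theta> - \<xi>\<bar>" using F_bounds(3)[OF t] unfolding M_def .
  also have "\<bar>\<xi> * cos \<theta> - \<xi>\<bar> = \<bar>\<xi>\<bar> * \<bar>cos \<theta> - 1\<bar>"
    unfolding abs_mult[symmetric] by (simp add: algebra_simps)
  also have "M * (\<bar>\<xi>\<bar> * \<bar>cos \<theta> - 1\<bar>) \<le> M * (\<bar>\<xi>\<bar> * \<bar>sin \<theta>\<bar>)"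
    using one_minus_cos_le_abs_sin[OF True] M0 by (intro mult_left_mono) auto
  finally have 1: "norm (?c - F t \<xi>) \<le> M * (\<bar>\<xi>\<bar> * \<bar>sin \<theta>\<bar>)" .
  have 2: "norm (?s - F t 0) \<le> M * (\<bar>\<xi>\<bar> * \<bar>sin \<theta>\<bar>)"
    using F_bounds(3)[OF t, of "- (\<xi> * sin \<theta>)" 0] unfolding M_def by (simp add: abs_mult)
  have "norm (?c * ?s - F t 0 * F t \<xi>) \<le> norm (?c - F t \<xi>) * norm ?s + norm (F t \<xi>) * norm (?s - F t 0)"
    unfolding e norm_mult[symmetric] by (rule norm_triangle_ineq)
  also have "\<dots> \<le> M * (\<bar>\<xi>\<bar> * \<bar>sin \<theta>\<bar>) * mass + mass * (M * (\<bar>\<xi>\<bar> * \<bar>sin \<theta>\<bar>))"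
    using 1 2 F_bounds(2)[OF t] M0 mass_nonneg by (intro add_mono mult_mono) auto
  also have "\<dots> = 2 * mass * M * \<bar>\<xi>\<bar> * \<bar>sin \<theta>\<bar>" by simp
  finally have "b \<theta> * norm (?c * ?s - F t 0 * F t \<xi>) \<le> b \<theta> * (2 * mass * M * \<bar>\<xi>\<bar> * \<bar>sin \<theta>\<bar>)"
    by (intro mult_left_mono b_nonneg)
  then show ?thesis
    unfolding bobylev_def norm_scaleR by (simp add: b_nonneg M_def ac_simps)
qed (simp add: bobylev_def b_eq_0)

text \<open>The weak equation expresses \<open>F\<close> as a time integral. Dominated convergence
  makes its integrand \<open>Q\<close> continuous in time, so the fundamental theorem gives a
  derivative at every time, one-sided at the endpoints.\<close>

lemma F_derivative:
  assumes t: "t \<in> {0..T}"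
  shows "((\<lambda>t. F t \<xi>) has_vector_derivative (\<integral>\<theta>. bobylev (F t) \<xi> \<theta> \<partial>lborel)) (at t within {0..T})"
proof -
  define Q where "Q t = (\<integral>\<theta>. bobylev (F t) \<xi> \<theta> \<partial>lborel)" for t
  have Qc: "continuous_on {0..T} Q"
  proof (rule continuous_on_sequentiallyI)
    fix u a assume u: "\<forall>n. u n \<in> {0..T}" and a: "a \<in> {0..T}" and lim: "u \<longlonglongrightarrow> a"
    have Fl: "(\<lambda>n. F (u n) \<zeta>) \<longlonglongrightarrow> F a \<zeta>" for \<zeta>
    proof -
      have "(\<lambda>n. (u n, \<zeta>)) \<longlonglongrightarrow> (a, \<zeta>)" by (intro tendsto_intros lim)
      then show ?thesis
        using continuous_on_tendsto_compose[OF F_continuous, of "\<lambda>n. (u n, \<zeta>)" "(a, \<zeta>)" sequentially] u a by simp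
    qed
    show "(\<lambda>n. Q (u n)) \<longlonglongrightarrow> Q a"
      unfolding Q_def
    proof (rule integral_dominated_convergence[where w = "\<lambda>\<theta>. 2 * mass * (mass + energy) * \<bar>\<xi>\<bar> * (b \<theta> * \<bar>sin \<theta>\<bar>)"])
      show "bobylev (F a) \<xi> \<in> borel_measurable lborel" "\<And>n. bobylev (F (u n)) \<xi> \<in> borel_measurable lborel"
        using F_bounds(4) a u by (simp_all only: borel_measurable_integrable)
      show "integrable lborel (\<lambda>\<theta>. 2 * mass * (mass + energy) * \<bar>\<xi>\<bar> * (b \<theta> * \<bar>sin \<theta>\<bar>))"
        by (intro integrable_mult_right b_sin_integrable)
      show "AE \<theta> in lborel. (\<lambda>n. bobylev (F (u n)) \<xi> \<theta>) \<longlonglongrightarrow> bobylev (F a) \<xi> \<theta>"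
        unfolding bobylev_def by (intro AE_I2 tendsto_intros Fl)
      show "AE \<theta> in lborel. norm (bobylev (F (u n)) \<xi> \<theta>) \<le> 2 * mass * (mass + energy) * \<bar>\<xi>\<bar> * (b \<theta> * \<bar>sin \<theta>\<bar>)" for n
        using norm_bobylev_le u by (intro AE_I2) blast
    qed
  qed
  have D: "((\<lambda>t. LINT v|lebesgue. f t v * \<phi> v) has_real_derivative q t) (at t within {0..T})"
    if \<phi>: "\<phi> \<in> smooth_gen" "\<And>x. \<bar>\<phi> x\<bar> \<le> 1" "\<And>x y. norm (\<phi> x - \<phi> y) \<le> \<bar>\<xi>\<bar> * \<bar>x - y\<bar>"
      and q: "\<And>\<tau>. \<tau> \<in> {0..T} \<Longrightarrow> kac_weak_form \<beta> (f \<tau>) \<phi> = q \<tau>" "continuous_on {0..T} q" for \<phi> q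
  proof -
    have "((\<lambda>t. integral {0..t} q + (LINT v|lebesgue. f0 v * \<phi> v)) has_vector_derivative q t) (at t within {0..T})"
      using integral_has_vector_derivative[OF q(2) t] by (simp add: has_vector_derivative_add_const)
    moreover have "(LINT v|lebesgue. f r v * \<phi> v) = integral {0..r} q + (LINT v|lebesgue. f0 v * \<phi> v)" if r: "r \<in> {0..T}" for r
    proof -
      have "set_integrable lebesgue {0..r} (\<lambda>\<tau>. kac_weak_form \<beta> (f \<tau>) \<phi>)"
        by (rule kac_weak_form_integrable[OF smooth_gen_measurable[OF \<phi>(1)] \<phi>(3)]) (use r in auto)
      from set_lebesgue_integral_eq_integral(2)[OF this]
      have "(LINT \<tau>:{0..r}|lebesgue. kac_weak_form \<beta> (f \<tau>) \<phi>) = integral {0..r} (\<lambda>\<tau>. kac_weak_form \<beta> (f \<tau>) \<phi>)" .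
      also have "\<dots> = integral {0..r} q" by (rule integral_cong) (use q(1) r in auto)
      finally show ?thesis using weak_equation_smooth[OF r \<phi>] by simp
    qed
    ultimately show ?thesis
      unfolding has_real_derivative_iff_has_vector_derivative
      by (rule has_vector_derivative_transform[OF t, rotated]) auto
  qed
  have "((\<lambda>t. Re (F t \<xi>)) has_real_derivative Re (Q t)) (at t within {0..T})"
  proof (rule has_field_derivative_transform_within[OF _ zero_less_one t])
    show "((\<lambda>t. LINT v|lebesgue. f t v * cos (\<xi> * v)) has_real_derivative Re (Q t)) (at t within {0..T})"
      by (rule D[of "\<lambda>v. cos (\<xi> * v)" "\<lambda>t. Re (Q t)"])
        (auto simp: Q_def F_bounds(5) smooth_gen.cos cos_lipschitz[unfolded real_norm_def] intro!: continuous_intros Qc[unfolded Q_def])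
  qed (simp add: F_bounds(7))
  moreover have "((\<lambda>t. Im (F t \<xi>)) has_real_derivative Im (Q t)) (at t within {0..T})"
  proof (rule has_field_derivative_transform_within[OF _ zero_less_one t])
    show "((\<lambda>t. LINT v|lebesgue. f t v * sin (\<xi> * v)) has_real_derivative Im (Q t)) (at t within {0..T})"
      by (rule D[of "\<lambda>v. sin (\<xi> * v)" "\<lambda>t. Im (Q t)"])
        (auto simp: Q_def F_bounds(6) smooth_gen.sin sin_lipschitz[unfolded real_norm_def] intro!: continuous_intros Qc[unfolded Q_def])
  qed (simp add: F_bounds(8))
  ultimately show ?thesis unfolding has_vector_derivative_complex_iff Q_def by blast
qed

end

section \<open>The spectral gap for short times\<close>

text \<open>On \<open>[0, 1]\<close> the cosine is at least \<open>1 / 2\<close>, as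
  \<open>1 < pi / 3\<close>; integrating once gives \<open>sin y \<ge> y / 2\<close>, and once more
  the claim.\<close>

lemma one_minus_cos_ge:
  fixes x :: real
  assumes "\<bar>x\<bar> \<le> 1"
  shows "x\<^sup>2 / 4 \<le> 1 - cos x"
proof -
  have half: "1 / 2 \<le> cos y" if "0 \<le> y" "y \<le> 1" for y :: real
    using cos_monotone_0_pi_le[of y "pi / 3"] that pi_gt3 by (simp add: cos_60)
  have sin: "y / 2 \<le> sin y" if y: "0 \<le> y" "y \<le> 1" for y :: real
  proof -
    have "sin 0 - 0 / 2 \<le> sin y - y / 2"
    proof (rule DERIV_nonneg_imp_nondecreasing[OF y(1)])
      fix z assume "0 \<le> z" "z \<le> y"
      then show "\<exists>d. ((\<lambda>y. sin y - y / 2) has_real_derivative d) (at z) \<and> 0 \<le> d"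
        using half[of z] y by (intro exI[of _ "cos z - 1 / 2"]) (auto intro!: derivative_eq_intros)
    qed
    then show ?thesis by simp
  qed
  have "1 - cos 0 - 0\<^sup>2 / 4 \<le> 1 - cos \<bar>x\<bar> - \<bar>x\<bar>\<^sup>2 / 4"
  proof (rule DERIV_nonneg_imp_nondecreasing[OF abs_ge_zero])
    fix z assume "0 \<le> z" "z \<le> \<bar>x\<bar>"
    then show "\<exists>d. ((\<lambda>y. 1 - cos y - y\<^sup>2 / 4) has_real_derivative d) (at z) \<and> 0 \<le> d"
      using sin[of z] assms by (intro exI[of _ "sin z - z / 2"]) (auto intro!: derivative_eq_intros)
  qed
  then show ?thesis by simp
qed

text \<open>The bump is positive on the open interval, so a vanishing integral would force
  \<open>g\<close> to vanish almost everywhere between \<open>l\<close> and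
  \<open>r\<close>.\<close>

lemma integral_bump_pos:
  fixes g :: "real \<Rightarrow> real"
  assumes g: "integrable lebesgue g" and pos: "AE v in lebesgue. 0 \<le> g v"
    and I: "0 < integral {l..r} g"
  shows "0 < (LINT v|lebesgue. g v * bump l r v)"
proof (rule ccontr)
  assume neg: "\<not> ?thesis"
  have "continuous_on UNIV (bump l r)"
    by (metis DERIV_continuous continuous_at_imp_continuous_on smooth_gen_derivative[OF bump_smooth_gen])
  then have "bump l r \<in> borel_measurable lborel" using borel_measurable_continuous_onI by simp
  then have bm: "bump l r \<in> borel_measurable lebesgue" by (rule measurable_completion)
  have gi: "integrable lebesgue (\<lambda>v. g v * bump l r v)"
    by (rule Bochner_Integration.integrable_bound[OF g])
      (use bump_bounds g bm borel_measurable_integrable[OF g] in \<open>auto simp: abs_mult intro!: mult_left_le\<close>)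
  have nn: "AE v in lebesgue. 0 \<le> g v * bump l r v"
    using pos by eventually_elim (simp add: bump_bounds)
  have "(LINT v|lebesgue. g v * bump l r v) = 0"
    using neg integral_nonneg_AE[OF nn] by simp
  then have z: "AE v in lebesgue. g v * bump l r v = 0"
    using integral_nonneg_eq_0_iff_AE[OF gi nn] by simp
  have "AE v in lebesgue. v \<noteq> l" "AE v in lebesgue. v \<noteq> r"
    by (auto intro!: AE_completion AE_lborel_singleton)
  with z have "AE v in lebesgue. indicator {l..r} v *\<^sub>R g v = 0"
  proof eventually_elim
    case (elim v)
    then show ?case using bump_pos[of l v r] by (cases "v \<in> {l..r}") auto
  qed
  then have "(LINT v:{l..r}|lebesgue. g v) = 0"
    unfolding set_lebesgue_integral_def by (rule integral_eq_zero_AE)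
  moreover have "set_integrable lebesgue {l..r} g"
    unfolding set_integrable_def by (intro integrable_mult_indicator g) simp
  ultimately show False using I set_lebesgue_integral_eq_integral(2)[of "{l..r}" g] by simp
qed

text \<open>The cumulative integral from \<open>- N\<close> is continuous, so it takes the values
  one third and two thirds of its total. Cutting there leaves a third of the mass on either side and
  a third in between, which keeps the two pieces apart.\<close>

lemma separated_bumps:
  fixes g :: "real \<Rightarrow> real"
  assumes g: "integrable lebesgue g" and pos: "AE v in lebesgue. 0 \<le> g v"
    and I: "0 < (LINT v|lebesgue. g v)"
  obtains N x y where "0 < N" "- N \<le> x" "x < y" "y \<le> N"
    "0 < (LINT v|lebesgue. g v * bump (- N) x v)" "0 < (LINT v|lebesgue. g v * bump y N v)"
proof -
  have si: "set_integrable lebesgue {a..c} g" for a c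
    unfolding set_integrable_def by (intro integrable_mult_indicator g) simp
  have eq: "(LINT v:{a..c}|lebesgue. g v) = integral {a..c} g" for a c
    using set_lebesgue_integral_eq_integral(2)[OF si] .
  have int: "g integrable_on {a..c}" for a c
    using set_lebesgue_integral_eq_integral(1)[OF si] .
  have nn: "0 \<le> integral {a..c} g" for a c
    unfolding eq[symmetric] set_lebesgue_integral_def
    by (rule integral_nonneg_AE) (use pos in \<open>eventually_elim, simp\<close>)
  have "(\<lambda>n. LINT v|lebesgue. indicator {- real n..real n} v *\<^sub>R g v) \<longlonglongrightarrow> (LINT v|lebesgue. g v)"
  proof (rule integral_dominated_convergence[where w = "\<lambda>v. \<bar>g v\<bar>"])
    show "AE v in lebesgue. (\<lambda>n. indicator {- real n..real n} v *\<^sub>R g v) \<longlonglongrightarrow> g v"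
    proof (intro AE_I2 tendsto_eventually)
      fix v :: real
      obtain n0 :: nat where "\<bar>v\<bar> \<le> real n0" using real_arch_simple by blast
      then show "\<forall>\<^sub>F n in sequentially. indicator {- real n..real n} v *\<^sub>R g v = g v"
        by (intro eventually_sequentiallyI[of n0]) (auto simp: indicator_def abs_le_iff)
    qed
  qed (use g si[unfolded set_integrable_def] in \<open>auto intro: borel_measurable_integrable simp: indicator_def\<close>)
  from order_tendstoD(1)[OF this I]
  obtain n0 where "\<And>n. n0 \<le> n \<Longrightarrow> 0 < (LINT v|lebesgue. indicator {- real n..real n} v *\<^sub>R g v)"
    unfolding eventually_sequentially by blast
  from this[of "Suc n0"] have M0: "0 < integral {- real (Suc n0)..real (Suc n0)} g"
    using eq unfolding set_lebesgue_integral_def by simp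
  define N where "N = real (Suc n0)"
  define M where "M = integral {- N..N} g"
  have N: "0 < N" and M: "0 < M" using M0 by (auto simp: N_def M_def)
  have c: "continuous_on {- N..N} (\<lambda>x. integral {- N..x} g)"
    by (rule indefinite_integral_continuous_1[OF int])
  obtain x where x: "- N \<le> x" "x \<le> N" "integral {- N..x} g = M / 3"
    using IVT'[of "\<lambda>x. integral {- N..x} g" "- N" "M / 3" N] c N M by (auto simp: M_def)
  obtain y where y: "- N \<le> y" "y \<le> N" "integral {- N..y} g = 2 * M / 3"
    using IVT'[of "\<lambda>x. integral {- N..x} g" "- N" "2 * M / 3" N] c N M by (auto simp: M_def)
  have "x < y"
  proof (rule ccontr)
    assume "\<not> x < y"
    then have "integral {- N..y} g + integral {y..x} g = integral {- N..x} g"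
      using y int by (intro Henstock_Kurzweil_Integration.integral_combine) auto
    then show False using nn[of y x] x y M by simp
  qed
  have "integral {- N..y} g + integral {y..N} g = M"
    unfolding M_def using y int by (intro Henstock_Kurzweil_Integration.integral_combine) auto
  then have "0 < integral {y..N} g" using y M by simp
  moreover have "0 < integral {- N..x} g" using x M by simp
  ultimately show ?thesis
    using that[of N x y] N x y \<open>x < y\<close> integral_bump_pos[OF g pos] by blast
qed

context kac_flow
begin

text \<open>The difference \<open>mass\<^sup>2 - |F|\<^sup>2\<close> is the double integral of
  \<open>h v * h w * (1 - cos (\<xi> * (v - w)))\<close>, whose integrand is nonnegative. Pairs
  taken from two separated bumps already contribute an amount of order
  \<open>\<xi>\<^sup>2\<close>.\<close>

lemma spectral_gap:
  assumes f0_nonneg: "AE v in lebesgue. 0 \<le> f0 v" and mass_pos: "0 < mass"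
  obtains T' \<delta> \<eta> where "0 < T'" "T' \<le> T" "0 < \<delta>" "0 < \<eta>"
    "\<And>t \<xi>. t \<in> {0..T'} \<Longrightarrow> \<bar>\<xi>\<bar> \<le> \<eta> \<Longrightarrow> norm (F t \<xi>) \<le> mass - \<delta> * \<xi>\<^sup>2"
proof -
  obtain N x y where N: "0 < N" "- N \<le> x" "x < y" "y \<le> N"
    and A: "0 < (LINT v|lebesgue. f0 v * bump (- N) x v)" "0 < (LINT v|lebesgue. f0 v * bump y N v)"
    using separated_bumps[OF f0_integrable f0_nonneg] mass_pos unfolding mass_def by blast
  define A1 where "A1 = (LINT v|lebesgue. f0 v * bump (- N) x v)"
  define A2 where "A2 = (LINT v|lebesgue. f0 v * bump y N v)"
  have A0: "0 < A1" "0 < A2" using A by (auto simp: A1_def A2_def)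
  \<comment> \<open>Bump averages move at speed at most \<open>4 * K\<close>, so up to
    \<open>T'\<close> they lose at most half of \<open>min A1 A2\<close>. The summand 1 covers
    \<open>K = 0\<close>.\<close>
  define T' where "T' = min T (min A1 A2 / (2 * (4 * K + 1)))"
  define d where "d = y - x"
  \<comment> \<open>Points of the two bumps are at most \<open>2 * N\<close> apart, so this gives
    \<open>|\<xi> * (v - w)| \<le> 1\<close>, as \<open>one_minus_cos_ge\<close> requires.\<close>
  define \<eta> where "\<eta> = 1 / (2 * N)"
  \<comment> \<open>Two halved averages and the \<open>1 / 4\<close> from the cosine give
    \<open>d\<^sup>2 * A1 * A2 / 16\<close>; the remaining \<open>2 * mass\<close> comes from
    factoring \<open>mass\<^sup>2 - |F|\<^sup>2\<close>.\<close>
  define \<delta> where "\<delta> = d\<^sup>2 * A1 * A2 / (32 * mass)"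
  have d: "0 < d" using N by (simp add: d_def)
  have T': "0 < T'" "T' \<le> T" using T A0 K_nonneg by (auto simp: T'_def)
  have \<delta>: "0 < \<delta>" using d A0 mass_pos by (simp add: \<delta>_def)
  have \<eta>: "0 < \<eta>" using N by (simp add: \<eta>_def)
  have stay: "A / 2 \<le> (LINT v|lebesgue. f t v * bump l r v)"
    if A: "A = (LINT v|lebesgue. f0 v * bump l r v)" "min A1 A2 \<le> A" and t: "t \<in> {0..T'}" for A l r t
  proof -
    have b: "\<bar>bump l r v\<bar> \<le> 1" for v using bump_bounds[of l r v] by simp
    have L: "norm (bump l r v - bump l r w) \<le> 4 * \<bar>v - w\<bar>" for v w using bump_lipschitz by simp
    have t0: "t \<in> {0..T}" "0 \<in> {0..T}" using t T' T by auto
    \<comment> \<open>The initial condition is contained in the weak equation at time 0, where the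
      time integral runs over a single point.\<close>
    have z: "(LINT \<tau>:{0..0}|lebesgue. kac_weak_form \<beta> (f \<tau>) (bump l r)) = 0"
      using set_lebesgue_integral_eq_integral(2)[OF kac_weak_form_integrable[OF smooth_gen_measurable[OF bump_smooth_gen] L, of 0 0]] T
      by simp
    have "(LINT v|lebesgue. f 0 v * bump l r v) = A"
      using weak_equation_smooth[OF t0(2) bump_smooth_gen b L] A(1) unfolding z by simp
    moreover have "\<bar>(LINT v|lebesgue. f t v * bump l r v) - (LINT v|lebesgue. f 0 v * bump l r v)\<bar> \<le> 4 * K * (t - 0)"
      by (rule time_lipschitz[OF _ _ _ bump_smooth_gen b L]) (use t0 in auto)
    moreover have "4 * K * t \<le> min A1 A2 / 2"
    proof -
      have "4 * K * t \<le> (4 * K + 1) * (min A1 A2 / (2 * (4 * K + 1)))"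
        using t K_nonneg by (intro mult_mono) (auto simp: T'_def)
      also have "\<dots> = min A1 A2 / 2"
        using K_nonneg by (simp add: field_simps)
      finally show ?thesis .
    qed
    ultimately show ?thesis using A(2) unfolding abs_le_iff diff_zero by linarith
  qed
  have "norm (F t \<xi>) \<le> mass - \<delta> * \<xi>\<^sup>2" if t: "t \<in> {0..T'}" and \<xi>: "\<bar>\<xi>\<bar> \<le> \<eta>" for t \<xi>
  proof -
    have tT: "t \<in> {0..T}" using t T' by auto
    obtain h where h: "h \<in> borel_measurable borel" "\<And>v. 0 \<le> h v" "AE v in lborel. f t v = h v"
      "integrable lborel h" "(\<integral>v. h v \<partial>lborel) = mass"
      "integrable lborel (\<lambda>v. \<bar>h v\<bar> * \<bar>v\<bar>)" "(\<integral>v. \<bar>h v\<bar> * \<bar>v\<bar> \<partial>lborel) \<le> mass + energy"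
      by (rule borel_representative[OF tT]) blast
    have hm[measurable]: "h \<in> borel_measurable borel" by (rule h(1))
    have fm: "f t \<in> borel_measurable lebesgue" using solution(2)[OF tT] by (rule borel_measurable_integrable)
    have bm[measurable]: "bump l r \<in> borel_measurable borel" for l r by (rule smooth_gen_measurable[OF bump_smooth_gen])
    have bl: "bump l r \<in> borel_measurable lebesgue" for l r by (rule measurable_completion) simp
    have hb: "integrable lborel (\<lambda>v. h v * bump l r v)" for l r
      by (rule Bochner_Integration.integrable_bound[OF h(4)])
        (use bump_bounds[of l r] h(2) in \<open>auto simp: abs_mult intro!: mult_left_le\<close>)
    have hbI: "(\<integral>v. h v * bump l r v \<partial>lborel) = (LINT v|lebesgue. f t v * bump l r v)" for l r
      by (rule integral_lebesgue_eq_lborel[symmetric]) (use fm bl h(3) in auto)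
    have B1: "A1 / 2 \<le> (\<integral>v. h v * bump (- N) x v \<partial>lborel)" unfolding hbI
      by (rule stay[OF A1_def _ t]) simp
    have B2: "A2 / 2 \<le> (\<integral>v. h v * bump y N v \<partial>lborel)" unfolding hbI
      by (rule stay[OF A2_def _ t]) simp
    have Fh: "F t \<xi> = (\<integral>v. complex_of_real (h v) * cis (\<xi> * v) \<partial>lborel)"
      unfolding F_def fourier_eq_lborel[OF fm h(1,3)] by (simp add: scaleR_conv_of_real)
    have hc: "integrable lborel (\<lambda>v. complex_of_real (h v) * cis (\<xi> * v))"
      by (rule Bochner_Integration.integrable_bound[OF h(4)]) (auto simp: norm_mult)
    have hc': "integrable lborel (\<lambda>v. cnj (complex_of_real (h v) * cis (\<xi> * v)))"
      using hc by (simp only: integrable_cnj)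
    let ?P = "\<lambda>p. case p of (v, w) \<Rightarrow> complex_of_real (h v) * cis (\<xi> * v) * cnj (complex_of_real (h w) * cis (\<xi> * w))"
    have Pi: "integrable lborel ?P" using integrable_pair_mult[OF hc hc'] unfolding lborel_prod .
    have "complex_of_real ((norm (F t \<xi>))\<^sup>2) = F t \<xi> * cnj (F t \<xi>)" by (rule complex_norm_square)
    also have "\<dots> = (\<integral>p. ?P p \<partial>lborel)"
      by (simp only: integral_pair_mult[OF hc hc'] Fh Bochner_Integration.integral_cnj)
    finally have "(norm (F t \<xi>))\<^sup>2 = Re (\<integral>p. ?P p \<partial>lborel)" by (metis Re_complex_of_real)
    also have "\<dots> = (\<integral>p. Re (?P p) \<partial>lborel)" by (rule integral_Re[OF Pi, symmetric])
    finally have n2: "(norm (F t \<xi>))\<^sup>2 = (\<integral>p. Re (?P p) \<partial>lborel)" .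
    have RePi: "integrable lborel (\<lambda>p. Re (?P p))" by (rule integrable_Re[OF Pi])
    have Mi: "integrable lborel (\<lambda>p. case p of (v, w) \<Rightarrow> h v * h w)"
      using integrable_pair_mult[OF h(4) h(4)] unfolding lborel_prod .
    have M2: "mass\<^sup>2 = (\<integral>p. (case p of (v, w) \<Rightarrow> h v * h w) \<partial>lborel)"
      unfolding integral_pair_mult[OF h(4) h(4)] h(5) by (simp add: power2_eq_square)
    let ?L = "\<lambda>p. case p of (v, w) \<Rightarrow> (h v * bump (- N) x v) * (h w * bump y N w)"
    have Li: "integrable lborel ?L" using integrable_pair_mult[OF hb hb] unfolding lborel_prod .
    have pw: "\<xi>\<^sup>2 * d\<^sup>2 / 4 * ?L p \<le> (case p of (v, w) \<Rightarrow> h v * h w) - Re (?P p)" for p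
    proof -
      obtain v w where p: "p = (v, w)" by force
      have "Re (?P p) = h v * h w * Re (cis (\<xi> * v) * cnj (cis (\<xi> * w)))"
        by (simp add: p algebra_simps)
      also have "cis (\<xi> * v) * cnj (cis (\<xi> * w)) = cis (\<xi> * (v - w))"
        by (simp add: cis_cnj cis_mult algebra_simps)
      finally have R: "(case p of (v, w) \<Rightarrow> h v * h w) - Re (?P p) = h v * h w * (1 - cos (\<xi> * (v - w)))"
        by (simp add: p algebra_simps)
      have "bump (- N) x v * bump y N w * (\<xi>\<^sup>2 * d\<^sup>2 / 4) \<le> 1 - cos (\<xi> * (v - w))"
      proof (cases "v \<in> {- N<..<x} \<and> w \<in> {y<..<N}")
        case True
        then have vw: "d \<le> \<bar>v - w\<bar>" "\<bar>v - w\<bar> \<le> 2 * N" using N by (auto simp: d_def)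
        have "\<bar>\<xi> * (v - w)\<bar> \<le> \<eta> * (2 * N)"
          unfolding abs_mult using vw \<xi> \<eta> by (intro mult_mono) auto
        then have "(\<xi> * (v - w))\<^sup>2 / 4 \<le> 1 - cos (\<xi> * (v - w))"
          using N by (intro one_minus_cos_ge) (simp add: \<eta>_def)
        moreover have "\<xi>\<^sup>2 * d\<^sup>2 \<le> (\<xi> * (v - w))\<^sup>2"
        proof -
          have "d\<^sup>2 \<le> \<bar>v - w\<bar>\<^sup>2" using vw(1) d by (intro power_mono) auto
          then show ?thesis by (simp add: power_mult_distrib mult_left_mono)
        qed
        moreover have "bump (- N) x v * bump y N w * (\<xi>\<^sup>2 * d\<^sup>2 / 4) \<le> 1 * (\<xi>\<^sup>2 * d\<^sup>2 / 4)"
          using bump_bounds by (intro mult_right_mono mult_le_one) auto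
        ultimately show ?thesis by simp
      next
        case False
        then have "bump (- N) x v = 0 \<or> bump y N w = 0" using bump_eq_0 by blast
        then show ?thesis by auto
      qed
      then have "h v * h w * (bump (- N) x v * bump y N w * (\<xi>\<^sup>2 * d\<^sup>2 / 4)) \<le> h v * h w * (1 - cos (\<xi> * (v - w)))"
        using h(2) by (intro mult_left_mono) auto
      then show ?thesis unfolding R by (simp add: p ac_simps)
    qed
    have "\<xi>\<^sup>2 * d\<^sup>2 / 4 * (A1 / 2 * (A2 / 2)) \<le> \<xi>\<^sup>2 * d\<^sup>2 / 4 * (\<integral>p. ?L p \<partial>lborel)"
      unfolding integral_pair_mult[OF hb hb] using B1 B2 A0 by (intro mult_left_mono mult_mono) auto
    also have "\<dots> = (\<integral>p. \<xi>\<^sup>2 * d\<^sup>2 / 4 * ?L p \<partial>lborel)" by (rule integral_mult_right_zero[symmetric])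
    also have "\<dots> \<le> (\<integral>p. (case p of (v, w) \<Rightarrow> h v * h w) - Re (?P p) \<partial>lborel)"
      by (rule integral_mono[OF integrable_mult_right[OF Li] Bochner_Integration.integrable_diff[OF Mi RePi] pw])
    also have "\<dots> = mass\<^sup>2 - (norm (F t \<xi>))\<^sup>2"
      unfolding Bochner_Integration.integral_diff[OF Mi RePi] n2 M2 ..
    also have "\<dots> = (mass + norm (F t \<xi>)) * (mass - norm (F t \<xi>))"
      by (simp add: power2_eq_square algebra_simps)
    also have "\<dots> \<le> (2 * mass) * (mass - norm (F t \<xi>))"
      using F_bounds(2)[OF tT, of \<xi>] by (intro mult_right_mono) auto
    finally have "\<delta> * \<xi>\<^sup>2 * (2 * mass) \<le> (2 * mass) * (mass - norm (F t \<xi>))"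
      using mass_pos by (simp add: \<delta>_def field_simps)
    then have "\<delta> * \<xi>\<^sup>2 \<le> mass - norm (F t \<xi>)" using mass_pos by (simp add: mult.commute)
    then show ?thesis by simp
  qed
  then show ?thesis using that[OF T' \<delta> \<eta>] by blast
qed

end

section \<open>Gevrey regularity of solutions\<close>

text \<open>\<open>W\<close> is supported on the angles with \<open>\<eta> / 2 \<le> |\<xi>| sin \<theta> \<le> \<eta>\<close>.\<close>
lemma kac_kernel_gain:
  fixes s C \<eta> \<xi> :: real
  assumes C: "0 < C" and s: "0 < s" "s < 1 / 2" and \<eta>: "0 < \<eta>" and \<xi>: "\<eta> \<le> \<bar>\<xi>\<bar>"
  obtains W where "integrable lborel W" "\<And>\<theta>. 0 \<le> W \<theta>"
    "\<And>\<theta>. W \<theta> \<le> indicator {- pi / 2..pi / 2} \<theta> * kac_kernel C s \<theta> * (sin \<theta>)\<^sup>2"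
    "\<And>\<theta>. W \<theta> \<noteq> 0 \<Longrightarrow> \<bar>\<xi> * sin \<theta>\<bar> \<le> \<eta>"
    "\<xi>\<^sup>2 * (\<integral>\<theta>. W \<theta> \<partial>lborel) = C * (\<eta> / 2) powr (2 - 2 * s) * \<bar>\<xi>\<bar> powr (2 * s)"
proof -
  define \<rho> where "\<rho> = \<eta> / \<bar>\<xi>\<bar>"
  have \<xi>0: "0 < \<bar>\<xi>\<bar>" using \<eta> \<xi> by simp
  have \<rho>: "0 < \<rho>" "\<rho> \<le> 1" using \<eta> \<xi> \<xi>0 by (auto simp: \<rho>_def)
  define x where "x = arcsin (\<rho> / 2)"
  define y where "y = arcsin \<rho>"
  have sx: "sin x = \<rho> / 2" and sy: "sin y = \<rho>" using \<rho> by (simp_all add: x_def y_def)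
  have x0: "0 < x" unfolding x_def using \<rho> arcsin_less_arcsin[of 0 "\<rho> / 2"] by simp
  have xy: "x \<le> y" unfolding x_def y_def using \<rho> by (intro arcsin_le_arcsin) auto
  have y1: "y \<le> pi / 2" unfolding y_def using arcsin_bounded[of \<rho>] \<rho> by simp
  have sin: "\<rho> / 2 \<le> sin \<theta>" "sin \<theta> \<le> \<rho>" "0 \<le> cos \<theta>" if \<theta>: "\<theta> \<in> {x..y}" for \<theta>
  proof -
    show "\<rho> / 2 \<le> sin \<theta>" unfolding sx[symmetric] using \<theta> x0 y1 by (intro sin_monotone_2pi_le) auto
    show "sin \<theta> \<le> \<rho>" unfolding sy[symmetric] using \<theta> x0 y1 by (intro sin_monotone_2pi_le) auto
    show "0 \<le> cos \<theta>" using \<theta> x0 y1 by (intro cos_ge_zero) auto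
  qed
  \<comment> \<open>On the support \<open>sin \<theta> \<ge> \<rho> / 2\<close>, so apart from the
    factor \<open>cos \<theta>\<close> the kernel times \<open>(sin \<theta>)\<^sup>2\<close> is at
    least \<open>k\<close>. Keeping the cosine in \<open>W\<close> makes the integral elementary:
    \<open>sin y - sin x = \<rho> / 2\<close>.\<close>
  define k where "k = C * (\<rho> / 2) powr (1 - 2 * s)"
  have k0: "0 < k" using C \<rho> by (simp add: k_def)
  define W where "W \<theta> = k * (indicator {x..y} \<theta> *\<^sub>R cos \<theta>)" for \<theta>
  have Wi: "integrable lborel W"
    unfolding W_def by (intro integrable_mult_right borel_integrable_compact continuous_intros) auto
  have WI: "(\<integral>\<theta>. W \<theta> \<partial>lborel) = k * (\<rho> / 2)"
  proof -
    have "(\<integral>\<theta>. indicator {x..y} \<theta> *\<^sub>R cos \<theta> \<partial>lborel) = sin y - sin x"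
      by (rule integral_FTC_atLeastAtMost[OF xy])
        (auto intro!: derivative_eq_intros continuous_intros simp flip: has_real_derivative_iff_has_vector_derivative)
    then show ?thesis by (simp add: W_def sx sy)
  qed
  have W0: "0 \<le> W \<theta>" for \<theta> using sin(3)[of \<theta>] k0 by (auto simp: W_def indicator_def)
  have Wb: "W \<theta> \<le> indicator {- pi / 2..pi / 2} \<theta> * kac_kernel C s \<theta> * (sin \<theta>)\<^sup>2" for \<theta>
  proof (cases "\<theta> \<in> {x..y}")
    case True
    have sp: "0 < sin \<theta>" using sin(1)[OF True] \<rho> by linarith
    have "kac_kernel C s \<theta> * (sin \<theta>)\<^sup>2 = C * cos \<theta> * (sin \<theta> powr 2 / sin \<theta> powr (1 + 2 * s))"
      using sp sin(3)[OF True] by (simp add: kac_kernel_def)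
    also have "sin \<theta> powr 2 / sin \<theta> powr (1 + 2 * s) = sin \<theta> powr (1 - 2 * s)"
      unfolding powr_diff[symmetric] by simp
    finally have "kac_kernel C s \<theta> * (sin \<theta>)\<^sup>2 = C * cos \<theta> * sin \<theta> powr (1 - 2 * s)" .
    moreover have "(\<rho> / 2) powr (1 - 2 * s) \<le> sin \<theta> powr (1 - 2 * s)"
      using sin(1)[OF True] \<rho> s by (intro powr_mono2) auto
    then have "C * cos \<theta> * (\<rho> / 2) powr (1 - 2 * s) \<le> C * cos \<theta> * sin \<theta> powr (1 - 2 * s)"
      using sin(3)[OF True] C by (intro mult_left_mono) auto
    moreover have "\<theta> \<in> {- pi / 2..pi / 2}" using True x0 y1 by auto
    ultimately show ?thesis using True by (simp add: W_def k_def ac_simps)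
  qed (simp add: W_def kac_kernel_nonneg C less_imp_le)
  have Ws: "\<bar>\<xi> * sin \<theta>\<bar> \<le> \<eta>" if "W \<theta> \<noteq> 0" for \<theta>
  proof -
    have \<theta>: "\<theta> \<in> {x..y}" using that by (auto simp: W_def indicator_def split: if_splits)
    have "\<bar>\<xi>\<bar> * \<bar>sin \<theta>\<bar> \<le> \<bar>\<xi>\<bar> * \<rho>" using sin[OF \<theta>] \<rho> by (intro mult_left_mono) auto
    then show ?thesis using \<xi>0 by (simp add: \<rho>_def abs_mult)
  qed
  \<comment> \<open>The integral of \<open>W\<close> scales like
    \<open>|\<xi>| powr (2 * s - 2)\<close>; the factor \<open>\<xi>\<^sup>2\<close> lifts it to the
    growth of the barrier exponent.\<close>
  have "k * (\<rho> / 2) = C * ((\<rho> / 2) powr (1 - 2 * s) * (\<rho> / 2) powr 1)"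
    using \<rho> by (simp add: k_def)
  also have "\<dots> = C * (\<rho> / 2) powr (2 - 2 * s)"
    unfolding powr_add[symmetric] by simp
  also have "(\<rho> / 2) powr (2 - 2 * s) = (\<eta> / 2) powr (2 - 2 * s) / \<bar>\<xi>\<bar> powr (2 - 2 * s)"
    unfolding \<rho>_def using \<eta> \<xi>0 by (subst powr_divide[symmetric]) (auto simp: field_simps)
  also have "\<bar>\<xi>\<bar> powr (2 - 2 * s) = \<xi>\<^sup>2 / \<bar>\<xi>\<bar> powr (2 * s)"
    using \<xi>0 by (simp add: powr_diff)
  finally have "\<xi>\<^sup>2 * (\<integral>\<theta>. W \<theta> \<partial>lborel) = C * (\<eta> / 2) powr (2 - 2 * s) * \<bar>\<xi>\<bar> powr (2 * s)"
    unfolding WI using \<xi>0 by simp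
  then show ?thesis using that[OF Wi W0 Wb Ws] by blast
qed

section \<open>Application to the Kac kernel\<close>

lemma angular_kernel_kac_kernel:
  assumes "0 < C" "s < 1 / 2"
  shows "angular_kernel (kac_kernel C s)"
  using assms kac_kernel_times_sin_integrable[of C s] by unfold_locales (auto simp: kac_kernel_nonneg)

lemma kac_flow_fourier_decay:
  fixes s C T :: real and f0 :: "real \<Rightarrow> real" and f :: "real \<Rightarrow> real \<Rightarrow> real"
  assumes flow: "kac_flow (kac_kernel C s) f0 T f" and C: "0 < C" and s: "0 < s" "s < 1 / 2"
    and f0_nonneg: "AE v in lebesgue. 0 \<le> f0 v" and mass_pos: "0 < (LINT v|lebesgue. f0 v)"
  obtains T' c M where "0 < T'" "T' \<le> T" "0 < c"
    "\<And>t \<xi>. t \<in> {0..T'} \<Longrightarrow> norm (fourier (f t) \<xi>) \<le> M * exp (- (c * t * ((1 + \<xi>\<^sup>2) powr s - 1)))"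
proof -
  interpret kac_flow "kac_kernel C s" f0 T f by (rule flow)
  have m: "0 < mass" using mass_pos by (simp add: mass_def)
  obtain T' \<delta> \<eta> where T': "0 < T'" "T' \<le> T" and \<delta>: "0 < \<delta>" and \<eta>: "0 < \<eta>"
    and gap: "\<And>t \<xi>. t \<in> {0..T'} \<Longrightarrow> \<bar>\<xi>\<bar> \<le> \<eta> \<Longrightarrow> norm (F t \<xi>) \<le> mass - \<delta> * \<xi>\<^sup>2"
    by (rule spectral_gap[OF f0_nonneg m]) blast
  define g where "g = C * (\<eta> / 2) powr (2 - 2 * s)"
  have g: "0 < g" using C \<eta> by (simp add: g_def)
  \<comment> \<open>The first bound gives \<open>small\<close>. The second is half of
    \<open>\<delta> / 2 * g\<close>, which leaves room for the strict inequality in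
    \<open>gain\<close>.\<close>
  define c where "c = min (\<delta> / (2 * T' * mass)) (\<delta> / 4 * g)"
  have c: "0 < c" using \<delta> T' m g by (simp add: c_def)
  have sub: "t \<in> {0..T'} \<Longrightarrow> t \<in> {0..T}" for t using T' by auto
  interpret kac_barrier "kac_kernel C s" F T' s mass c \<delta> \<eta>
  proof unfold_locales
    show "continuous_on ({0..T'} \<times> UNIV) (\<lambda>(t, \<xi>). F t \<xi>)"
      by (rule continuous_on_subset[OF F_continuous]) (use T' in auto)
    show "((\<lambda>t. F t \<xi>) has_vector_derivative (\<integral>\<theta>. bobylev (F t) \<xi> \<theta> \<partial>lborel)) (at t within {0..T'})"
      if "t \<in> {0..T'}" for t \<xi>
      by (rule has_vector_derivative_within_subset[OF F_derivative[OF sub[OF that]]]) (use T' in auto)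
    have "c * T' * mass \<le> \<delta> / (2 * T' * mass) * T' * mass"
      using T' m by (intro mult_right_mono) (auto simp: c_def)
    then show "c * T' * mass \<le> \<delta> / 2" using T' m by simp
    fix \<xi> :: real assume \<xi>: "\<eta> \<le> \<bar>\<xi>\<bar>"
    obtain W where W: "integrable lborel W" "\<And>\<theta>. 0 \<le> W \<theta>"
        "\<And>\<theta>. W \<theta> \<le> indicator {- pi / 2..pi / 2} \<theta> * kac_kernel C s \<theta> * (sin \<theta>)\<^sup>2"
        "\<And>\<theta>. W \<theta> \<noteq> 0 \<Longrightarrow> \<bar>\<xi> * sin \<theta>\<bar> \<le> \<eta>"
      and WI: "\<xi>\<^sup>2 * (\<integral>\<theta>. W \<theta> \<partial>lborel) = g * \<bar>\<xi>\<bar> powr (2 * s)"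
      unfolding g_def by (rule kac_kernel_gain[OF C s \<eta> \<xi>]) blast
    have \<xi>0: "0 < \<bar>\<xi>\<bar>" using \<eta> \<xi> by simp
    have "(1 + \<xi>\<^sup>2) powr s - 1 \<le> (\<xi>\<^sup>2) powr s"
      using s \<xi>0 by (intro powr_one_plus_le_powr) auto
    also have "(\<xi>\<^sup>2) powr s = \<bar>\<xi>\<bar> powr (2 * s)"
      using \<xi>0 by (simp add: powr_powr[symmetric])
    finally have "c * ((1 + \<xi>\<^sup>2) powr s - 1) \<le> c * \<bar>\<xi>\<bar> powr (2 * s)"
      using c by (intro mult_left_mono) auto
    also have "\<dots> < \<delta> / 2 * g * \<bar>\<xi>\<bar> powr (2 * s)"
    proof (rule mult_strict_right_mono)
      have "c \<le> \<delta> / 4 * g" by (simp add: c_def)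
      also have "\<dots> < \<delta> / 2 * g" using \<delta> g by simp
      finally show "c < \<delta> / 2 * g" .
    qed (use \<xi>0 in simp)
    also have "\<dots> = \<delta> / 2 * \<xi>\<^sup>2 * (\<integral>\<theta>. W \<theta> \<partial>lborel)"
      using WI by (simp add: mult.assoc)
    finally show "\<exists>W. integrable lborel W \<and>
        (\<forall>\<theta>. 0 \<le> W \<theta> \<and> W \<theta> \<le> b \<theta> * (sin \<theta>)\<^sup>2 \<and> (W \<theta> \<noteq> 0 \<longrightarrow> \<bar>\<xi> * sin \<theta>\<bar> \<le> \<eta>)) \<and>
        c * ((1 + \<xi>\<^sup>2) powr s - 1) < \<delta> / 2 * \<xi>\<^sup>2 * (\<integral>\<theta>. W \<theta> \<partial>lborel)"
      using W by (intro exI[of _ W]) (simp add: b_def)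
  qed (use T' s m c \<delta> \<eta> gap F_bounds[OF sub] in auto)
  show ?thesis using that[OF T' c, of mass] barrier unfolding F_def by blast
qed

lemma weighted_L1_integrable:
  assumes "g \<in> weighted_L1 l" "g \<in> borel_measurable lebesgue" "0 \<le> l"
  shows "integrable lebesgue g"
proof (rule Bochner_Integration.integrable_bound)
  show "integrable lebesgue (\<lambda>v. japanese v powr l * g v)" using assms(1) by (simp add: weighted_L1_def)
  have "1 \<le> japanese v powr l" for v
    using assms(3) by (intro ge_one_powr_ge_zero) (auto simp: japanese_def)
  then have "1 * \<bar>g v\<bar> \<le> japanese v powr l * \<bar>g v\<bar>" for v by (intro mult_right_mono) auto
  then show "AE v in lebesgue. norm (g v) \<le> norm (japanese v powr l * g v)"
    by (intro AE_I2) (simp add: abs_mult)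
qed (rule assms(2))

theorem theorem1p1:
  fixes s C0 T0 :: real and f0 :: "real \<Rightarrow> real" and f :: "real \<Rightarrow> real \<Rightarrow> real"
  assumes "0 < s" and "s < 1 / 2" and "0 < C0"
    and "f0 \<in> weighted_L1 (2 + 2 * s) \<inter> LlogL"
    and "AE v in lebesgue. 0 \<le> f0 v"
    and "\<not> (AE v in lebesgue. f0 v = 0)"
    and "0 < T0"
    and "f \<in> Linfty_L1_LlogL T0 (2 + 2 * s)"
    and "kac_weak_solution (kac_kernel C0 s) f0 T0 f"
  shows "\<forall>s'. 0 < s' \<and> s' < s \<longrightarrow>
           (\<exists>Tstar. 0 < Tstar \<and> Tstar \<le> T0 \<and>
              (\<forall>t. 0 < t \<and> t \<le> Tstar \<longrightarrow> f t \<in> gevrey (1 / (2 * s'))))"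
proof -
  have f0: "integrable lebesgue f0"
    by (rule weighted_L1_integrable[of _ "2 + 2 * s"]) (use assms in \<open>auto simp: LlogL_def\<close>)
  have "(LINT v|lebesgue. f0 v) \<noteq> 0"
    using integral_nonneg_eq_0_iff_AE[OF f0 assms(5)] assms(6) by simp
  then have mass: "0 < (LINT v|lebesgue. f0 v)"
    using integral_nonneg_AE[OF assms(5)] by simp
  have flow: "kac_flow (kac_kernel C0 s) f0 T0 f"
    using angular_kernel_kac_kernel[OF assms(3,2)] assms(7,8,9) f0
    by (simp add: kac_flow_def kac_flow_axioms_def Linfty_L1_LlogL_def)
  obtain T' c M where T': "0 < T'" "T' \<le> T0" and c: "0 < c"
    and decay: "\<And>t \<xi>. t \<in> {0..T'} \<Longrightarrow> norm (fourier (f t) \<xi>) \<le> M * exp (- (c * t * ((1 + \<xi>\<^sup>2) powr s - 1)))"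
    by (rule kac_flow_fourier_decay[OF flow assms(3,1,2,5) mass]) blast
  \<comment> \<open>The decay gives the exponent \<open>1 / (2 * s)\<close>, which is at most
    \<open>1 / (2 * s')\<close>. The factor \<open>exp (c * t)\<close> in the constant absorbs the
    summand \<open>- 1\<close> of the barrier exponent.\<close>
  have "f t \<in> gevrey (1 / (2 * s'))" if t: "0 < t" "t \<le> T'" and s': "0 < s'" "s' < s" for t s'
  proof (rule gevrey_if_fourier_decay[where p = "1 / (2 * s)" and a = "c * t" and M = "M * exp (c * t)"])
    have t0: "t \<in> {0..T0}" using t T' by auto
    interpret kac_flow "kac_kernel C0 s" f0 T0 f by (rule flow)
    show "integrable lebesgue (f t)" by (rule solution(2)[OF t0])
    show "0 < 1 / (2 * s)" "1 / (2 * s) \<le> 1 / (2 * s')" "0 < c * t"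
      using assms(1) s' c t by (auto simp: frac_le)
    have M0: "0 \<le> M" using order_trans[OF norm_ge_zero decay[of 0 0]] T' by simp
    fix \<xi> :: real
    have "\<bar>\<xi>\<bar> powr (2 * s) = (\<xi>\<^sup>2) powr s"
      by (cases "\<xi> = 0") (auto simp: powr_powr[symmetric])
    also have "\<dots> \<le> (1 + \<xi>\<^sup>2) powr s" using assms(1) by (intro powr_mono2) auto
    finally have "c * t * (\<bar>\<xi>\<bar> powr (2 * s) - 1) \<le> c * t * ((1 + \<xi>\<^sup>2) powr s - 1)"
      using c t by (intro mult_left_mono) auto
    then have "exp (- (c * t * ((1 + \<xi>\<^sup>2) powr s - 1))) \<le> exp (c * t) * exp (- (c * t * \<bar>\<xi>\<bar> powr (2 * s)))"
      unfolding exp_add[symmetric] by (simp add: algebra_simps)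
    then have "M * exp (- (c * t * ((1 + \<xi>\<^sup>2) powr s - 1))) \<le> M * (exp (c * t) * exp (- (c * t * \<bar>\<xi>\<bar> powr (2 * s))))"
      using M0 by (rule mult_left_mono)
    then show "norm (fourier (f t) \<xi>) \<le> M * exp (c * t) * exp (- (c * t * \<bar>\<xi>\<bar> powr (1 / (1 / (2 * s)))))"
      using decay[of t \<xi>] t by simp
  qed
  then show ?thesis using T' by blast
qed

end
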